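(* Let $G\subset \mathrm{GL}(V)$ be a real reductive Lie group acting linearly on the finite-dimensional real vector space $(V,\langle\cdot,\cdot\rangle)$, with $G=K\exp(\mathfrak p)$, and let $\mathcal M\subset V$ be the set of minimal vectors. Then the following holds. (i) Any orbit $G\cdot v$ containing a minimal vector $\bar v$ is closed, and moreover $G\cdot\bar v\cap\mathcal M=K\cdot\bar v$. (ii) If the orbit $G\cdot v$ is not closed, then there exists $\alpha\in\mathfrak p$ such that the limit $w=\lim_{t\to\infty}\exp(t\alpha)\cdot v$ exists, and the orbit $G\cdot w$ is closed. (iii) The closure of any orbit contains exactly one closed orbit. (iv) The null cone $\mathcal N=\{v\in V: 0\in\overline{G\cdot v}\}$ is a closed subset of $V$.
   Context: $V$ is a finite-dimensional real vector space with its usual vector space topology; closures and closedness refer to this topology, and orbits are $G$-orbits in $V$. A closed subgroup $G\subset\mathrm{GL}(V)$ with Lie algebra $\mathfrak g\subset\mathfrak{gl}(V)$ is called a real reductive Lie group if there is a scalar product $\langle\cdot,\cdot\rangle$ on $V$ such that $G=K\cdot\exp(\mathfrak p)$, where $K:=G\cap \mathrm O(V,\langle\cdot,\cdot\rangle)$, $\mathfrak p:=\mathfrak g\cap\mathrm{Sym}(V,\langle\cdot,\cdot\rangle)$, $\mathrm O(V,\langle\cdot,\cdot\rangle)$ is the group of orthogonal linear maps, $\mathrm{Sym}(V,\langle\cdot,\cdot\rangle)$ is the set of symmetric endomorphisms, and $\exp:\mathfrak{gl}(V)\to\mathrm{GL}(V)$ is the Lie exponential map. The scalar product on $V$ is fixed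 to be one with this property, with norm $\|\cdot\|$. A vector $\bar v\in G\cdot v$ is called a minimal vector if it minimizes the distance to $0\in V$ within the orbit $G\cdot v$, i.e. $\|\bar v\|\le\|g\cdot\bar v\|$ for all $g\in G$; $\mathcal M$ denotes the set of all minimal vectors in $V$. *)

theory Defs
  imports "HOL-Analysis.Analysis" "HOL-Algebra.Group"
begin

text \<open>
  The space \<open>V\<close> with its fixed scalar product is a type of class \<^class>\<open>euclidean_space\<close> with its inner
  product. Endomorphisms of \<open>V\<close> are elements of \<open>'a \<Rightarrow>\<^sub>L 'a\<close>: in finite dimension every linear map
  is bounded, and the operator norm induces the usual topology of \<open>\<gg>\<ll>(V)\<close>.
\<close>

definition End_monoid :: "('a::euclidean_space \<Rightarrow>\<^sub>L 'a) monoid" where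
  "End_monoid = \<lparr>carrier = UNIV, monoid.mult = (o\<^sub>L), one = id_blinfun\<rparr>"

definition GL :: "('a::euclidean_space \<Rightarrow>\<^sub>L 'a) monoid" where
  "GL = units_of End_monoid"

definition closed_subgroup_GL :: "('a::euclidean_space \<Rightarrow>\<^sub>L 'a) set \<Rightarrow> bool" where
  "closed_subgroup_GL G \<longleftrightarrow> subgroup G GL \<and> closedin (top_of_set (carrier GL)) G"

text \<open>The library's \<^const>\<open>exp\<close> is not available here, because \<open>'a \<Rightarrow>\<^sub>L 'a\<close> is not an instance of
  its algebra type class.\<close>

definition exp_blinfun :: "('a::euclidean_space \<Rightarrow>\<^sub>L 'a) \<Rightarrow> ('a \<Rightarrow>\<^sub>L 'a)" where
  "exp_blinfun A = (\<Sum>n. (1 / fact n) *\<^sub>R (((\<lambda>B. A o\<^sub>L B) ^^ n) id_blinfun))"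

text \<open>The Lie algebra of a closed subgroup of \<open>GL(V)\<close>, as a subset of \<open>\<gg>\<ll>(V)\<close>.\<close>

definition lie_algebra :: "('a::euclidean_space \<Rightarrow>\<^sub>L 'a) set \<Rightarrow> ('a \<Rightarrow>\<^sub>L 'a) set" where
  "lie_algebra G = {A. \<forall>t::real. exp_blinfun (t *\<^sub>R A) \<in> G}"

definition orthogonal_maps :: "('a::euclidean_space \<Rightarrow>\<^sub>L 'a) set" where
  "orthogonal_maps = {g. orthogonal_transformation (blinfun_apply g)}"

definition symmetric_maps :: "('a::euclidean_space \<Rightarrow>\<^sub>L 'a) set" where
  "symmetric_maps = {A. \<forall>x y. blinfun_apply A x \<bullet> y = x \<bullet> blinfun_apply A y}"

definition K_part :: "('a::euclidean_space \<Rightarrow>\<^sub>L 'a) set \<Rightarrow> ('a \<Rightarrow>\<^sub>L 'a) set" where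
  "K_part G = G \<inter> orthogonal_maps"

definition p_part :: "('a::euclidean_space \<Rightarrow>\<^sub>L 'a) set \<Rightarrow> ('a \<Rightarrow>\<^sub>L 'a) set" where
  "p_part G = lie_algebra G \<inter> symmetric_maps"

text \<open>Reductivity with respect to the fixed scalar product of the type.\<close>

definition real_reductive :: "('a::euclidean_space \<Rightarrow>\<^sub>L 'a) set \<Rightarrow> bool" where
  "real_reductive G \<longleftrightarrow> closed_subgroup_GL G \<and>
     G = {k o\<^sub>L exp_blinfun A | k A. k \<in> K_part G \<and> A \<in> p_part G}"

definition orbit :: "('a::euclidean_space \<Rightarrow>\<^sub>L 'a) set \<Rightarrow> 'a \<Rightarrow> 'a set" where
  "orbit G v = (\<lambda>g. blinfun_apply g v) ` G"

definition minimal_vectors :: "('a::euclidean_space \<Rightarrow>\<^sub>L 'a) set \<Rightarrow> 'a set" where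
  "minimal_vectors G = {v. \<forall>g\<in>G. norm v \<le> norm (blinfun_apply g v)}"

definition null_cone :: "('a::euclidean_space \<Rightarrow>\<^sub>L 'a) set \<Rightarrow> 'a set" where
  "null_cone G = {v. 0 \<in> closure (orbit G v)}"

end

theory Submission
  imports Defs
begin

text \<open>
  For symmetric \<open>A\<close> the function \<open>t \<mapsto> |exp(t A) v|\<^sup>2\<close> is convex, so a minimal vector \<open>w\<close> satisfies
  \<open>A w \<bullet> w = 0\<close> for \<open>A \<in> \<pp>\<close>, and \<open>|exp(A) w| = |w|\<close> forces \<open>A w = 0\<close>; this gives
  \<open>G w \<inter> \<M> = K w\<close>. The orbit of \<open>w\<close> is closed because the representatives of \<open>G / G\<^sub>w\<close> of least
  Frobenius norm reach the points of a bounded part of \<open>G w\<close> from a bounded part of \<open>G\<close>.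
  A vector of least norm in the closure of \<open>G v\<close> is minimal, so the closure contains a closed orbit.
  Writing \<open>G = K T K\<close> with \<open>T\<close> the exponential of a maximal abelian subspace of \<open>\<pp>\<close>, linear algebra
  of weights shows that any minimal vector \<open>w\<close> in the closure is, up to \<open>G\<close>, the limit of
  \<open>exp(t \<alpha>) v\<close> at an exponential rate. Against this rate the polar part of \<open>g exp(- t \<alpha>)\<close> grows only
  linearly, whence \<open>|w| \<le> |g v|\<close> for all \<open>g\<close>. Thus all minimal vectors in the closure have the same, least,
  norm, and the parallelogram law makes them \<open>K\<close>-conjugate. Finally the null cone is the union of
  the closed sets \<open>K V\<^sub>I\<close>, for the finitely many coordinate subspaces \<open>V\<^sub>I\<close> that are contracted
  to \<open>0\<close> by a one-parameter subgroup of \<open>T\<close>.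
\<close>

section \<open>The exponential of endomorphisms\<close>

text \<open>A copy of the endomorphism algebra that is an instance of the Banach algebra classes, so that
  the library's exponential series applies to it.\<close>

typedef (overloaded) ('a::euclidean_space) endo = "UNIV :: ('a \<Rightarrow>\<^sub>L 'a) set"
  morphisms blinfun_of_endo endo_of_blinfun ..

setup_lifting type_definition_endo

instantiation endo :: (euclidean_space) real_normed_algebra_1
begin

lift_definition norm_endo :: "'a endo \<Rightarrow> real" is norm .
lift_definition minus_endo :: "'a endo \<Rightarrow> 'a endo \<Rightarrow> 'a endo" is "(-)" .
lift_definition plus_endo :: "'a endo \<Rightarrow> 'a endo \<Rightarrow> 'a endo" is "(+)" .
lift_definition times_endo :: "'a endo \<Rightarrow> 'a endo \<Rightarrow> 'a endo" is "(o\<^sub>L)" .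
lift_definition uminus_endo :: "'a endo \<Rightarrow> 'a endo" is "uminus" .
lift_definition zero_endo :: "'a endo" is 0 .
lift_definition one_endo :: "'a endo" is id_blinfun .
lift_definition scaleR_endo :: "real \<Rightarrow> 'a endo \<Rightarrow> 'a endo" is scaleR .

definition dist_endo :: "'a endo \<Rightarrow> 'a endo \<Rightarrow> real"
  where "dist_endo a b = norm (a - b)"

definition sgn_endo :: "'a endo \<Rightarrow> 'a endo"
  where "sgn_endo x = scaleR (inverse (norm x)) x"

definition
  "(uniformity :: ('a endo \<times> 'a endo) filter) = (INF e\<in>{0 <..}. principal {(x, y). dist x y < e})"

definition open_endo :: "'a endo set \<Rightarrow> bool"
  where "open_endo S = (\<forall>x\<in>S. \<forall>\<^sub>F (x', y) in uniformity. x' = x \<longrightarrow> y \<in> S)"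

instance
proof
  fix x y z :: "'a endo" and a b :: real
  show "x + y + z = x + (y + z)" by transfer (rule add.assoc)
  show "x + y = y + x" by transfer (rule add.commute)
  show "0 + x = x" by transfer (rule add_0)
  show "- x + x = 0" by transfer (rule left_minus)
  show "x - y = x + - y" by transfer (rule diff_conv_add_uminus)
  show "scaleR a (x + y) = scaleR a x + scaleR a y" by transfer (rule scaleR_add_right)
  show "scaleR (a + b) x = scaleR a x + scaleR b x" by transfer (rule scaleR_add_left)
  show "scaleR a (scaleR b x) = scaleR (a * b) x" by transfer (rule scaleR_scaleR)
  show "scaleR 1 x = x" by transfer (rule scaleR_one)
  show "x * y * z = x * (y * z)" by transfer (rule blinfun_eqI, simp)
  show "(x + y) * z = x * z + y * z"
    by transfer (rule bounded_bilinear.add_left[OF bounded_bilinear_blinfun_compose])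
  show "x * (y + z) = x * y + x * z"
    by transfer (rule bounded_bilinear.add_right[OF bounded_bilinear_blinfun_compose])
  show "scaleR a x * y = scaleR a (x * y)"
    by transfer (rule bounded_bilinear.scaleR_left[OF bounded_bilinear_blinfun_compose])
  show "x * scaleR a y = scaleR a (x * y)"
    by transfer (rule bounded_bilinear.scaleR_right[OF bounded_bilinear_blinfun_compose])
  show "1 * x = x" "x * 1 = x" by (transfer; rule blinfun_eqI; simp)+
  show "norm (x + y) \<le> norm x + norm y" by transfer (rule norm_triangle_ineq)
  show "norm x = 0 \<longleftrightarrow> x = 0" by transfer (rule norm_eq_zero)
  show "norm (scaleR a x) = \<bar>a\<bar> * norm x" by transfer (rule norm_scaleR)
  show "norm (x * y) \<le> norm x * norm y" by transfer (rule norm_blinfun_compose)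
  show "norm (1 :: 'a endo) = 1" by transfer (rule norm_blinfun_id)
  have "norm (id_blinfun :: 'a \<Rightarrow>\<^sub>L 'a) \<noteq> 0" unfolding norm_blinfun_id by (rule one_neq_zero)
  then have "(0 :: 'a \<Rightarrow>\<^sub>L 'a) \<noteq> id_blinfun" unfolding norm_eq_zero by (rule not_sym)
  then show "(0 :: 'a endo) \<noteq> 1" by transfer
qed (unfold dist_endo_def open_endo_def sgn_endo_def uniformity_endo_def, (rule refl)+)

end

lemma bounded_linear_blinfun_of_endo: "bounded_linear blinfun_of_endo"
  by (rule bounded_linear_intro[where K = 1]) (transfer; simp)+

lemma bounded_linear_endo_of_blinfun: "bounded_linear endo_of_blinfun"
  by (rule bounded_linear_intro[where K = 1]) (transfer; simp)+

instance endo :: (euclidean_space) banach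
proof
  fix X :: "nat \<Rightarrow> 'a endo"
  assume "Cauchy X"
  then have "Cauchy (\<lambda>n. blinfun_of_endo (X n))"
    by (rule bounded_linear.Cauchy[OF bounded_linear_blinfun_of_endo])
  then obtain L where "(\<lambda>n. blinfun_of_endo (X n)) \<longlonglongrightarrow> L"
    using Cauchy_convergent_iff convergent_def by blast
  then have "(\<lambda>n. endo_of_blinfun (blinfun_of_endo (X n))) \<longlonglongrightarrow> endo_of_blinfun L"
    by (rule bounded_linear.tendsto[OF bounded_linear_endo_of_blinfun])
  then show "convergent X"
    by (auto simp: blinfun_of_endo_inverse convergent_def)
qed

lemma blinfun_of_endo_power:
  "blinfun_of_endo (x ^ n) = ((\<lambda>B. blinfun_of_endo x o\<^sub>L B) ^^ n) id_blinfun"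
  by (induction n) (simp_all add: one_endo.rep_eq times_endo.rep_eq)

lemma exp_blinfun_eq: "exp_blinfun A = blinfun_of_endo (exp (endo_of_blinfun A))"
proof -
  have "(\<lambda>n. blinfun_of_endo (endo_of_blinfun A ^ n /\<^sub>R fact n)) sums
      blinfun_of_endo (exp (endo_of_blinfun A))"
    by (intro bounded_linear.sums[OF bounded_linear_blinfun_of_endo] exp_converges)
  then have "(\<lambda>n. (1 / fact n) *\<^sub>R ((\<lambda>B. A o\<^sub>L B) ^^ n) id_blinfun) sums
      blinfun_of_endo (exp (endo_of_blinfun A))"
    by (simp add: scaleR_endo.rep_eq blinfun_of_endo_power endo_of_blinfun_inverse divide_inverse)
  then show ?thesis
    unfolding exp_blinfun_def by (rule sums_unique[symmetric])
qed

lemma exp_blinfun_zero [simp]: "exp_blinfun 0 = id_blinfun"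
  by (simp add: exp_blinfun_eq one_endo.rep_eq flip: zero_endo.abs_eq)

lemma exp_blinfun_add:
  assumes "A o\<^sub>L B = B o\<^sub>L A"
  shows "exp_blinfun (A + B) = exp_blinfun A o\<^sub>L exp_blinfun B"
proof -
  have "exp (endo_of_blinfun A + endo_of_blinfun B) = exp (endo_of_blinfun A) * exp (endo_of_blinfun B)"
    using assms by (intro exp_add_commuting) (simp add: times_endo.abs_eq)
  then show ?thesis
    by (simp add: exp_blinfun_eq plus_endo.abs_eq flip: times_endo.rep_eq)
qed

lemma exp_blinfun_minus:
  "exp_blinfun A o\<^sub>L exp_blinfun (- A) = id_blinfun" "exp_blinfun (- A) o\<^sub>L exp_blinfun A = id_blinfun"
proof -
  have c: "A o\<^sub>L - A = - A o\<^sub>L A"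
    by (intro blinfun_eqI) (simp add: blinfun.bilinear_simps)
  show "exp_blinfun A o\<^sub>L exp_blinfun (- A) = id_blinfun"
    using exp_blinfun_add[OF c] by simp
  show "exp_blinfun (- A) o\<^sub>L exp_blinfun A = id_blinfun"
    using exp_blinfun_add[OF c[symmetric]] by simp
qed

lemma exp_blinfun_minus_apply [simp]:
  "exp_blinfun A (exp_blinfun (- A) x) = x" "exp_blinfun (- A) (exp_blinfun A x) = x"
  by (metis blinfun_apply_blinfun_compose blinfun_apply_id_blinfun exp_blinfun_minus)+

lemma isCont_exp_algebra:
  "isCont exp (x :: 'b::{real_normed_algebra_1, banach})"
proof -
  define M where "M = norm x + 1"
  have M0: "0 \<le> M" by (simp add: M_def add_nonneg_nonneg)
  have "uniform_limit (cball 0 M) (\<lambda>n y :: 'b. \<Sum>i<n. y ^ i /\<^sub>R fact i) (\<lambda>y. \<Sum>i. y ^ i /\<^sub>R fact i) sequentially"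
  proof (rule Weierstrass_m_test[where M = "\<lambda>i. M ^ i /\<^sub>R fact i"])
    show "summable (\<lambda>i. M ^ i /\<^sub>R fact i)" by (rule summable_exp_generic)
    fix n and y :: 'b assume "y \<in> cball 0 M"
    then have "norm (y ^ n) \<le> M ^ n"
      by (metis dist_0_norm mem_cball norm_ge_zero norm_power_ineq order_trans power_mono)
    then show "norm (y ^ n /\<^sub>R fact n) \<le> M ^ n /\<^sub>R fact n"
      by (simp add: mult_left_mono)
  qed
  then have "continuous_on (cball 0 M) (\<lambda>y :: 'b. \<Sum>i. y ^ i /\<^sub>R fact i)"
    by (rule uniform_limit_theorem[rotated]) (auto intro!: always_eventually continuous_intros)
  then have "continuous_on (ball 0 M) (exp :: 'b \<Rightarrow> 'b)"
    unfolding exp_def[abs_def] by (rule continuous_on_subset[OF _ ball_subset_cball])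
  then show ?thesis
    by (simp add: continuous_on_eq_continuous_at M_def)
qed

lemma continuous_on_exp_blinfun: "continuous_on UNIV (exp_blinfun :: ('a::euclidean_space \<Rightarrow>\<^sub>L 'a) \<Rightarrow> _)"
proof -
  have "continuous_on UNIV (exp :: 'a endo \<Rightarrow> 'a endo)"
    by (simp add: continuous_at_imp_continuous_on isCont_exp_algebra)
  then have "continuous_on UNIV (\<lambda>A :: 'a \<Rightarrow>\<^sub>L 'a. exp (endo_of_blinfun A))"
    by (rule continuous_on_compose2[OF _ linear_continuous_on[OF bounded_linear_endo_of_blinfun]]) simp
  then show ?thesis
    unfolding exp_blinfun_eq
    by (rule bounded_linear.continuous_on[OF bounded_linear_blinfun_of_endo])
qed

lemma tendsto_exp_blinfun:
  "(f \<longlongrightarrow> A) F \<Longrightarrow> ((\<lambda>x. exp_blinfun (f x)) \<longlongrightarrow> exp_blinfun A) F"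
  using continuous_on_exp_blinfun continuous_on_tendsto_compose[of UNIV exp_blinfun f A F] by auto

lemma exp_blinfun_has_vector_derivative:
  "((\<lambda>t. exp_blinfun (t *\<^sub>R A)) has_vector_derivative exp_blinfun (t *\<^sub>R A) o\<^sub>L A) (at t)"
proof -
  have "((\<lambda>t. blinfun_of_endo (exp (t *\<^sub>R endo_of_blinfun A))) has_vector_derivative
      blinfun_of_endo (exp (t *\<^sub>R endo_of_blinfun A) * endo_of_blinfun A)) (at t)"
    by (intro bounded_linear.has_vector_derivative[OF bounded_linear_blinfun_of_endo]
        exp_scaleR_has_vector_derivative_right)
  then show ?thesis
    by (simp add: exp_blinfun_eq scaleR_endo.abs_eq times_endo.rep_eq endo_of_blinfun_inverse)
qed

lemma exp_blinfun_sums: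
  "(\<lambda>n. (1 / fact n) *\<^sub>R ((blinfun_apply A) ^^ n) x) sums exp_blinfun A x"
proof -
  have p: "((\<lambda>B. A o\<^sub>L B) ^^ n) id_blinfun x = (blinfun_apply A ^^ n) x" for n
    by (induction n) simp_all
  have "(\<lambda>n. endo_of_blinfun A ^ n /\<^sub>R fact n) sums exp (endo_of_blinfun A)"
    by (rule exp_converges)
  then have "(\<lambda>n. blinfun_of_endo (endo_of_blinfun A ^ n /\<^sub>R fact n) x) sums
      blinfun_of_endo (exp (endo_of_blinfun A)) x"
    by (intro bounded_linear.sums[OF blinfun.bounded_linear_left]
        bounded_linear.sums[OF bounded_linear_blinfun_of_endo])
  then show ?thesis
    by (simp add: exp_blinfun_eq scaleR_endo.rep_eq blinfun_of_endo_power endo_of_blinfun_inverse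
        p divide_inverse blinfun.scaleR_left)
qed

lemma exp_blinfun_adjoint:
  fixes A B :: "'a::euclidean_space \<Rightarrow>\<^sub>L 'a"
  assumes "\<And>x y. A x \<bullet> y = x \<bullet> B y"
  shows "exp_blinfun A x \<bullet> y = x \<bullet> exp_blinfun B y"
proof -
  have p: "(blinfun_apply A ^^ n) x \<bullet> y = x \<bullet> (blinfun_apply B ^^ n) y" for n
    by (induction n arbitrary: y) (simp_all add: assms flip: funpow_swap1)
  have "(\<lambda>n. ((1 / fact n) *\<^sub>R (blinfun_apply A ^^ n) x) \<bullet> y) sums (exp_blinfun A x \<bullet> y)"
    by (intro bounded_linear.sums[OF bounded_linear_inner_left] exp_blinfun_sums)
  moreover have "(\<lambda>n. x \<bullet> ((1 / fact n) *\<^sub>R (blinfun_apply B ^^ n) y)) sums (x \<bullet> exp_blinfun B y)"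
    by (intro bounded_linear.sums[OF bounded_linear_inner_right] exp_blinfun_sums)
  ultimately show ?thesis
    by (simp add: p sums_unique2)
qed

lemma exp_blinfun_eigenvector:
  fixes A :: "'a::euclidean_space \<Rightarrow>\<^sub>L 'a"
  assumes "A x = c *\<^sub>R x"
  shows "exp_blinfun A x = exp c *\<^sub>R x"
proof -
  have p: "(blinfun_apply A ^^ n) x = c ^ n *\<^sub>R x" for n
    by (induction n) (simp_all add: assms blinfun.scaleR_right)
  have "(\<lambda>n. (c ^ n /\<^sub>R fact n) *\<^sub>R x) sums (exp c *\<^sub>R x)"
    by (intro bounded_linear.sums[OF bounded_linear_scaleR_left] exp_converges)
  then show ?thesis
    using exp_blinfun_sums[of A x] by (simp add: p divide_inverse sums_unique2)
qed

lemma exp_blinfun_conjugate: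
  fixes k l :: "'a::euclidean_space \<Rightarrow>\<^sub>L 'a"
  assumes "l o\<^sub>L k = id_blinfun"
  shows "exp_blinfun (k o\<^sub>L A o\<^sub>L l) = k o\<^sub>L exp_blinfun A o\<^sub>L l"
proof (rule blinfun_eqI)
  fix x
  have lk: "l (k y) = y" for y
    using assms by (metis blinfun_apply_blinfun_compose blinfun_apply_id_blinfun)
  have kl: "k (l y) = y" for y
    using blinfun_bij1[OF assms] lk by (metis bij_pointE)
  have p: "(blinfun_apply (k o\<^sub>L A o\<^sub>L l) ^^ n) x = k ((blinfun_apply A ^^ n) (l x))" for n
    by (induction n) (simp_all add: lk kl)
  have "(\<lambda>n. k ((1 / fact n) *\<^sub>R ((blinfun_apply A) ^^ n) (l x))) sums k (exp_blinfun A (l x))"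
    by (intro bounded_linear.sums[OF blinfun.bounded_linear_right] exp_blinfun_sums)
  then show "exp_blinfun (k o\<^sub>L A o\<^sub>L l) x = (k o\<^sub>L exp_blinfun A o\<^sub>L l) x"
    using exp_blinfun_sums[of "k o\<^sub>L A o\<^sub>L l" x]
    by (simp add: p blinfun.scaleR_right sums_unique2)
qed

lemma has_vector_derivative_sequentially:
  fixes f :: "real \<Rightarrow> 'b::real_normed_vector"
  assumes "(f has_vector_derivative z) (at 0)"
  shows "(\<lambda>n. real n *\<^sub>R (f (inverse (real n)) - f 0)) \<longlonglongrightarrow> z"
proof -
  have lim: "((\<lambda>h. norm ((f h - f 0 - h *\<^sub>R z) /\<^sub>R \<bar>h\<bar>)) \<longlongrightarrow> 0) (at 0)"
    using assms by (intro tendsto_norm_zero) (simp add: has_vector_derivative_def has_derivative_at_within)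
  have fl: "filterlim (\<lambda>n. inverse (real n)) (at 0) sequentially"
    by (rule filterlim_atI) (auto simp: lim_inverse_n eventually_sequentially intro!: exI[of _ 1])
  have "(\<lambda>n. norm (real n *\<^sub>R (f (inverse (real n)) - f 0) - z)) \<longlonglongrightarrow> 0"
  proof (rule Lim_transform_eventually[OF filterlim_compose[OF lim fl]])
    show "\<forall>\<^sub>F n in sequentially.
        norm ((f (inverse (real n)) - f 0 - inverse (real n) *\<^sub>R z) /\<^sub>R \<bar>inverse (real n)\<bar>) =
        norm (real n *\<^sub>R (f (inverse (real n)) - f 0) - z)"
      using eventually_gt_at_top[of 0]
    proof eventually_elim
      case (elim n)
      have "(f (inverse (real n)) - f 0 - inverse (real n) *\<^sub>R z) /\<^sub>R \<bar>inverse (real n)\<bar> =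
        real n *\<^sub>R (f (inverse (real n)) - f 0) - z"
        using elim by (simp add: scaleR_right_diff_distrib)
      then show ?case by simp
    qed
  qed
  then show ?thesis
    by (simp add: Lim_null[of _ z] tendsto_norm_zero_iff)
qed

lemma power_diff_bound:
  fixes x y :: "'b::real_normed_algebra_1"
  assumes "norm x \<le> M" "norm y \<le> M"
  shows "norm (x ^ n - y ^ n) \<le> real n * M ^ (n - 1) * norm (x - y)"
proof (induction n)
  case (Suc n)
  have M: "0 \<le> M" by (rule order_trans[OF norm_ge_zero assms(1)])
  have "x ^ Suc n - y ^ Suc n = x ^ n * (x - y) + (x ^ n - y ^ n) * y"
    unfolding power_Suc2 by (simp add: algebra_simps)
  then have "norm (x ^ Suc n - y ^ Suc n) \<le> norm (x ^ n * (x - y)) + norm ((x ^ n - y ^ n) * y)"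
    by (simp only: norm_triangle_ineq)
  also have "\<dots> \<le> M ^ n * norm (x - y) + real n * M ^ (n - 1) * norm (x - y) * M"
  proof (rule add_mono)
    have "norm (x ^ n) \<le> M ^ n"
      by (rule order_trans[OF norm_power_ineq power_mono[OF assms(1) norm_ge_zero]])
    from mult_right_mono[OF this norm_ge_zero]
    show "norm (x ^ n * (x - y)) \<le> M ^ n * norm (x - y)"
      by (rule order_trans[OF norm_mult_ineq])
    have "norm (x ^ n - y ^ n) * norm y \<le> real n * M ^ (n - 1) * norm (x - y) * M"
      using assms(2) M by (intro mult_mono Suc.IH mult_nonneg_nonneg) auto
    then show "norm ((x ^ n - y ^ n) * y) \<le> real n * M ^ (n - 1) * norm (x - y) * M"
      by (rule order_trans[OF norm_mult_ineq])
  qed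
  also have "\<dots> = real (Suc n) * M ^ (Suc n - 1) * norm (x - y)"
  proof (cases n)
    case (Suc m)
    have "real n * M ^ (n - 1) * norm (x - y) * M = real n * M ^ n * norm (x - y)"
      by (simp add: Suc mult_ac)
    then show ?thesis by (simp add: distrib_right)
  qed simp
  finally show ?case .
qed simp

lemma power_tendsto_exp:
  fixes x :: "nat \<Rightarrow> 'b::{real_normed_algebra_1, banach}"
  assumes "(\<lambda>n. real n *\<^sub>R (x n - 1)) \<longlonglongrightarrow> z"
  shows "(\<lambda>n. x n ^ n) \<longlonglongrightarrow> exp z"
proof -
  define y where "y n = exp (z /\<^sub>R real n)" for n
  have y: "(\<lambda>n. real n *\<^sub>R (y n - 1)) \<longlonglongrightarrow> z"
  proof -
    have "((\<lambda>t. exp (t *\<^sub>R z)) has_vector_derivative z) (at 0)"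
      using exp_scaleR_has_vector_derivative_right[of z 0 UNIV] by simp
    from has_vector_derivative_sequentially[OF this] show ?thesis
      by (simp add: y_def)
  qed
  obtain C1 where C1: "\<And>n. norm (real n *\<^sub>R (x n - 1)) \<le> C1"
    using convergent_imp_Bseq[OF convergentI[OF assms]] by (auto simp: Bseq_def)
  obtain C2 where C2: "\<And>n. norm (real n *\<^sub>R (y n - 1)) \<le> C2"
    using convergent_imp_Bseq[OF convergentI[OF y]] by (auto simp: Bseq_def)
  define C where "C = max C1 C2"
  have C0: "0 \<le> C" unfolding C_def using C1[of 0] by simp
  have b: "norm u \<le> 1 + C / n" if "norm (real n *\<^sub>R (u - 1)) \<le> C" "n > 0" for n :: nat and u :: 'b
  proof -
    have "norm (u - 1) \<le> C / n" using that unfolding norm_scaleR by (simp add: pos_le_divide_eq mult.commute)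
    then show ?thesis using norm_triangle_ineq[of "u - 1" 1] by simp
  qed
  have bnd: "norm (x n ^ n - y n ^ n) \<le> exp C * norm (real n *\<^sub>R (x n - 1) - real n *\<^sub>R (y n - 1))"
    if n: "n > 0" for n
  proof -
    have "(1 + C / n) ^ (n - 1) \<le> (1 + C / n) ^ n"
      using C0 by (intro power_increasing) auto
    also have "\<dots> \<le> exp C"
      using exp_ge_one_plus_x_over_n_power_n[of "n" C] C0 n by simp
    finally have P: "(1 + C / n) ^ (n - 1) \<le> exp C" .
    have "norm (x n ^ n - y n ^ n) \<le> real n * (1 + C / n) ^ (n - 1) * norm (x n - y n)"
      using C1[of n] C2[of n] n by (intro power_diff_bound b) (auto simp: C_def)
    also have "\<dots> \<le> real n * exp C * norm (x n - y n)"
      by (intro mult_right_mono mult_left_mono P) auto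
    also have "\<dots> = exp C * norm (real n *\<^sub>R (x n - y n))"
      by simp
    also have "real n *\<^sub>R (x n - y n) = real n *\<^sub>R (x n - 1) - real n *\<^sub>R (y n - 1)"
      unfolding scaleR_right_diff_distrib[symmetric] by (rule arg_cong[where f = "scaleR (real n)"]) simp
    finally show ?thesis .
  qed
  have "(\<lambda>n. exp C * norm (real n *\<^sub>R (x n - 1) - real n *\<^sub>R (y n - 1))) \<longlonglongrightarrow> exp C * norm (z - z)"
    by (intro tendsto_intros assms y)
  then have lim: "(\<lambda>n. exp C * norm (real n *\<^sub>R (x n - 1) - real n *\<^sub>R (y n - 1))) \<longlonglongrightarrow> 0"
    by (simp only: diff_self norm_zero mult_zero_right)
  have "\<forall>\<^sub>F n in sequentially. norm (x n ^ n - y n ^ n)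
      \<le> exp C * norm (real n *\<^sub>R (x n - 1) - real n *\<^sub>R (y n - 1))"
    using eventually_gt_at_top[of 0] by eventually_elim (rule bnd)
  then have "(\<lambda>n. x n ^ n - y n ^ n) \<longlonglongrightarrow> 0"
    by (rule Lim_null_comparison[OF _ lim])
  moreover have "(\<lambda>n. y n ^ n) \<longlonglongrightarrow> exp z"
  proof (rule tendsto_eventually)
    have "exp w ^ n = exp (real n *\<^sub>R w)" for n and w :: 'b
    proof (induction n)
      case (Suc n)
      have "exp (w + real n *\<^sub>R w) = exp w * exp (real n *\<^sub>R w)"
        by (rule exp_add_commuting) simp
      then show ?case using Suc by (simp add: scaleR_left_distrib)
    qed simp
    then have "y n ^ n = exp z" if "n > 0" for n
      using that by (simp add: y_def)
    then show "\<forall>\<^sub>F n in sequentially. y n ^ n = exp z"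
      by (auto simp: eventually_sequentially intro!: exI[of _ 1])
  qed
  ultimately show ?thesis
    using tendsto_add[of "\<lambda>n. x n ^ n - y n ^ n" 0 sequentially "\<lambda>n. y n ^ n" "exp z"] by simp
qed


lemma blinfun_power_tendsto_exp:
  fixes x :: "nat \<Rightarrow> 'a::euclidean_space \<Rightarrow>\<^sub>L 'a"
  assumes "(\<lambda>n. real n *\<^sub>R (x n - id_blinfun)) \<longlonglongrightarrow> Z"
  shows "(\<lambda>n. ((o\<^sub>L) (x n) ^^ n) id_blinfun) \<longlonglongrightarrow> exp_blinfun Z"
proof -
  have "(\<lambda>n. real n *\<^sub>R (endo_of_blinfun (x n) - 1)) \<longlonglongrightarrow> endo_of_blinfun Z"
    unfolding one_endo_def minus_endo.abs_eq scaleR_endo.abs_eq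
    by (rule bounded_linear.tendsto[OF bounded_linear_endo_of_blinfun assms])
  then have "(\<lambda>n. blinfun_of_endo (endo_of_blinfun (x n) ^ n)) \<longlonglongrightarrow> exp_blinfun Z"
    unfolding exp_blinfun_eq
    by (intro bounded_linear.tendsto[OF bounded_linear_blinfun_of_endo] power_tendsto_exp)
  then show ?thesis
    by (simp add: blinfun_of_endo_power endo_of_blinfun_inverse)
qed

section \<open>Symmetric maps\<close>

definition onb :: "'a::euclidean_space set \<Rightarrow> bool" where
  "onb E \<longleftrightarrow> finite E \<and> pairwise orthogonal E \<and> (\<forall>e\<in>E. norm e = 1) \<and> span E = UNIV"

definition diag_on :: "'a::euclidean_space set \<Rightarrow> ('a \<Rightarrow>\<^sub>L 'a) \<Rightarrow> bool" where
  "diag_on E A \<longleftrightarrow> (\<forall>e\<in>E. A e = (A e \<bullet> e) *\<^sub>R e)"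

lemma onb_inner:
  assumes "onb E" "e \<in> E" "f \<in> E"
  shows "e \<bullet> f = (if e = f then 1 else 0)"
  using assms by (auto simp: onb_def pairwise_def orthogonal_def norm_eq_1)

lemma onb_finite: "onb E \<Longrightarrow> finite E"
  by (simp add: onb_def)

lemma onb_expand:
  assumes "onb E"
  shows "(\<Sum>e\<in>E. (x \<bullet> e) *\<^sub>R e) = x"
  using assms by (intro orthonormal_basis_expand) (auto simp: onb_def)

lemma onb_sum_inner:
  assumes "onb E" "f \<in> E"
  shows "(\<Sum>e\<in>E. c e *\<^sub>R e) \<bullet> f = c f"
proof -
  have "(\<Sum>e\<in>E. c e *\<^sub>R e) \<bullet> f = (\<Sum>e\<in>E. if e = f then c e else 0)"
    unfolding inner_sum_left by (rule sum.cong) (auto simp: onb_inner[OF assms(1) _ assms(2)])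
  then show ?thesis
    using assms by (simp add: onb_finite)
qed

lemma onb_inner_eq:
  assumes "onb E"
  shows "x \<bullet> y = (\<Sum>e\<in>E. (x \<bullet> e) * (y \<bullet> e))"
proof -
  have "x \<bullet> y = (\<Sum>e\<in>E. (x \<bullet> e) *\<^sub>R e) \<bullet> y" by (simp add: onb_expand[OF assms])
  also have "\<dots> = (\<Sum>e\<in>E. (x \<bullet> e) * (y \<bullet> e))"
    unfolding inner_sum_left inner_scaleR_left by (simp only: inner_commute)
  finally show ?thesis .
qed

lemma onb_norm_eq:
  assumes "onb E"
  shows "(norm x)\<^sup>2 = (\<Sum>e\<in>E. (x \<bullet> e)\<^sup>2)"
  unfolding power2_norm_eq_inner onb_inner_eq[OF assms, of x x] by (simp only: power2_eq_square)

lemma onb_eqI: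
  assumes "onb E" "\<And>e. e \<in> E \<Longrightarrow> x \<bullet> e = y \<bullet> e"
  shows "x = y"
proof -
  have "(\<Sum>e\<in>E. (x \<bullet> e) *\<^sub>R e) = (\<Sum>e\<in>E. (y \<bullet> e) *\<^sub>R e)"
    using assms(2) by (intro sum.cong) auto
  then show ?thesis unfolding onb_expand[OF assms(1)] .
qed

lemma onb_card:
  assumes "onb (E :: 'a::euclidean_space set)"
  shows "card E \<le> DIM('a)"
proof -
  have "0 \<notin> E" using assms by (auto simp: onb_def)
  then have "independent E"
    using assms by (intro pairwise_orthogonal_independent) (auto simp: onb_def)
  then show ?thesis by (simp add: independent_bound)
qed

lemma onb_Basis: "onb (Basis :: 'a::euclidean_space set)"
  by (auto simp: onb_def pairwise_def orthogonal_def inner_Basis)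

lemma symmetricD: "A \<in> symmetric_maps \<Longrightarrow> A x \<bullet> y = x \<bullet> A y"
  by (simp add: symmetric_maps_def)

lemma diag_on_inner:
  assumes "A \<in> symmetric_maps" "diag_on E A" "e \<in> E"
  shows "A x \<bullet> e = (A e \<bullet> e) * (x \<bullet> e)"
proof -
  have "A e = (A e \<bullet> e) *\<^sub>R e" using assms by (simp add: diag_on_def)
  then have "x \<bullet> A e = x \<bullet> ((A e \<bullet> e) *\<^sub>R e)" by (rule arg_cong)
  then show ?thesis by (simp only: symmetricD[OF assms(1)] inner_scaleR_right)
qed

lemma exp_symmetric:
  assumes "A \<in> symmetric_maps"
  shows "exp_blinfun A x \<bullet> y = x \<bullet> exp_blinfun A y"
  using symmetricD[OF assms] by (rule exp_blinfun_adjoint)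

lemma diag_on_exp_inner:
  assumes "A \<in> symmetric_maps" "diag_on E A" "e \<in> E"
  shows "exp_blinfun A x \<bullet> e = exp (A e \<bullet> e) * (x \<bullet> e)"
proof -
  have "A e = (A e \<bullet> e) *\<^sub>R e" using assms by (simp add: diag_on_def)
  from exp_blinfun_eigenvector[OF this] show ?thesis
    by (simp add: exp_symmetric[OF assms(1)])
qed

lemma symmetric_maps_scaleR: "A \<in> symmetric_maps \<Longrightarrow> c *\<^sub>R A \<in> symmetric_maps"
  by (simp add: symmetric_maps_def blinfun.scaleR_left)

lemma symmetric_maps_add: "A \<in> symmetric_maps \<Longrightarrow> B \<in> symmetric_maps \<Longrightarrow> A + B \<in> symmetric_maps"
  by (simp add: symmetric_maps_def blinfun.add_left inner_add_left inner_add_right)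

lemma diag_on_scaleR: "diag_on E A \<Longrightarrow> diag_on E (c *\<^sub>R A)"
  unfolding diag_on_def by (metis blinfun.scaleR_left inner_scaleR_left scaleR_scaleR)

lemma diag_on_add: "diag_on E A \<Longrightarrow> diag_on E B \<Longrightarrow> diag_on E (A + B)"
  unfolding diag_on_def by (metis blinfun.add_left inner_add_left scaleR_left_distrib)

lemma diag_on_commute:
  assumes "onb E" "diag_on E A" "diag_on E B" "A \<in> symmetric_maps" "B \<in> symmetric_maps"
  shows "A o\<^sub>L B = B o\<^sub>L A"
proof (intro blinfun_eqI onb_eqI[OF assms(1)])
  fix x e assume e: "e \<in> E"
  note * = diag_on_inner[OF assms(4,2) e] diag_on_inner[OF assms(5,3) e]
  show "(A o\<^sub>L B) x \<bullet> e = (B o\<^sub>L A) x \<bullet> e"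
    using *[of "B x"] *[of "A x"] *[of x] by simp
qed

text \<open>A maximiser \<open>u\<close> of \<open>A x \<bullet> x\<close> on the unit sphere of \<open>S\<close> is an eigenvector, since
  \<open>y \<mapsto> c * (y \<bullet> y) - A y \<bullet> y\<close> is nonnegative on \<open>S\<close> and vanishes at \<open>u\<close>.\<close>

lemma symmetric_eigenvector:
  fixes A :: "'a::euclidean_space \<Rightarrow>\<^sub>L 'a"
  assumes A: "A \<in> symmetric_maps" and S: "subspace S" "S \<noteq> {0}" and inv: "\<And>x. x \<in> S \<Longrightarrow> A x \<in> S"
  obtains u c where "u \<in> S" "norm u = 1" "A u = c *\<^sub>R u"
proof -
  obtain z where z: "z \<in> S" "z \<noteq> 0" using S subspace_0 by fastforce
  have "compact (sphere 0 1 \<inter> S)"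
    by (intro compact_Int_closed compact_sphere closed_subspace S)
  moreover have "z /\<^sub>R norm z \<in> sphere 0 1 \<inter> S"
    using z S by (auto intro: subspace_scale)
  moreover have "continuous_on (sphere 0 1 \<inter> S) (\<lambda>x. A x \<bullet> x)"
    by (intro continuous_intros)
  ultimately obtain u where u: "u \<in> sphere 0 1 \<inter> S"
    and max: "\<And>y. y \<in> sphere 0 1 \<inter> S \<Longrightarrow> A y \<bullet> y \<le> A u \<bullet> u"
    using continuous_attains_sup[of "sphere 0 1 \<inter> S" "\<lambda>x. A x \<bullet> x"] by blast
  define c where "c = A u \<bullet> u"
  have nu: "norm u = 1" "u \<in> S" using u by auto
  have le: "A y \<bullet> y \<le> c * (y \<bullet> y)" if "y \<in> S" for y
  proof (cases "y = 0")
    case False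
    then have "y /\<^sub>R norm y \<in> sphere 0 1 \<inter> S" using that S by (auto intro: subspace_scale)
    from max[OF this] have "(A y \<bullet> y) / (norm y)\<^sup>2 \<le> c"
      by (simp add: c_def blinfun.scaleR_right power2_eq_square divide_inverse mult_ac)
    then show ?thesis using False by (simp add: field_simps power2_norm_eq_inner)
  qed simp
  define w where "w = A u - c *\<^sub>R u"
  have wS: "w \<in> S" unfolding w_def using S inv nu by (intro subspace_diff subspace_scale) auto
  have "w \<bullet> w = 0"
  proof (rule ccontr)
    assume "w \<bullet> w \<noteq> 0"
    then have w: "w \<bullet> w > 0" by simp
    have uu: "u \<bullet> u = 1" using nu by (simp add: norm_eq_1)
    have quad: "2 * t * (w \<bullet> w) \<le> t\<^sup>2 * (c * (w \<bullet> w) - A w \<bullet> w)" for t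
    proof -
      have "A (u + t *\<^sub>R w) \<bullet> (u + t *\<^sub>R w) \<le> c * ((u + t *\<^sub>R w) \<bullet> (u + t *\<^sub>R w))"
        using S nu wS by (intro le subspace_add subspace_scale) auto
      moreover have "A (u + t *\<^sub>R w) \<bullet> (u + t *\<^sub>R w) = c + 2 * t * (A u \<bullet> w) + t\<^sup>2 * (A w \<bullet> w)"
        using symmetricD[OF A, of w u]
        by (simp add: blinfun.add_right blinfun.scaleR_right inner_add_left inner_add_right
            c_def power2_eq_square algebra_simps inner_commute)
      moreover have "(u + t *\<^sub>R w) \<bullet> (u + t *\<^sub>R w) = 1 + 2 * t * (u \<bullet> w) + t\<^sup>2 * (w \<bullet> w)"
        by (simp add: inner_add_left inner_add_right uu power2_eq_square algebra_simps inner_commute)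
      moreover have "A u \<bullet> w = w \<bullet> w + c * (u \<bullet> w)"
        by (simp add: w_def inner_diff_left)
      ultimately have "c + 2 * t * (w \<bullet> w + c * (u \<bullet> w)) + t\<^sup>2 * (A w \<bullet> w) \<le>
          c * (1 + 2 * t * (u \<bullet> w) + t\<^sup>2 * (w \<bullet> w))"
        by (simp only:)
      then show ?thesis by (simp add: algebra_simps)
    qed
    define q where "q = \<bar>c * (w \<bullet> w) - A w \<bullet> w\<bar> + 1"
    define t where "t = (w \<bullet> w) / q"
    have q: "q > 0" by (simp add: q_def)
    then have t: "t > 0" using w by (simp add: t_def)
    have "2 * t * (w \<bullet> w) \<le> t\<^sup>2 * q"
      using quad[of t] by (rule order_trans) (auto simp: q_def intro!: mult_left_mono)
    also have "\<dots> = t * (w \<bullet> w)" using q by (simp add: t_def power2_eq_square)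
    finally show False using t w by simp
  qed
  then have "A u = c *\<^sub>R u" by (simp add: w_def)
  with nu show thesis by (intro that)
qed

lemma symmetric_eigenbasis_subspace:
  fixes A :: "'a::euclidean_space \<Rightarrow>\<^sub>L 'a"
  assumes A: "A \<in> symmetric_maps"
  shows "subspace S \<Longrightarrow> (\<And>x. x \<in> S \<Longrightarrow> A x \<in> S) \<Longrightarrow>
    \<exists>E. finite E \<and> pairwise orthogonal E \<and> (\<forall>e\<in>E. norm e = 1 \<and> A e = (A e \<bullet> e) *\<^sub>R e) \<and> span E = S"
proof (induction "dim S" arbitrary: S rule: less_induct)
  case less
  show ?case
  proof (cases "S = {0}")
    case True
    then show ?thesis by (intro exI[of _ "{}"]) auto
  next
    case False
    obtain u c where u: "u \<in> S" "norm u = 1" "A u = c *\<^sub>R u"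
      using symmetric_eigenvector[OF A less.prems(1) False less.prems(2)] by blast
    have uu: "u \<bullet> u = 1" using u by (simp add: norm_eq_1)
    define S' where "S' = {x \<in> S. x \<bullet> u = 0}"
    have sub: "subspace S'"
      using less.prems(1) by (auto simp: S'_def subspace_def inner_add_left)
    have "u \<notin> S'" "S' \<subseteq> S" using uu by (auto simp: S'_def)
    then have "S' \<subset> S" using u(1) by blast
    then have "dim S' < dim S"
      using sub less.prems(1) by (intro dim_psubset) (metis span_eq_iff)
    moreover have "A x \<in> S'" if "x \<in> S'" for x
      using that less.prems(2) u symmetricD[OF A, of x u] by (auto simp: S'_def)
    ultimately obtain E where E: "finite E" "pairwise orthogonal E"
      "\<forall>e\<in>E. norm e = 1 \<and> A e = (A e \<bullet> e) *\<^sub>R e" "span E = S'"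
      using less.hyps[OF _ sub] by blast
    have ES: "E \<subseteq> S'" using E(4) span_superset by blast
    have "span (insert u E) = S"
    proof
      show "span (insert u E) \<subseteq> S"
        using ES u less.prems(1) by (intro span_minimal) (auto simp: S'_def)
      show "S \<subseteq> span (insert u E)"
      proof
        fix x assume "x \<in> S"
        then have "x - (x \<bullet> u) *\<^sub>R u \<in> S'"
          using u uu less.prems(1) by (auto simp: S'_def inner_diff_left intro: subspace_diff subspace_scale)
        then have "x - (x \<bullet> u) *\<^sub>R u \<in> span E" using E by simp
        then show "x \<in> span (insert u E)" using span_breakdown_eq by blast
      qed
    qed
    moreover have "pairwise orthogonal (insert u E)"
      using E(2) ES by (auto simp: pairwise_insert orthogonal_def S'_def inner_commute)
    ultimately show ?thesis
      using E u uu by (intro exI[of _ "insert u E"]) auto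
  qed
qed

theorem symmetric_diagonalizable:
  fixes A :: "'a::euclidean_space \<Rightarrow>\<^sub>L 'a"
  assumes "A \<in> symmetric_maps"
  obtains E where "onb E" "diag_on E A"
  using symmetric_eigenbasis_subspace[OF assms subspace_UNIV] that
  unfolding onb_def diag_on_def by auto

lemma diag_on_exp_norm:
  assumes "onb E" "A \<in> symmetric_maps" "diag_on E A"
  shows "(norm (exp_blinfun A x))\<^sup>2 = (\<Sum>e\<in>E. exp (2 * (A e \<bullet> e)) * (x \<bullet> e)\<^sup>2)"
  unfolding onb_norm_eq[OF assms(1)]
  by (rule sum.cong) (simp_all add: diag_on_exp_inner[OF assms(2,3), where x = x] power_mult_distrib exp_double)

lemma diag_on_quadratic:
  assumes "onb E" "A \<in> symmetric_maps" "diag_on E A"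
  shows "A x \<bullet> x = (\<Sum>e\<in>E. (A e \<bullet> e) * (x \<bullet> e)\<^sup>2)"
  unfolding onb_inner_eq[OF assms(1), of "A x" x]
proof (rule sum.cong[OF refl])
  fix e assume "e \<in> E"
  then have "A x \<bullet> e = (A e \<bullet> e) * (x \<bullet> e)" by (rule diag_on_inner[OF assms(2,3)])
  then show "(A x \<bullet> e) * (x \<bullet> e) = (A e \<bullet> e) * (x \<bullet> e)\<^sup>2"
    by (simp only: power2_eq_square mult.assoc)
qed

lemma exp_symmetric_norm_ge:
  assumes "A \<in> symmetric_maps"
  shows "(norm (exp_blinfun A x))\<^sup>2 \<ge> (norm x)\<^sup>2 + 2 * (A x \<bullet> x)"
proof -
  obtain E where E: "onb E" "diag_on E A" using symmetric_diagonalizable[OF assms] .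
  have "(norm x)\<^sup>2 + 2 * (A x \<bullet> x) = (\<Sum>e\<in>E. (1 + 2 * (A e \<bullet> e)) * (x \<bullet> e)\<^sup>2)"
    unfolding onb_norm_eq[OF E(1)] diag_on_quadratic[OF E(1) assms E(2), of x] sum_distrib_left
    by (simp add: algebra_simps sum.distrib)
  also have "\<dots> \<le> (\<Sum>e\<in>E. exp (2 * (A e \<bullet> e)) * (x \<bullet> e)\<^sup>2)"
    by (intro sum_mono mult_right_mono exp_ge_add_one_self) auto
  finally show ?thesis by (simp add: diag_on_exp_norm[OF E(1) assms E(2)])
qed

lemma exp_symmetric_norm_convex:
  assumes "A \<in> symmetric_maps" "0 \<le> s" "s \<le> 1"
  shows "(norm (exp_blinfun (s *\<^sub>R A) x))\<^sup>2 \<le> (1 - s) * (norm x)\<^sup>2 + s * (norm (exp_blinfun A x))\<^sup>2"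
proof -
  obtain E where E: "onb E" "diag_on E A" using symmetric_diagonalizable[OF assms(1)] .
  have c: "exp (2 * (s * a)) \<le> (1 - s) + s * exp (2 * a)" for a :: real
    using convex_onD[OF exp_convex, of s 0 "2 * a"] assms by (simp add: mult_ac)
  have "(norm (exp_blinfun (s *\<^sub>R A) x))\<^sup>2 = (\<Sum>e\<in>E. exp (2 * (s * (A e \<bullet> e))) * (x \<bullet> e)\<^sup>2)"
    by (simp add: diag_on_exp_norm[OF E(1) symmetric_maps_scaleR[OF assms(1)] diag_on_scaleR[OF E(2)]]
        blinfun.scaleR_left)
  also have "\<dots> \<le> (\<Sum>e\<in>E. ((1 - s) + s * exp (2 * (A e \<bullet> e))) * (x \<bullet> e)\<^sup>2)"
    by (intro sum_mono mult_right_mono c) auto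
  also have "\<dots> = (1 - s) * (norm x)\<^sup>2 + s * (norm (exp_blinfun A x))\<^sup>2"
    unfolding onb_norm_eq[OF E(1), of x] diag_on_exp_norm[OF E(1) assms(1) E(2)] sum_distrib_left
      sum.distrib[symmetric]
    by (rule sum.cong) (simp_all add: algebra_simps)
  finally show ?thesis .
qed

lemma exp_half: "exp_blinfun A x = exp_blinfun ((1/2) *\<^sub>R A) (exp_blinfun ((1/2) *\<^sub>R A) x)"
proof -
  have "exp_blinfun ((1/2) *\<^sub>R A + (1/2) *\<^sub>R A) = exp_blinfun ((1/2) *\<^sub>R A) o\<^sub>L exp_blinfun ((1/2) *\<^sub>R A)"
    by (intro exp_blinfun_add refl)
  then show ?thesis by (simp flip: scaleR_left_distrib)
qed

lemma exp_symmetric_displacement: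
  assumes "A \<in> symmetric_maps"
  shows "(norm (exp_blinfun A x - x))\<^sup>2 =
    (norm (exp_blinfun A x))\<^sup>2 + (norm x)\<^sup>2 - 2 * (norm (exp_blinfun ((1/2) *\<^sub>R A) x))\<^sup>2"
proof -
  have "exp_blinfun A x \<bullet> x = (norm (exp_blinfun ((1/2) *\<^sub>R A) x))\<^sup>2"
    unfolding exp_half[of A x] power2_norm_eq_inner
    by (rule exp_symmetric[OF symmetric_maps_scaleR[OF assms]])
  then show ?thesis
    by (simp add: power2_norm_eq_inner inner_diff_left inner_diff_right inner_commute)
qed

lemma diag_on_abs_le_norm:
  fixes A :: "'a::euclidean_space \<Rightarrow>\<^sub>L 'a"
  assumes "onb E" "e \<in> E"
  shows "\<bar>A e \<bullet> e\<bar> \<le> norm A"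
  using Cauchy_Schwarz_ineq2[of "A e" e] norm_blinfun[of A e] assms by (auto simp: onb_def)

lemma diag_on_norm_attained:
  fixes A :: "'a::euclidean_space \<Rightarrow>\<^sub>L 'a"
  assumes "onb E" "A \<in> symmetric_maps" "diag_on E A"
  obtains e where "e \<in> E" "\<bar>A e \<bullet> e\<bar> = norm A"
proof -
  define m where "m = Max ((\<lambda>e. \<bar>A e \<bullet> e\<bar>) ` E)"
  have fin: "finite E" using assms by (simp add: onb_def)
  have ne: "E \<noteq> {}"
  proof
    assume "E = {}"
    then have "(UNIV :: 'a set) = {0}" using assms(1) by (simp add: onb_def)
    then show False using nonempty_Basis nonzero_Basis by blast
  qed
  have le: "\<bar>A e \<bullet> e\<bar> \<le> m" if "e \<in> E" for e using that fin by (simp add: m_def)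
  have m0: "0 \<le> m" using le ne by (meson abs_ge_zero all_not_in_conv order_trans)
  have "norm A \<le> m"
  proof (rule norm_blinfun_bound[OF m0])
    fix x
    have "(norm (A x))\<^sup>2 = (\<Sum>e\<in>E. (A e \<bullet> e)\<^sup>2 * (x \<bullet> e)\<^sup>2)"
      unfolding onb_norm_eq[OF assms(1)]
      by (rule sum.cong) (simp_all add: diag_on_inner[OF assms(2,3), where x = x] power_mult_distrib)
    also have "\<dots> \<le> (\<Sum>e\<in>E. m\<^sup>2 * (x \<bullet> e)\<^sup>2)"
      using le m0 by (intro sum_mono mult_right_mono) (auto simp flip: abs_le_square_iff)
    also have "\<dots> = (m * norm x)\<^sup>2"
      by (simp add: onb_norm_eq[OF assms(1)] sum_distrib_left power_mult_distrib)
    finally show "norm (A x) \<le> m * norm x"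
      using m0 by (auto intro: power2_le_imp_le)
  qed
  moreover obtain e where "e \<in> E" "m = \<bar>A e \<bullet> e\<bar>"
    using Max_in[of "(\<lambda>e. \<bar>A e \<bullet> e\<bar>) ` E"] fin ne unfolding m_def by blast
  ultimately show thesis
    using diag_on_abs_le_norm[OF assms(1), of e A] that by force
qed

lemma exp_norm_le_symmetric:
  assumes "A \<in> symmetric_maps"
  shows "exp (norm A) \<le> max (norm (exp_blinfun A)) (norm (exp_blinfun (- A)))"
proof -
  obtain E where E: "onb E" "diag_on E A" using symmetric_diagonalizable[OF assms] .
  obtain e where e: "e \<in> E" "\<bar>A e \<bullet> e\<bar> = norm A"
    using diag_on_norm_attained[OF E(1) assms E(2)] .
  have ne: "norm e = 1" using E e by (simp add: onb_def)
  have Ae: "A e = (A e \<bullet> e) *\<^sub>R e" using E e by (simp add: diag_on_def)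
  have "(- A) e = (- (A e \<bullet> e)) *\<^sub>R e" by (subst blinfun.minus_left, subst Ae) simp
  from exp_blinfun_eigenvector[OF Ae] exp_blinfun_eigenvector[OF this]
  have "norm (exp_blinfun (- A) e) = exp (- (A e \<bullet> e))" "norm (exp_blinfun A e) = exp (A e \<bullet> e)"
    using ne by (metis abs_exp_cancel mult.right_neutral norm_scaleR)+
  moreover have "norm (exp_blinfun A e) \<le> norm (exp_blinfun A)"
    "norm (exp_blinfun (- A) e) \<le> norm (exp_blinfun (- A))"
    using norm_blinfun[of "exp_blinfun A" e] norm_blinfun[of "exp_blinfun (- A)" e] ne by simp_all
  ultimately show ?thesis using e(2) by (auto simp: abs_if split: if_splits)
qed

section \<open>Reductive groups\<close>

lemma group_GL: "group (GL :: ('a::euclidean_space \<Rightarrow>\<^sub>L 'a) monoid)"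
proof -
  have "monoid (End_monoid :: ('a \<Rightarrow>\<^sub>L 'a) monoid)"
    by unfold_locales (auto simp: End_monoid_def intro!: blinfun_eqI)
  then show ?thesis unfolding GL_def by (rule monoid.units_group)
qed

lemma GL_simps:
  "\<one>\<^bsub>GL\<^esub> = id_blinfun" "x \<otimes>\<^bsub>GL\<^esub> y = x o\<^sub>L y"
  "carrier GL = {x. \<exists>y. y o\<^sub>L x = id_blinfun \<and> x o\<^sub>L y = id_blinfun}"
  by (auto simp: GL_def End_monoid_def units_of_def Units_def)

locale reductive =
  fixes G :: "('a::euclidean_space \<Rightarrow>\<^sub>L 'a) set"
  assumes reductive: "real_reductive G"
begin

abbreviation "K \<equiv> K_part G"
abbreviation "\<pp> \<equiv> p_part G"

lemma subgroup: "subgroup G GL"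
  using reductive by (simp add: real_reductive_def closed_subgroup_GL_def)

lemma one_mem: "id_blinfun \<in> G"
  using subgroup.one_closed[OF subgroup] by (simp add: GL_simps)

lemma mult_mem: "g \<in> G \<Longrightarrow> h \<in> G \<Longrightarrow> g o\<^sub>L h \<in> G"
  using subgroup.m_closed[OF subgroup] by (simp add: GL_simps)

lemma inverse_mem:
  assumes "g \<in> G"
  obtains h where "h \<in> G" "g o\<^sub>L h = id_blinfun" "h o\<^sub>L g = id_blinfun" "\<And>x. g (h x) = x" "\<And>x. h (g x) = x"
proof -
  have c: "g \<in> carrier GL" using assms subgroup.mem_carrier[OF subgroup] by blast
  have h: "inv\<^bsub>GL\<^esub> g \<in> G" using assms subgroup.m_inv_closed[OF subgroup] by blast
  have 1: "g o\<^sub>L inv\<^bsub>GL\<^esub> g = id_blinfun" "inv\<^bsub>GL\<^esub> g o\<^sub>L g = id_blinfun"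
    using group.r_inv[OF group_GL c] group.l_inv[OF group_GL c] by (simp_all only: GL_simps)
  show thesis
  proof (rule that[OF h 1])
    show "g ((inv\<^bsub>GL\<^esub> g) x) = x" for x
      using arg_cong[OF 1(1), of "\<lambda>f. f x"] by simp
    show "(inv\<^bsub>GL\<^esub> g) (g x) = x" for x
      using arg_cong[OF 1(2), of "\<lambda>f. f x"] by simp
  qed
qed

lemma limit_mem:
  assumes "\<And>n. x n \<in> G" "x \<longlonglongrightarrow> g" "g o\<^sub>L h = id_blinfun" "h o\<^sub>L g = id_blinfun"
  shows "g \<in> G"
proof -
  have "closedin (top_of_set (carrier GL)) G"
    using reductive by (simp add: real_reductive_def closed_subgroup_GL_def)
  then obtain T where T: "closed T" "G = carrier GL \<inter> T"
    by (auto simp: closedin_closed)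
  have "g \<in> T" using closed_sequentially[OF T(1), of x g] assms(1,2) T(2) by blast
  moreover have "g \<in> carrier GL" using assms(3,4) by (auto simp: GL_simps)
  ultimately show ?thesis using T by blast
qed

lemma polar:
  assumes "g \<in> G"
  obtains k A where "k \<in> K" "A \<in> \<pp>" "g = k o\<^sub>L exp_blinfun A"
  using assms reductive unfolding real_reductive_def by blast

lemma K_mem: "k \<in> K \<Longrightarrow> k \<in> G"
  by (simp add: K_part_def)

lemma K_inner: "k \<in> K \<Longrightarrow> k x \<bullet> k y = x \<bullet> y"
  by (simp add: K_part_def orthogonal_maps_def orthogonal_transformation_def)

lemma K_I: "g \<in> G \<Longrightarrow> (\<And>x. norm (g x) = norm x) \<Longrightarrow> g \<in> K"
  by (simp add: K_part_def orthogonal_maps_def orthogonal_transformation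
      bounded_linear.linear[OF blinfun.bounded_linear_right])

lemma K_norm [simp]: "k \<in> K \<Longrightarrow> norm (k x) = norm x"
  by (simp add: K_part_def orthogonal_maps_def orthogonal_transformation_norm)

lemma K_one: "id_blinfun \<in> K"
  by (rule K_I) (auto simp: one_mem)

lemma K_mult: "k \<in> K \<Longrightarrow> l \<in> K \<Longrightarrow> k o\<^sub>L l \<in> K"
  by (rule K_I) (auto simp: mult_mem K_mem)

lemma K_inverse:
  assumes "k \<in> K"
  obtains l where "l \<in> K" "k o\<^sub>L l = id_blinfun" "l o\<^sub>L k = id_blinfun"
    "\<And>x. k (l x) = x" "\<And>x. l (k x) = x" "\<And>x y. k x \<bullet> y = x \<bullet> l y"
proof -
  obtain l where l: "l \<in> G" "k o\<^sub>L l = id_blinfun" "l o\<^sub>L k = id_blinfun" "\<And>x. k (l x) = x" "\<And>x. l (k x) = x"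
    by (rule inverse_mem[OF K_mem[OF assms]]) blast
  have "l \<in> K" using l(1) by (rule K_I) (metis K_norm assms l(4))
  moreover have "k x \<bullet> y = x \<bullet> l y" for x y using K_inner[OF assms, of x "l y"] l(4) by simp
  ultimately show thesis using l that by blast
qed

lemma K_bounded: "k \<in> K \<Longrightarrow> norm k \<le> 1"
  by (rule norm_blinfun_bound) auto

lemma K_compact: "compact K"
proof -
  have "bounded K" using K_bounded by (auto simp: bounded_iff)
  moreover have "closed K"
    unfolding closed_sequential_limits
  proof (intro allI impI, elim conjE)
    fix x l assume x: "\<forall>n. x n \<in> K" and lim: "x \<longlonglongrightarrow> l"
    show "l \<in> K"
    proof (rule K_I)
      show n: "norm (l v) = norm v" for v
      proof -
        have "(\<lambda>n. norm (x n v)) \<longlonglongrightarrow> norm (l v)"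
          by (intro tendsto_intros lim)
        then show ?thesis using x by (simp add: LIMSEQ_const_iff)
      qed
      have "inj (blinfun_apply l)"
        by (rule injI) (metis n blinfun.diff_right norm_eq_zero right_minus_eq)
      then obtain f where f: "linear f" "\<And>x. f (l x) = x" "\<And>x. l (f x) = x"
        using linear_injective_isomorphism[of "blinfun_apply l"]
          bounded_linear.linear[OF blinfun.bounded_linear_right] by blast
      then have "l o\<^sub>L Blinfun f = id_blinfun" "Blinfun f o\<^sub>L l = id_blinfun"
        by (auto intro!: blinfun_eqI simp: bounded_linear_Blinfun_apply linear_conv_bounded_linear)
      then show "l \<in> G" using limit_mem[OF _ lim] x K_mem by blast
    qed
  qed
  ultimately show ?thesis by (simp add: compact_eq_bounded_closed)
qed

lemma K_subseq:
  fixes k :: "nat \<Rightarrow> 'a \<Rightarrow>\<^sub>L 'a"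
  assumes "\<And>n. k n \<in> K"
  obtains l r where "l \<in> K" "strict_mono (r :: nat \<Rightarrow> nat)" "(\<lambda>n. k (r n)) \<longlonglongrightarrow> l"
proof -
  have "\<exists>l\<in>K. \<exists>r. strict_mono r \<and> (k \<circ> r) \<longlonglongrightarrow> l"
    using compact_imp_seq_compact[OF K_compact] assms unfolding seq_compact_def by simp
  then show thesis using that by (auto simp: o_def)
qed

lemma p_symmetric: "A \<in> \<pp> \<Longrightarrow> A \<in> symmetric_maps"
  by (simp add: p_part_def)

lemma p_exp_mem: "A \<in> \<pp> \<Longrightarrow> exp_blinfun (t *\<^sub>R A) \<in> G"
  by (simp add: p_part_def lie_algebra_def)

lemma p_exp_mem_1: "A \<in> \<pp> \<Longrightarrow> exp_blinfun A \<in> G"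
  using p_exp_mem[of A 1] by simp

lemma p_scaleR: "A \<in> \<pp> \<Longrightarrow> c *\<^sub>R A \<in> \<pp>"
  by (simp add: p_part_def lie_algebra_def symmetric_maps_scaleR)

lemma p_add_commuting:
  assumes "A \<in> \<pp>" "B \<in> \<pp>" "A o\<^sub>L B = B o\<^sub>L A"
  shows "A + B \<in> \<pp>"
proof -
  have "exp_blinfun (t *\<^sub>R (A + B)) = exp_blinfun (t *\<^sub>R A) o\<^sub>L exp_blinfun (t *\<^sub>R B)" for t
  proof -
    have "(t *\<^sub>R A) o\<^sub>L (t *\<^sub>R B) = (t *\<^sub>R B) o\<^sub>L (t *\<^sub>R A)"
      using assms(3) by (simp add: bounded_bilinear.scaleR_left[OF bounded_bilinear_blinfun_compose]
        bounded_bilinear.scaleR_right[OF bounded_bilinear_blinfun_compose])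
    then show ?thesis by (simp add: scaleR_add_right exp_blinfun_add)
  qed
  then show ?thesis
    using assms by (simp add: p_part_def lie_algebra_def symmetric_maps_add mult_mem)
qed

lemma p_conjugate:
  assumes "A \<in> \<pp>" "k \<in> K" "l \<in> K" "l o\<^sub>L k = id_blinfun"
  shows "k o\<^sub>L A o\<^sub>L l \<in> \<pp>"
proof -
  have "exp_blinfun (t *\<^sub>R (k o\<^sub>L A o\<^sub>L l)) = k o\<^sub>L exp_blinfun (t *\<^sub>R A) o\<^sub>L l" for t
  proof -
    have "t *\<^sub>R (k o\<^sub>L A o\<^sub>L l) = k o\<^sub>L (t *\<^sub>R A) o\<^sub>L l"
      by (rule blinfun_eqI) (simp add: blinfun.scaleR_left blinfun.scaleR_right)
    then show ?thesis by (simp add: exp_blinfun_conjugate[OF assms(4)])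
  qed
  then have "k o\<^sub>L A o\<^sub>L l \<in> lie_algebra G"
    using assms by (simp add: lie_algebra_def mult_mem K_mem p_exp_mem)
  moreover have "k o\<^sub>L A o\<^sub>L l \<in> symmetric_maps"
  proof -
    have lk: "l (k x) = x" for x
      using arg_cong[OF assms(4), of "\<lambda>f. f x"] by simp
    have kl: "k x \<bullet> y = x \<bullet> l y" for x y
      using K_inner[OF assms(3), of "k x" y] by (simp add: lk)
    then show ?thesis
      using symmetricD[OF p_symmetric[OF assms(1)]] by (auto simp: symmetric_maps_def) (metis inner_commute)
  qed
  ultimately show ?thesis by (simp add: p_part_def)
qed

lemma lie_algebra_closed:
  assumes "\<And>n. A n \<in> lie_algebra G" "A \<longlonglongrightarrow> B"
  shows "B \<in> lie_algebra G"
proof -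
  have "exp_blinfun (t *\<^sub>R B) \<in> G" for t
  proof (rule limit_mem)
    show "exp_blinfun (t *\<^sub>R A n) \<in> G" for n using assms(1) by (simp add: lie_algebra_def)
    show "(\<lambda>n. exp_blinfun (t *\<^sub>R A n)) \<longlonglongrightarrow> exp_blinfun (t *\<^sub>R B)"
      by (intro tendsto_exp_blinfun tendsto_intros assms)
  qed (rule exp_blinfun_minus)+
  then show ?thesis by (simp add: lie_algebra_def)
qed

lemma p_closed:
  assumes "\<And>n. A n \<in> \<pp>" "A \<longlonglongrightarrow> B"
  shows "B \<in> \<pp>"
proof -
  have "B x \<bullet> y = x \<bullet> B y" for x y
  proof (rule LIMSEQ_unique)
    show "(\<lambda>n. A n x \<bullet> y) \<longlonglongrightarrow> B x \<bullet> y" by (intro tendsto_intros assms)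
    have "(\<lambda>n. x \<bullet> A n y) \<longlonglongrightarrow> x \<bullet> B y" by (intro tendsto_intros assms)
    then show "(\<lambda>n. A n x \<bullet> y) \<longlonglongrightarrow> x \<bullet> B y"
      using symmetricD[OF p_symmetric[OF assms(1)]] by simp
  qed
  moreover have "B \<in> lie_algebra G"
    by (rule lie_algebra_closed[OF _ assms(2)]) (use assms(1) in \<open>simp add: p_part_def\<close>)
  ultimately show ?thesis by (simp add: p_part_def symmetric_maps_def)
qed

lemma power_mem: "g \<in> G \<Longrightarrow> (((o\<^sub>L) g) ^^ n) id_blinfun \<in> G"
  by (induction n) (auto simp: one_mem mult_mem)

lemma exp_tangent_mem:
  assumes "\<And>s. \<gamma> s \<in> G" "\<gamma> 0 = id_blinfun" "(\<gamma> has_vector_derivative Z) (at 0)"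
  shows "exp_blinfun Z \<in> G"
proof -
  have "(\<lambda>n. real n *\<^sub>R (\<gamma> (inverse (real n)) - id_blinfun)) \<longlonglongrightarrow> Z"
    using has_vector_derivative_sequentially[OF assms(3)] by (simp only: assms(2))
  from blinfun_power_tendsto_exp[OF this] show ?thesis
    by (rule limit_mem[rotated]) (auto intro: power_mem assms exp_blinfun_minus)
qed

lemma lie_algebraI:
  assumes "\<And>s. \<gamma> s \<in> G" "\<gamma> 0 = id_blinfun" "(\<gamma> has_vector_derivative Z) (at 0)"
  shows "Z \<in> lie_algebra G"
proof -
  have "exp_blinfun (t *\<^sub>R Z) \<in> G" for t
  proof (rule exp_tangent_mem)
    have "((\<gamma> \<circ> (\<lambda>s. t * s)) has_vector_derivative t *\<^sub>R Z) (at 0)"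
      using assms(3) by (intro vector_diff_chain_at) (auto intro!: derivative_eq_intros)
    then show "((\<lambda>s. \<gamma> (t * s)) has_vector_derivative t *\<^sub>R Z) (at 0)" by (simp add: o_def)
  qed (use assms in auto)
  then show ?thesis by (simp add: lie_algebra_def)
qed

lemma lie_algebra_scaleR: "A \<in> lie_algebra G \<Longrightarrow> c *\<^sub>R A \<in> lie_algebra G"
  by (simp add: lie_algebra_def)

lemma lie_algebra_exp_mem: "A \<in> lie_algebra G \<Longrightarrow> exp_blinfun (t *\<^sub>R A) \<in> G"
  by (simp add: lie_algebra_def)

lemma lie_algebra_add:
  assumes "A \<in> lie_algebra G" "B \<in> lie_algebra G"
  shows "A + B \<in> lie_algebra G"
proof (rule lie_algebraI)
  show "exp_blinfun (s *\<^sub>R A) o\<^sub>L exp_blinfun (s *\<^sub>R B) \<in> G" for s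
    using assms by (intro mult_mem lie_algebra_exp_mem)
  show "exp_blinfun (0 *\<^sub>R A) o\<^sub>L exp_blinfun (0 *\<^sub>R B) = id_blinfun"
    by (rule blinfun_eqI) simp
  have "((\<lambda>s. exp_blinfun (s *\<^sub>R A) o\<^sub>L exp_blinfun (s *\<^sub>R B)) has_vector_derivative
     (exp_blinfun (0 *\<^sub>R A) o\<^sub>L (exp_blinfun (0 *\<^sub>R B) o\<^sub>L B)) + ((exp_blinfun (0 *\<^sub>R A) o\<^sub>L A) o\<^sub>L exp_blinfun (0 *\<^sub>R B))) (at 0)"
    by (rule bounded_bilinear.has_vector_derivative[OF bounded_bilinear_blinfun_compose
          exp_blinfun_has_vector_derivative exp_blinfun_has_vector_derivative])
  moreover have "(exp_blinfun (0 *\<^sub>R A) o\<^sub>L (exp_blinfun (0 *\<^sub>R B) o\<^sub>L B)) + ((exp_blinfun (0 *\<^sub>R A) o\<^sub>L A) o\<^sub>L exp_blinfun (0 *\<^sub>R B)) = A + B"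
    by (rule blinfun_eqI) (simp add: blinfun.add_left)
  ultimately show "((\<lambda>s. exp_blinfun (s *\<^sub>R A) o\<^sub>L exp_blinfun (s *\<^sub>R B)) has_vector_derivative A + B) (at 0)"
    by simp
qed

lemma lie_algebra_conjugate:
  assumes "B \<in> lie_algebra G" "g \<in> G" "h \<in> G" "h o\<^sub>L g = id_blinfun"
  shows "g o\<^sub>L B o\<^sub>L h \<in> lie_algebra G"
proof -
  have "exp_blinfun (t *\<^sub>R (g o\<^sub>L B o\<^sub>L h)) = g o\<^sub>L exp_blinfun (t *\<^sub>R B) o\<^sub>L h" for t
  proof -
    have "t *\<^sub>R (g o\<^sub>L B o\<^sub>L h) = g o\<^sub>L (t *\<^sub>R B) o\<^sub>L h"
      by (rule blinfun_eqI) (simp add: blinfun.scaleR_left blinfun.scaleR_right)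
    then show ?thesis by (simp add: exp_blinfun_conjugate[OF assms(4)])
  qed
  then show ?thesis
    using assms by (simp add: lie_algebra_def mult_mem)
qed

lemma lie_algebra_bracket:
  assumes A: "A \<in> lie_algebra G" and B: "B \<in> lie_algebra G"
  shows "(A o\<^sub>L B) - (B o\<^sub>L A) \<in> lie_algebra G"
proof -
  define f where "f s = exp_blinfun (s *\<^sub>R A) o\<^sub>L B o\<^sub>L exp_blinfun (s *\<^sub>R (- A))" for s
  have fL: "f s \<in> lie_algebra G" for s
    unfolding f_def
  proof (rule lie_algebra_conjugate[OF B])
    show "exp_blinfun (s *\<^sub>R A) \<in> G" using A by (rule lie_algebra_exp_mem)
    show "exp_blinfun (s *\<^sub>R (- A)) \<in> G"
      using lie_algebra_exp_mem[OF A, of "- s"] by simp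
    show "exp_blinfun (s *\<^sub>R (- A)) o\<^sub>L exp_blinfun (s *\<^sub>R A) = id_blinfun"
      using exp_blinfun_minus(2)[of "s *\<^sub>R A"] by simp
  qed
  have f0: "f 0 = B" by (rule blinfun_eqI) (simp add: f_def)
  have "(f has_vector_derivative
     ((exp_blinfun (0 *\<^sub>R A) o\<^sub>L B) o\<^sub>L (exp_blinfun (0 *\<^sub>R (- A)) o\<^sub>L (- A))) +
     (((exp_blinfun (0 *\<^sub>R A) o\<^sub>L 0) + ((exp_blinfun (0 *\<^sub>R A) o\<^sub>L A) o\<^sub>L B)) o\<^sub>L exp_blinfun (0 *\<^sub>R (- A)))) (at 0)"
    unfolding f_def
    by (rule bounded_bilinear.has_vector_derivative[OF bounded_bilinear_blinfun_compose
          bounded_bilinear.has_vector_derivative[OF bounded_bilinear_blinfun_compose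
            exp_blinfun_has_vector_derivative has_vector_derivative_const]
          exp_blinfun_has_vector_derivative])
  moreover have "((exp_blinfun (0 *\<^sub>R A) o\<^sub>L B) o\<^sub>L (exp_blinfun (0 *\<^sub>R (- A)) o\<^sub>L (- A))) +
     (((exp_blinfun (0 *\<^sub>R A) o\<^sub>L 0) + ((exp_blinfun (0 *\<^sub>R A) o\<^sub>L A) o\<^sub>L B)) o\<^sub>L exp_blinfun (0 *\<^sub>R (- A))) =
     (A o\<^sub>L B) - (B o\<^sub>L A)"
    by (rule blinfun_eqI) (simp add: blinfun.bilinear_simps)
  ultimately have "(f has_vector_derivative ((A o\<^sub>L B) - (B o\<^sub>L A))) (at 0)" by simp
  from has_vector_derivative_sequentially[OF this]
  have "(\<lambda>n. real n *\<^sub>R (f (inverse (real n)) - B)) \<longlonglongrightarrow> (A o\<^sub>L B) - (B o\<^sub>L A)"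
    by (simp only: f0)
  moreover have "real n *\<^sub>R (f (inverse (real n)) - B) \<in> lie_algebra G" for n
    using lie_algebra_scaleR[OF lie_algebra_add[OF fL lie_algebra_scaleR[OF B, of "- 1"]]] by simp
  ultimately show ?thesis by (rule lie_algebra_closed[rotated])
qed

end

section \<open>Conjugation into a maximal abelian subspace\<close>

definition eigenvalues :: "('a::euclidean_space \<Rightarrow>\<^sub>L 'a) \<Rightarrow> real set" where
  "eigenvalues A = {c. \<exists>v. v \<noteq> 0 \<and> A v = c *\<^sub>R v}"

lemma eigenvalues_diag:
  assumes "onb E" "A \<in> symmetric_maps" "diag_on E A"
  shows "eigenvalues A \<subseteq> (\<lambda>e. A e \<bullet> e) ` E"
proof
  fix c assume "c \<in> eigenvalues A"
  then obtain v where v: "v \<noteq> 0" "A v = c *\<^sub>R v" by (auto simp: eigenvalues_def)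
  obtain e where e: "e \<in> E" "v \<bullet> e \<noteq> 0"
    using v(1) onb_eqI[OF assms(1), of v 0] by auto
  have "c * (v \<bullet> e) = (A e \<bullet> e) * (v \<bullet> e)"
    using diag_on_inner[OF assms(2,3) e(1), of v] v(2) by simp
  then show "c \<in> (\<lambda>e. A e \<bullet> e) ` E" using e by auto
qed

lemma eigenvalues_finite:
  fixes A :: "'a::euclidean_space \<Rightarrow>\<^sub>L 'a"
  assumes "A \<in> symmetric_maps"
  shows "finite (eigenvalues A) \<and> card (eigenvalues A) \<le> DIM('a)"
proof -
  obtain E where E: "onb E" "diag_on E A" using symmetric_diagonalizable[OF assms] .
  have "card E \<le> DIM('a)" by (rule onb_card[OF E(1)])
  then show ?thesis
    using eigenvalues_diag[OF E(1) assms E(2)] onb_finite[OF E(1)]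
    by (meson card_image_le card_mono finite_imageI finite_subset order_trans)
qed

lemma commuting_joint_eigenvector:
  fixes A B :: "'a::euclidean_space \<Rightarrow>\<^sub>L 'a"
  assumes "B \<in> symmetric_maps" "A o\<^sub>L B = B o\<^sub>L A" "c \<in> eigenvalues A"
  obtains v d where "v \<noteq> 0" "A v = c *\<^sub>R v" "B v = d *\<^sub>R v"
proof -
  define S where "S = {x. A x = c *\<^sub>R x}"
  have sub: "subspace S"
    by (auto simp: S_def subspace_def blinfun.bilinear_simps scaleR_add_right)
  have "S \<noteq> {0}" using assms(3) by (auto simp: S_def eigenvalues_def)
  moreover have "B x \<in> S" if "x \<in> S" for x
    using that arg_cong[OF assms(2), of "\<lambda>f. f x"] by (simp add: S_def blinfun.scaleR_right)
  ultimately obtain u d where u: "u \<in> S" "norm u = 1" "B u = d *\<^sub>R u"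
    using symmetric_eigenvector[OF assms(1) sub] by blast
  show thesis
    using u by (intro that[of u d]) (auto simp: S_def)
qed

context reductive
begin

lemma p_zero: "0 \<in> \<pp>"
  by (simp add: p_part_def lie_algebra_def symmetric_maps_def one_mem)

lemma exists_max_eigenvalues:
  obtains H where "H \<in> \<pp>" "\<And>A. A \<in> \<pp> \<Longrightarrow> card (eigenvalues A) \<le> card (eigenvalues H)"
proof -
  have "card (eigenvalues A) < Suc DIM('a)" if "A \<in> \<pp>" for A
    using eigenvalues_finite[OF p_symmetric[OF that]] by simp
  then have "\<exists>H. H \<in> \<pp> \<and> (\<forall>A. A \<in> \<pp> \<longrightarrow> card (eigenvalues A) \<le> card (eigenvalues H))"
    using ex_has_greatest_nat[of "\<lambda>A. A \<in> \<pp>" 0 "\<lambda>A. card (eigenvalues A)" "Suc DIM('a)"] p_zero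
    by (metis less_imp_le)
  then show thesis using that by blast
qed

text \<open>If \<open>X\<close> were not scalar on some eigenspace of \<open>H\<close>, a small generic perturbation \<open>H + \<epsilon> X\<close>
  would have more eigenvalues than \<open>H\<close>.\<close>

lemma commuting_scalar_on_eigenspaces:
  assumes H: "H \<in> \<pp>" and max: "\<And>A. A \<in> \<pp> \<Longrightarrow> card (eigenvalues A) \<le> card (eigenvalues H)"
    and X: "X \<in> \<pp>" and comm: "H o\<^sub>L X = X o\<^sub>L H" and v: "H v = c *\<^sub>R v"
  obtains d where "X v = d *\<^sub>R v"
proof -
  define J where "J = {(m, x). \<exists>v. v \<noteq> 0 \<and> H v = m *\<^sub>R v \<and> X v = x *\<^sub>R v}"
  have "J \<subseteq> eigenvalues H \<times> eigenvalues X" by (auto simp: J_def eigenvalues_def)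
  then have finJ: "finite J"
    using eigenvalues_finite[OF p_symmetric[OF H]] eigenvalues_finite[OF p_symmetric[OF X]]
    by (meson finite_SigmaI finite_subset)
  define bad where "bad = (\<lambda>(p, q). (fst p - fst q) / (snd q - snd p)) ` (J \<times> J)"
  have "finite bad" using finJ by (simp add: bad_def)
  then obtain \<epsilon> where \<epsilon>: "\<epsilon> \<notin> bad" using ex_new_if_finite[OF infinite_UNIV_char_0] by blast
  define q where "q p = fst p + \<epsilon> * snd p" for p :: "real \<times> real"
  have "inj_on q J"
  proof (rule inj_onI)
    fix a b assume ab: "a \<in> J" "b \<in> J" "q a = q b"
    show "a = b"
    proof (cases "snd a = snd b")
      case True
      then show ?thesis using ab(3) by (simp add: q_def prod_eq_iff)
    next
      case False
      then have "\<epsilon> = (fst a - fst b) / (snd b - snd a)"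
        using ab(3) by (simp add: q_def field_simps)
      then have "\<epsilon> \<in> bad" using ab by (auto simp: bad_def intro!: image_eqI[of _ _ "(a, b)"])
      then show ?thesis using \<epsilon> by simp
    qed
  qed
  then have "card J = card (q ` J)" by (simp add: card_image)
  also have "\<dots> \<le> card (eigenvalues (H + \<epsilon> *\<^sub>R X))"
  proof (rule card_mono)
    have HX: "H + \<epsilon> *\<^sub>R X \<in> \<pp>"
      using comm by (intro p_add_commuting H p_scaleR X)
        (simp add: bounded_bilinear.scaleR_left[OF bounded_bilinear_blinfun_compose]
          bounded_bilinear.scaleR_right[OF bounded_bilinear_blinfun_compose])
    show "finite (eigenvalues (H + \<epsilon> *\<^sub>R X))"
      using eigenvalues_finite[OF p_symmetric[OF HX]] by simp
    show "q ` J \<subseteq> eigenvalues (H + \<epsilon> *\<^sub>R X)"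
      by (auto simp: J_def q_def eigenvalues_def blinfun.add_left blinfun.scaleR_left scaleR_add_left)
  qed
  also have "\<dots> \<le> card (eigenvalues H)"
    using comm by (intro max p_add_commuting H p_scaleR X)
      (simp add: bounded_bilinear.scaleR_left[OF bounded_bilinear_blinfun_compose]
        bounded_bilinear.scaleR_right[OF bounded_bilinear_blinfun_compose])
  also have "\<dots> \<le> card (fst ` J)"
  proof (rule card_mono)
    show "eigenvalues H \<subseteq> fst ` J"
    proof
      fix m assume "m \<in> eigenvalues H"
      from commuting_joint_eigenvector[OF p_symmetric[OF X] comm this]
      obtain u d where "u \<noteq> 0" "H u = m *\<^sub>R u" "X u = d *\<^sub>R u" .
      then have "(m, d) \<in> J" by (auto simp: J_def)
      then show "m \<in> fst ` J" by force
    qed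
  qed (use finJ in simp)
  finally have inj: "inj_on fst J"
    using card_image_le[OF finJ, of fst] by (intro eq_card_imp_inj_on finJ) simp
  define S where "S = {x. H x = c *\<^sub>R x}"
  have sub: "subspace S"
    by (auto simp: S_def subspace_def blinfun.bilinear_simps scaleR_add_right)
  have "X x \<in> S" if "x \<in> S" for x
    using that arg_cong[OF comm, of "\<lambda>f. f x"] by (simp add: S_def blinfun.scaleR_right)
  from symmetric_eigenbasis_subspace[OF p_symmetric[OF X] sub this]
  obtain F where F: "\<forall>e\<in>F. norm e = 1 \<and> X e = (X e \<bullet> e) *\<^sub>R e" "span F = S" by blast
  have J: "(c, X f \<bullet> f) \<in> J" if "f \<in> F" for f
  proof -
    have "f \<in> S" using that F(2) span_base by blast
    then show ?thesis using F(1) that by (auto simp: J_def S_def intro!: exI[of _ f])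
  qed
  obtain d where d: "\<And>f. f \<in> F \<Longrightarrow> X f = d *\<^sub>R f"
  proof (cases "F = {}")
    case False
    then obtain f0 where f0: "f0 \<in> F" by blast
    have "X f = (X f0 \<bullet> f0) *\<^sub>R f" if "f \<in> F" for f
      using inj_onD[OF inj _ J[OF that] J[OF f0]] F(1) that by auto
    then show ?thesis using that by blast
  qed (use that in blast)
  have "subspace {x. X x = d *\<^sub>R x}"
    by (auto simp: subspace_def blinfun.bilinear_simps scaleR_add_right)
  then have "span F \<subseteq> {x. X x = d *\<^sub>R x}" using d by (intro span_minimal) auto
  moreover have "v \<in> span F" using v F(2) by (simp add: S_def)
  ultimately show thesis using that by blast
qed

text \<open>At a maximiser \<open>l\<close> of \<open>\<Sum>b\<in>E. (H b \<bullet> b) * (X (l b) \<bullet> l b)\<close> over \<open>K\<close>, moving \<open>l\<close> in the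
  direction of the bracket of \<open>l\<^sup>-\<^sup>1 X l\<close> and \<open>H\<close> shows that the bracket vanishes.\<close>

lemma conjugate_commuting:
  assumes H: "H \<in> \<pp>" and X: "X \<in> \<pp>"
  obtains k l where "k \<in> K" "l \<in> K" "k o\<^sub>L l = id_blinfun" "l o\<^sub>L k = id_blinfun"
    "H o\<^sub>L (k o\<^sub>L X o\<^sub>L l) = (k o\<^sub>L X o\<^sub>L l) o\<^sub>L H"
proof -
  obtain E where E: "onb E" "diag_on E H" using symmetric_diagonalizable[OF p_symmetric[OF H]] .
  define h where "h b = H b \<bullet> b" for b
  define \<phi> where "\<phi> l = (\<Sum>b\<in>E. h b * (X (blinfun_apply l b) \<bullet> l b))" for l
  have "continuous_on K \<phi>" unfolding \<phi>_def by (intro continuous_intros)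
  then obtain l where l: "l \<in> K" and max: "\<And>z. z \<in> K \<Longrightarrow> \<phi> z \<le> \<phi> l"
    using continuous_attains_sup[OF K_compact] K_one by blast
  obtain k where k: "k \<in> K" "l o\<^sub>L k = id_blinfun" "k o\<^sub>L l = id_blinfun" "\<And>x y. l x \<bullet> y = x \<bullet> k y"
    by (rule K_inverse[OF l]) blast
  define Y where "Y = k o\<^sub>L X o\<^sub>L l"
  have Y: "Y \<in> \<pp>" unfolding Y_def by (rule p_conjugate[OF X k(1) l k(2)])
  define Z where "Z = (Y o\<^sub>L H) - (H o\<^sub>L Y)"
  have Zapp: "Z x = Y (H x) - H (Y x)" for x by (simp add: Z_def blinfun.diff_left)
  have Zlie: "Z \<in> lie_algebra G"
    unfolding Z_def using Y H by (intro lie_algebra_bracket) (auto simp: p_part_def)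
  have skew: "Z x \<bullet> y = x \<bullet> (- Z) y" for x y
    using symmetricD[OF p_symmetric[OF Y]] symmetricD[OF p_symmetric[OF H]]
    by (simp add: Zapp blinfun.minus_left inner_diff_left inner_diff_right)
  define u where "u s = exp_blinfun (s *\<^sub>R Z)" for s
  have uK: "u s \<in> K" for s
  proof (rule K_I)
    show "u s \<in> G" unfolding u_def by (rule lie_algebra_exp_mem[OF Zlie])
    fix x
    have "u s x \<bullet> u s x = x \<bullet> exp_blinfun (- (s *\<^sub>R Z)) (u s x)"
      unfolding u_def by (rule exp_blinfun_adjoint) (simp add: blinfun.bilinear_simps skew)
    also have "\<dots> = x \<bullet> x" by (simp add: u_def)
    finally show "norm (u s x) = norm x" by (simp add: norm_eq)
  qed
  define \<psi> where "\<psi> s = (\<Sum>b\<in>E. h b * (Y (u s b) \<bullet> u s b))" for s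
  have "\<psi> s \<le> \<psi> 0" for s
  proof -
    have "\<psi> s = \<phi> (l o\<^sub>L u s)" for s
      unfolding \<psi>_def \<phi>_def Y_def by (simp add: k(4) inner_commute)
    moreover have "\<phi> (l o\<^sub>L u 0) = \<phi> l" by (simp add: \<phi>_def u_def)
    ultimately show ?thesis using max[OF K_mult[OF l uK]] by simp
  qed
  moreover have "(\<psi> has_real_derivative (\<Sum>b\<in>E. h b * (2 * (Y b \<bullet> Z b)))) (at 0)"
    unfolding \<psi>_def
  proof (intro DERIV_sum DERIV_cmult)
    fix b
    have "((\<lambda>s. u s b) has_vector_derivative Z b) (at 0)"
      using bounded_linear.has_vector_derivative[OF blinfun.bounded_linear_left[of b]
          exp_blinfun_has_vector_derivative[of Z 0]] by (simp add: u_def)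
    note d = this
    have "((\<lambda>s. Y (u s b)) has_vector_derivative Y (Z b)) (at 0)"
      by (rule bounded_linear.has_vector_derivative[OF blinfun.bounded_linear_right d])
    from bounded_bilinear.has_vector_derivative[OF bounded_bilinear_inner this d]
    have "((\<lambda>s. Y (u s b) \<bullet> u s b) has_vector_derivative (Y (u 0 b) \<bullet> Z b + Y (Z b) \<bullet> u 0 b)) (at 0)" .
    moreover have "Y (u 0 b) \<bullet> Z b + Y (Z b) \<bullet> u 0 b = 2 * (Y b \<bullet> Z b)"
      using symmetricD[OF p_symmetric[OF Y], of "Z b" b] by (simp add: u_def inner_commute)
    ultimately show "((\<lambda>s. Y (u s b) \<bullet> u s b) has_real_derivative 2 * (Y b \<bullet> Z b)) (at 0)"
      by (simp add: has_real_derivative_iff_has_vector_derivative)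
  qed
  ultimately have zero: "(\<Sum>b\<in>E. h b * (2 * (Y b \<bullet> Z b))) = 0"
    using DERIV_local_max[of \<psi> _ 0 1] by simp
  have fin: "finite E" using E(1) by (rule onb_finite)
  have Zc: "Z b \<bullet> c = (h b - h c) * (Y b \<bullet> c)" if "b \<in> E" "c \<in> E" for b c
  proof -
    have "H b = h b *\<^sub>R b" using E(2) that(1) by (simp add: diag_on_def h_def)
    moreover have "H (Y b) \<bullet> c = h c * (Y b \<bullet> c)"
      unfolding h_def by (rule diag_on_inner[OF p_symmetric[OF H] E(2) that(2)])
    ultimately show ?thesis
      by (simp add: Zapp inner_diff_left blinfun.scaleR_right left_diff_distrib)
  qed
  have YZ: "Y b \<bullet> Z b = (\<Sum>c\<in>E. (h b - h c) * (Y b \<bullet> c)\<^sup>2)" if "b \<in> E" for b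
    unfolding onb_inner_eq[OF E(1), of "Y b" "Z b"]
    by (rule sum.cong) (simp_all add: Zc[OF that] power2_eq_square)
  have s1: "(\<Sum>b\<in>E. \<Sum>c\<in>E. h b * (h b - h c) * (Y b \<bullet> c)\<^sup>2) = 0"
  proof -
    have "(\<Sum>b\<in>E. \<Sum>c\<in>E. h b * (h b - h c) * (Y b \<bullet> c)\<^sup>2) = (\<Sum>b\<in>E. h b * (Y b \<bullet> Z b))"
      by (rule sum.cong) (simp_all add: YZ sum_distrib_left mult.assoc)
    also have "\<dots> = 0"
      using zero by (simp add: sum_distrib_left[symmetric] mult.left_commute[of _ 2])
    finally show ?thesis .
  qed
  have s2: "(\<Sum>b\<in>E. \<Sum>c\<in>E. h c * (h c - h b) * (Y b \<bullet> c)\<^sup>2) = 0"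
  proof -
    have "Y b \<bullet> c = Y c \<bullet> b" for b c
      using symmetricD[OF p_symmetric[OF Y], of b c] by (simp add: inner_commute)
    then have "(\<Sum>b\<in>E. \<Sum>c\<in>E. h c * (h c - h b) * (Y b \<bullet> c)\<^sup>2) =
        (\<Sum>b\<in>E. \<Sum>c\<in>E. h c * (h c - h b) * (Y c \<bullet> b)\<^sup>2)" by presburger
    also have "\<dots> = (\<Sum>c\<in>E. \<Sum>b\<in>E. h c * (h c - h b) * (Y c \<bullet> b)\<^sup>2)" by (rule sum.swap)
    finally show ?thesis using s1 by simp
  qed
  have "(\<Sum>b\<in>E. \<Sum>c\<in>E. ((h b - h c) * (Y b \<bullet> c))\<^sup>2) =
      (\<Sum>b\<in>E. \<Sum>c\<in>E. h b * (h b - h c) * (Y b \<bullet> c)\<^sup>2 + h c * (h c - h b) * (Y b \<bullet> c)\<^sup>2)"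
    by (intro sum.cong refl) (simp add: power2_eq_square algebra_simps)
  then have "(\<Sum>b\<in>E. \<Sum>c\<in>E. ((h b - h c) * (Y b \<bullet> c))\<^sup>2) = 0"
    using s1 s2 by (simp add: sum.distrib)
  then have "Z b \<bullet> c = 0" if "b \<in> E" "c \<in> E" for b c
    using that fin by (simp add: sum_nonneg_eq_0_iff sum_nonneg Zc)
  then have "Z b = 0" if "b \<in> E" for b
    using onb_eqI[OF E(1), of "Z b" 0] that by simp
  then have "Z x = 0" for x
    using onb_eqI[OF E(1), of "Z x" 0] by (simp add: skew blinfun.minus_left)
  then have "H o\<^sub>L Y = Y o\<^sub>L H"
    by (intro blinfun_eqI) (simp add: Zapp)
  then show thesis using that[OF k(1) l k(3) k(2)] by (simp add: Y_def)
qed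

text \<open>The elements of \<open>\<pp>\<close> that are diagonal in a frame form a maximal abelian subspace, whose
  \<open>K\<close>-conjugates cover \<open>\<pp>\<close>.\<close>

definition frame :: "'a set \<Rightarrow> bool" where
  "frame E \<longleftrightarrow> onb E \<and> (\<forall>X\<in>\<pp>.
     \<exists>k\<in>K. \<exists>l\<in>K. k o\<^sub>L l = id_blinfun \<and> l o\<^sub>L k = id_blinfun \<and> diag_on E (k o\<^sub>L X o\<^sub>L l))"

theorem exists_frame: obtains E where "frame E"
proof -
  obtain H where H: "H \<in> \<pp>" "\<And>A. A \<in> \<pp> \<Longrightarrow> card (eigenvalues A) \<le> card (eigenvalues H)"
    by (rule exists_max_eigenvalues) blast
  obtain E where E: "onb E" "diag_on E H" using symmetric_diagonalizable[OF p_symmetric[OF H(1)]] .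
  have "frame E"
    unfolding frame_def
  proof (intro conjI ballI)
    show "onb E" by (rule E(1))
    fix X assume X: "X \<in> \<pp>"
    obtain k l where kl: "k \<in> K" "l \<in> K" "k o\<^sub>L l = id_blinfun" "l o\<^sub>L k = id_blinfun"
      "H o\<^sub>L (k o\<^sub>L X o\<^sub>L l) = (k o\<^sub>L X o\<^sub>L l) o\<^sub>L H"
      using conjugate_commuting[OF H(1) X] .
    have Y: "k o\<^sub>L X o\<^sub>L l \<in> \<pp>" by (rule p_conjugate[OF X kl(1,2,4)])
    have "diag_on E (k o\<^sub>L X o\<^sub>L l)"
      unfolding diag_on_def
    proof
      fix e assume e: "e \<in> E"
      then have "H e = (H e \<bullet> e) *\<^sub>R e" using E(2) by (simp add: diag_on_def)
      from commuting_scalar_on_eigenspaces[OF H Y kl(5) this]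
      obtain d where d: "(k o\<^sub>L X o\<^sub>L l) e = d *\<^sub>R e" .
      moreover have "e \<bullet> e = 1" using onb_inner[OF E(1) e e] by simp
      ultimately show "(k o\<^sub>L X o\<^sub>L l) e = ((k o\<^sub>L X o\<^sub>L l) e \<bullet> e) *\<^sub>R e" by simp
    qed
    then show "\<exists>k\<in>K. \<exists>l\<in>K. k o\<^sub>L l = id_blinfun \<and> l o\<^sub>L k = id_blinfun \<and> diag_on E (k o\<^sub>L X o\<^sub>L l)"
      using kl by blast
  qed
  then show thesis by (rule that)
qed

end

section \<open>Minimal vectors\<close>

context reductive
begin

abbreviation "\<M> \<equiv> minimal_vectors G"

lemma orbit_I: "g \<in> G \<Longrightarrow> g v \<in> orbit G v"
  by (simp add: orbit_def)

lemma orbit_self: "v \<in> orbit G v"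
  using orbit_I[OF one_mem, of v] by simp

lemma orbit_apply: "x \<in> orbit G v \<Longrightarrow> g \<in> G \<Longrightarrow> g x \<in> orbit G v"
  by (auto simp: orbit_def image_iff) (metis blinfun_apply_blinfun_compose mult_mem)

lemma orbit_eq:
  assumes "x \<in> orbit G v"
  shows "orbit G x = orbit G v"
proof -
  obtain g where g: "g \<in> G" "x = g v" using assms by (auto simp: orbit_def)
  obtain h where h: "h \<in> G" "\<And>x. h (g x) = x" by (rule inverse_mem[OF g(1)]) blast
  have "v \<in> orbit G x" using orbit_I[OF h(1), of x] h(2) g(2) by simp
  then show ?thesis
    using assms orbit_apply unfolding orbit_def[of G x] orbit_def[of G v] by (auto simp: orbit_def)
qed

lemma closure_orbit_apply:
  assumes "x \<in> closure (orbit G v)" "g \<in> G"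
  shows "g x \<in> closure (orbit G v)"
proof -
  have "g ` closure (orbit G v) \<subseteq> closure (g ` orbit G v)"
    by (intro closure_bounded_linear_image_subset blinfun.bounded_linear_right)
  also have "\<dots> \<subseteq> closure (orbit G v)"
    using assms(2) orbit_apply by (intro closure_mono) blast
  finally show ?thesis using assms(1) by blast
qed

lemma closure_orbitE:
  assumes "x \<in> closure (orbit G v)"
  obtains g where "\<And>n. g n \<in> G" "(\<lambda>n. g n v) \<longlonglongrightarrow> x"
proof -
  obtain f where f: "\<And>n. f n \<in> orbit G v" "f \<longlonglongrightarrow> x"
    using assms closure_sequential by blast
  then have "\<forall>n. \<exists>g\<in>G. f n = g v" by (auto simp: orbit_def)
  then obtain g where g: "\<And>n. g n \<in> G" "\<And>n. f n = g n v" by metis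
  then have "f = (\<lambda>n. g n v)" by blast
  then show thesis using that[of g] g(1) f(2) by simp
qed

lemma minimalD: "w \<in> \<M> \<Longrightarrow> g \<in> G \<Longrightarrow> norm w \<le> norm (g w)"
  by (simp add: minimal_vectors_def)

lemma minimal_K:
  assumes "w \<in> \<M>" "k \<in> K"
  shows "k w \<in> \<M>"
proof -
  have "norm w \<le> norm (g (k w))" if "g \<in> G" for g
    using minimalD[OF assms(1) mult_mem[OF that K_mem[OF assms(2)]]] by simp
  then show ?thesis using assms by (simp add: minimal_vectors_def)
qed

lemma minimal_moment:
  assumes w: "w \<in> \<M>" and A: "A \<in> \<pp>"
  shows "A w \<bullet> w = 0"
proof -
  define f where "f s = exp_blinfun (s *\<^sub>R A) w \<bullet> exp_blinfun (s *\<^sub>R A) w" for s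
  have d: "((\<lambda>s. exp_blinfun (s *\<^sub>R A) w) has_vector_derivative A w) (at 0)"
    using bounded_linear.has_vector_derivative[OF blinfun.bounded_linear_left[of w]
        exp_blinfun_has_vector_derivative[of A 0]] by simp
  have "(f has_real_derivative 2 * (A w \<bullet> w)) (at 0)"
    using bounded_bilinear.has_vector_derivative[OF bounded_bilinear_inner d d]
    unfolding f_def by (simp add: has_real_derivative_iff_has_vector_derivative inner_commute)
  moreover have "f 0 \<le> f s" for s
    using minimalD[OF w p_exp_mem[OF A]] by (simp add: f_def norm_le)
  ultimately show ?thesis using DERIV_local_min[of f "2 * (A w \<bullet> w)" 0 1] by simp
qed

lemma minimal_stable:
  assumes w: "w \<in> \<M>" and A: "A \<in> \<pp>" and le: "norm (exp_blinfun A w) \<le> norm w"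
  shows "A w = 0"
proof -
  note As = p_symmetric[OF A]
  obtain E where E: "onb E" "diag_on E A" using symmetric_diagonalizable[OF As] .
  define a where "a e = A e \<bullet> e" for e
  have "(\<Sum>e\<in>E. (exp (2 * a e) - 1 - 2 * a e) * (w \<bullet> e)\<^sup>2) =
      (norm (exp_blinfun A w))\<^sup>2 - (norm w)\<^sup>2 - 2 * (A w \<bullet> w)"
    unfolding diag_on_exp_norm[OF E(1) As E(2)] onb_norm_eq[OF E(1), of w]
      diag_on_quadratic[OF E(1) As E(2), of w] a_def
    by (simp add: sum_subtractf sum_distrib_left left_diff_distrib mult.assoc)
  also have "\<dots> \<le> 0"
    using le minimal_moment[OF w A] by (simp add: power_mono)
  finally have "(\<Sum>e\<in>E. (exp (2 * a e) - 1 - 2 * a e) * (w \<bullet> e)\<^sup>2) \<le> 0" .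
  moreover have nn: "0 \<le> (exp (2 * a e) - 1 - 2 * a e) * (w \<bullet> e)\<^sup>2" for e
    using exp_ge_add_one_self[of "2 * a e"] by (intro mult_nonneg_nonneg zero_le_power2) linarith
  ultimately have "(\<Sum>e\<in>E. (exp (2 * a e) - 1 - 2 * a e) * (w \<bullet> e)\<^sup>2) = 0"
    by (intro antisym sum_nonneg)
  then have z: "(exp (2 * a e) - 1 - 2 * a e) * (w \<bullet> e)\<^sup>2 = 0" if "e \<in> E" for e
    using that nn onb_finite[OF E(1)] by (simp add: sum_nonneg_eq_0_iff)
  have "A w \<bullet> e = 0" if e: "e \<in> E" for e
  proof (cases "w \<bullet> e = 0")
    case False
    then have "ln (exp (2 * a e)) = exp (2 * a e) - 1" using z[OF e] by simp
    then have "exp (2 * a e) = 1" by (intro ln_eq_minus_one) auto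
    then show ?thesis using diag_on_inner[OF As E(2) e, of w] by (simp add: a_def)
  qed (use diag_on_inner[OF As E(2) e, of w] in simp)
  then show ?thesis using onb_eqI[OF E(1), of "A w" 0] by simp
qed

lemma exp_fixes: "A w = 0 \<Longrightarrow> exp_blinfun A w = w" for A :: "'a \<Rightarrow>\<^sub>L 'a"
  using exp_blinfun_eigenvector[of A w 0] by simp

lemma orbit_inter_minimal:
  assumes w: "w \<in> \<M>"
  shows "orbit G w \<inter> \<M> = orbit K w"
proof
  show "orbit K w \<subseteq> orbit G w \<inter> \<M>"
    using minimal_K[OF w] K_mem by (auto simp: orbit_def)
  show "orbit G w \<inter> \<M> \<subseteq> orbit K w"
  proof
    fix x assume x: "x \<in> orbit G w \<inter> \<M>"
    then obtain g where g: "g \<in> G" "x = g w" by (auto simp: orbit_def)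
    obtain k A where kA: "k \<in> K" "A \<in> \<pp>" "g = k o\<^sub>L exp_blinfun A" using polar[OF g(1)] .
    obtain h where h: "h \<in> G" "\<And>x. h (g x) = x" by (rule inverse_mem[OF g(1)]) blast
    have "norm x \<le> norm w"
      using minimalD[of x, OF _ h(1)] x h(2) g(2) by simp
    then have "norm (exp_blinfun A w) \<le> norm w" using g kA by simp
    then have "exp_blinfun A w = w" using minimal_stable[OF w kA(2)] exp_fixes by blast
    then show "x \<in> orbit K w" using g kA by (auto simp: orbit_def)
  qed
qed

lemma exists_minimal:
  obtains w where "w \<in> closure (orbit G v)" "w \<in> \<M>" "\<And>x. x \<in> closure (orbit G v) \<Longrightarrow> norm w \<le> norm x"
proof -
  obtain w where w: "w \<in> closure (orbit G v)" "\<forall>x\<in>closure (orbit G v). dist 0 w \<le> dist 0 x"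
    using distance_attains_inf[OF closed_closure, of "orbit G v" 0] orbit_self[of v]
    by (metis closure_eq_empty empty_iff)
  then show thesis
    using that[of w] closure_orbit_apply[OF w(1)] by (simp add: minimal_vectors_def)
qed

section \<open>The Hilbert-Mumford criterion\<close>

lemma KAK:
  assumes E: "frame E" and g: "g \<in> G"
  obtains a D b where "a \<in> K" "b \<in> K" "D \<in> \<pp>" "diag_on E D" "g = a o\<^sub>L exp_blinfun D o\<^sub>L b"
proof -
  obtain c A where cA: "c \<in> K" "A \<in> \<pp>" "g = c o\<^sub>L exp_blinfun A" using polar[OF g] .
  obtain k l where kl: "k \<in> K" "l \<in> K" "k o\<^sub>L l = id_blinfun" "l o\<^sub>L k = id_blinfun" "diag_on E (k o\<^sub>L A o\<^sub>L l)"
    using E cA(2) unfolding frame_def by blast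
  define D where "D = k o\<^sub>L A o\<^sub>L l"
  have lk: "l (k x) = x" for x using arg_cong[OF kl(4), of "\<lambda>f. f x"] by simp
  have "D \<in> \<pp>" unfolding D_def by (rule p_conjugate[OF cA(2) kl(1,2,4)])
  moreover have "exp_blinfun D = k o\<^sub>L exp_blinfun A o\<^sub>L l"
    unfolding D_def by (rule exp_blinfun_conjugate[OF kl(4)])
  then have "g = (c o\<^sub>L l) o\<^sub>L exp_blinfun D o\<^sub>L k"
    unfolding cA(3) by (intro blinfun_eqI) (simp add: lk)
  ultimately show thesis
    using that[of "c o\<^sub>L l" k D] kl cA by (simp add: K_mult D_def)
qed

definition weights :: "'a set \<Rightarrow> 'a set" where
  "weights E = {z. \<exists>D\<in>\<pp>. diag_on E D \<and> (\<forall>e\<in>E. D e \<bullet> e = z \<bullet> e)}"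

lemma subspace_weights:
  assumes E: "onb E"
  shows "subspace (weights E)"
  unfolding subspace_def
proof (intro conjI ballI allI)
  show "0 \<in> weights E"
    by (auto simp: weights_def diag_on_def intro!: bexI[of _ 0] p_zero)
next
  fix x y assume "x \<in> weights E" "y \<in> weights E"
  then obtain A B where AB: "A \<in> \<pp>" "diag_on E A" "\<forall>e\<in>E. A e \<bullet> e = x \<bullet> e"
    "B \<in> \<pp>" "diag_on E B" "\<forall>e\<in>E. B e \<bullet> e = y \<bullet> e" by (auto simp: weights_def)
  have "A + B \<in> \<pp>"
    using AB by (intro p_add_commuting diag_on_commute[OF E] p_symmetric)
  then show "x + y \<in> weights E"
    using AB by (auto simp: weights_def blinfun.add_left inner_add_left intro!: bexI[of _ "A + B"] diag_on_add)
next
  fix c x assume "x \<in> weights E"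
  then obtain A where A: "A \<in> \<pp>" "diag_on E A" "\<forall>e\<in>E. A e \<bullet> e = x \<bullet> e" by (auto simp: weights_def)
  then show "c *\<^sub>R x \<in> weights E"
    by (auto simp: weights_def blinfun.scaleR_left intro!: bexI[of _ "c *\<^sub>R A"] diag_on_scaleR p_scaleR)
qed

text \<open>The group element \<open>g\<^sub>n = a\<^sub>n exp(D\<^sub>n) b\<^sub>n\<close> moves \<open>v\<close> towards \<open>w\<close>. On the coordinates where
  both limits \<open>b\<^sub>n v \<rightarrow> v'\<close> and \<open>a\<^sub>n\<^sup>-\<^sup>1 w \<rightarrow> w'\<close> are nonzero, the weights of \<open>D\<^sub>n\<close> converge, so \<open>D\<^sub>n\<close> can be
  corrected by a convergent sequence to vanish there. The correction is negative where only \<open>v'\<close> is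
  nonzero and positive where only \<open>w'\<close> is nonzero, and minimality of \<open>w'\<close> excludes the latter.\<close>

lemma hilbert_mumford_diag:
  assumes frame: "frame E" and w: "w \<in> \<M>" "w \<in> closure (orbit G v)"
  obtains l D where "l \<in> K" "D \<in> \<pp>" "diag_on E D"
    "\<And>e. e \<in> E \<Longrightarrow> l v \<bullet> e \<noteq> 0 \<Longrightarrow> D e \<bullet> e \<le> 0"
    "(\<Sum>e\<in>E. (if D e \<bullet> e = 0 then l v \<bullet> e else 0) *\<^sub>R e) \<in> orbit G w"
proof -
  have E: "onb E" using frame by (simp add: frame_def)
  have fin: "finite E" using E by (rule onb_finite)
  obtain g where g: "\<And>n. g n \<in> G" "(\<lambda>n. g n v) \<longlonglongrightarrow> w" using closure_orbitE[OF w(2)] by blast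
  have "\<forall>n. \<exists>a b D. a \<in> K \<and> b \<in> K \<and> D \<in> \<pp> \<and> diag_on E D \<and> g n = a o\<^sub>L exp_blinfun D o\<^sub>L b"
    using KAK[OF frame g(1)] by metis
  then obtain a0 b0 D0 where abD: "\<And>n. a0 n \<in> K" "\<And>n. b0 n \<in> K" "\<And>n. D0 n \<in> \<pp>"
    "\<And>n. diag_on E (D0 n)" "\<And>n. g n = a0 n o\<^sub>L exp_blinfun (D0 n) o\<^sub>L b0 n"
    by metis
  obtain a r where a: "a \<in> K" "strict_mono r" "(\<lambda>n. a0 (r n)) \<longlonglongrightarrow> a"
    using K_subseq[of a0, OF abD(1)] by blast
  obtain b s where b: "b \<in> K" "strict_mono s" "(\<lambda>n. b0 (r (s n))) \<longlonglongrightarrow> b"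
    using K_subseq[of "\<lambda>n. b0 (r n)", OF abD(2)] by blast
  define D where "D n = D0 (r (s n))" for n
  define x where "x n = b0 (r (s n)) v" for n
  define y where "y n = exp_blinfun (D n) (x n)" for n
  have Dp: "D n \<in> \<pp>" and Dd: "diag_on E (D n)" for n using abD by (auto simp: D_def)
  obtain a' where a': "a' \<in> K" "\<And>x. a (a' x) = x" by (rule K_inverse[OF a(1)]) blast
  define v' w' where "v' = b v" and "w' = a' w"
  have w'M: "w' \<in> \<M>" unfolding w'_def by (rule minimal_K[OF w(1) a'(1)])
  have xlim: "x \<longlonglongrightarrow> v'" unfolding x_def v'_def by (intro tendsto_intros b)
  have ylim: "y \<longlonglongrightarrow> w'"
  proof -
    have 1: "(\<lambda>n. a0 (r (s n))) \<longlonglongrightarrow> a" using LIMSEQ_subseq_LIMSEQ[OF a(3) b(2)] by (simp add: o_def)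
    have "(\<lambda>n. g (r (s n)) v) \<longlonglongrightarrow> w"
      using LIMSEQ_subseq_LIMSEQ[OF g(2) strict_mono_o[OF a(2) b(2)]] by (simp add: o_def)
    moreover have "(\<lambda>n. a0 (r (s n)) w') \<longlonglongrightarrow> a w'" by (intro tendsto_intros 1)
    ultimately have "(\<lambda>n. g (r (s n)) v - a0 (r (s n)) w') \<longlonglongrightarrow> w - a w'" by (rule tendsto_diff)
    then have "(\<lambda>n. norm (g (r (s n)) v - a0 (r (s n)) w')) \<longlonglongrightarrow> 0"
      by (intro tendsto_norm_zero) (simp add: w'_def a'(2))
    moreover have "g (r (s n)) v - a0 (r (s n)) w' = a0 (r (s n)) (y n - w')" for n
      by (simp add: abD(5) y_def x_def D_def blinfun.diff_right)
    ultimately have "(\<lambda>n. norm (y n - w')) \<longlonglongrightarrow> 0" using abD(1) by simp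
    then show ?thesis by (simp add: Lim_null[of _ w'] tendsto_norm_zero_iff)
  qed
  define d where "d n e = D n e \<bullet> e" for n e
  have ye: "y n \<bullet> e = exp (d n e) * (x n \<bullet> e)" if "e \<in> E" for n e
    unfolding y_def d_def by (rule diag_on_exp_inner[OF p_symmetric[OF Dp] Dd that])
  have xe: "(\<lambda>n. x n \<bullet> e) \<longlonglongrightarrow> v' \<bullet> e" and yel: "(\<lambda>n. y n \<bullet> e) \<longlonglongrightarrow> w' \<bullet> e" for e
    by (intro tendsto_intros xlim ylim)+
  have ratio: "(\<lambda>n. exp (d n e)) \<longlonglongrightarrow> (w' \<bullet> e) / (v' \<bullet> e)" if "e \<in> E" "v' \<bullet> e \<noteq> 0" for e
  proof (rule Lim_transform_eventually[OF tendsto_divide[OF yel xe that(2)]])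
    show "\<forall>\<^sub>F n in sequentially. y n \<bullet> e / (x n \<bullet> e) = exp (d n e)"
      using tendsto_imp_eventually_ne[OF xe that(2)] by eventually_elim (simp add: ye that)
  qed
  have inv_ratio: "(\<lambda>n. exp (- d n e)) \<longlonglongrightarrow> (v' \<bullet> e) / (w' \<bullet> e)" if "e \<in> E" "w' \<bullet> e \<noteq> 0" for e
  proof (rule Lim_transform_eventually[OF tendsto_divide[OF xe yel that(2)]])
    show "\<forall>\<^sub>F n in sequentially. x n \<bullet> e / (y n \<bullet> e) = exp (- d n e)"
      using tendsto_imp_eventually_ne[OF yel that(2)]
      by eventually_elim (simp add: ye that exp_minus divide_inverse)
  qed
  define I where "I = {e \<in> E. v' \<bullet> e \<noteq> 0 \<and> w' \<bullet> e \<noteq> 0}"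
  define \<rho> where "\<rho> e = ln ((w' \<bullet> e) / (v' \<bullet> e))" for e
  have rho: "exp (\<rho> e) = (w' \<bullet> e) / (v' \<bullet> e)" "(\<lambda>n. d n e) \<longlonglongrightarrow> \<rho> e" if "e \<in> I" for e
  proof -
    have e: "e \<in> E" "v' \<bullet> e \<noteq> 0" "w' \<bullet> e \<noteq> 0" using that by (auto simp: I_def)
    have "0 \<le> (w' \<bullet> e) / (v' \<bullet> e)"
      by (rule LIMSEQ_le_const[OF ratio[OF e(1,2)]]) (auto intro: less_imp_le)
    then have pos: "0 < (w' \<bullet> e) / (v' \<bullet> e)" using e by (simp add: order_less_le)
    then show "exp (\<rho> e) = (w' \<bullet> e) / (v' \<bullet> e)" unfolding \<rho>_def by (rule exp_ln)
    show "(\<lambda>n. d n e) \<longlonglongrightarrow> \<rho> e"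
      using tendsto_ln[OF ratio[OF e(1,2)] less_imp_neq[OF pos, symmetric]] unfolding ln_exp \<rho>_def .
  qed
  define L where "L z = (\<Sum>e\<in>E. (if e \<in> I then z \<bullet> e else 0) *\<^sub>R e)" for z
  have Le: "L z \<bullet> e = (if e \<in> I then z \<bullet> e else 0)" if "e \<in> E" for z e
    unfolding L_def by (rule onb_sum_inner[OF E that])
  have linL: "linear L"
    by (rule linearI; rule onb_eqI[OF E]) (simp_all add: Le inner_add_left)
  obtain \<gamma> where \<gamma>: "range \<gamma> \<subseteq> weights E" "linear \<gamma>" "\<And>u. u \<in> L ` weights E \<Longrightarrow> L (\<gamma> u) = u"
    using linear_exists_right_inverse_on[OF linL subspace_weights[OF E]] by auto
  define z where "z n = (\<Sum>e\<in>E. d n e *\<^sub>R e)" for n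
  have ze: "z n \<bullet> e = d n e" if "e \<in> E" for n e
    unfolding z_def by (rule onb_sum_inner[OF E that])
  have zW: "z n \<in> weights E" for n
    using Dp Dd by (auto simp: weights_def ze d_def)
  define \<eta> where "\<eta> n = \<gamma> (L (z n))" for n
  define \<eta>' where "\<eta>' = \<gamma> (\<Sum>e\<in>E. (if e \<in> I then \<rho> e else 0) *\<^sub>R e)"
  have \<eta>lim: "\<eta> \<longlonglongrightarrow> \<eta>'"
  proof -
    have "(\<lambda>n. \<Sum>e\<in>E. (if e \<in> I then d n e else 0) *\<^sub>R e) \<longlonglongrightarrow> (\<Sum>e\<in>E. (if e \<in> I then \<rho> e else 0) *\<^sub>R e)"
      by (intro tendsto_sum tendsto_scaleR tendsto_const) (auto intro: rho)
    moreover have "L (z n) = (\<Sum>e\<in>E. (if e \<in> I then d n e else 0) *\<^sub>R e)" for n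
      unfolding L_def by (rule sum.cong) (auto simp: ze)
    ultimately have "(\<lambda>n. L (z n)) \<longlonglongrightarrow> (\<Sum>e\<in>E. (if e \<in> I then \<rho> e else 0) *\<^sub>R e)" by simp
    then show ?thesis
      unfolding \<eta>_def \<eta>'_def using \<gamma>(2)
      by (intro bounded_linear.tendsto[of \<gamma>]) (auto simp: linear_conv_bounded_linear)
  qed
  have \<eta>I: "\<eta> n \<bullet> e = d n e" if "e \<in> I" for n e
  proof -
    have e: "e \<in> E" using that by (simp add: I_def)
    have "L (\<eta> n) = L (z n)" unfolding \<eta>_def using \<gamma>(3) zW by blast
    then show ?thesis using Le[OF e, of "\<eta> n"] Le[OF e, of "z n"] that ze[OF e] by simp
  qed
  have \<eta>e: "(\<lambda>n. \<eta> n \<bullet> e) \<longlonglongrightarrow> \<eta>' \<bullet> e" for e by (intro tendsto_intros \<eta>lim)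
  have \<eta>'I: "\<eta>' \<bullet> e = \<rho> e" if "e \<in> I" for e
    using LIMSEQ_unique[OF \<eta>e[of e]] rho(2)[OF that] \<eta>I[OF that] by simp
  have neg: "\<forall>\<^sub>F n in sequentially. d n e < \<eta> n \<bullet> e" if "e \<in> E" "v' \<bullet> e \<noteq> 0" "w' \<bullet> e = 0" for e
  proof -
    have "(\<lambda>n. exp (d n e) * exp (- (\<eta> n \<bullet> e))) \<longlonglongrightarrow> (w' \<bullet> e) / (v' \<bullet> e) * exp (- (\<eta>' \<bullet> e))"
      by (intro tendsto_intros ratio that \<eta>e)
    then have "(\<lambda>n. exp (d n e - \<eta> n \<bullet> e)) \<longlonglongrightarrow> 0"
      using that(3) by (simp add: exp_diff exp_minus divide_inverse)
    then have "\<forall>\<^sub>F n in sequentially. exp (d n e - \<eta> n \<bullet> e) < 1" by (rule order_tendstoD) simp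
    then show ?thesis by eventually_elim simp
  qed
  have pos: "\<forall>\<^sub>F n in sequentially. d n e > \<eta> n \<bullet> e" if "e \<in> E" "v' \<bullet> e = 0" "w' \<bullet> e \<noteq> 0" for e
  proof -
    have "(\<lambda>n. exp (- d n e) * exp (\<eta> n \<bullet> e)) \<longlonglongrightarrow> (v' \<bullet> e) / (w' \<bullet> e) * exp (\<eta>' \<bullet> e)"
      by (intro tendsto_intros inv_ratio that \<eta>e)
    then have "(\<lambda>n. exp (\<eta> n \<bullet> e - d n e)) \<longlonglongrightarrow> 0"
      using that(2) by (simp add: exp_diff exp_minus divide_inverse mult.commute)
    then have "\<forall>\<^sub>F n in sequentially. exp (\<eta> n \<bullet> e - d n e) < 1" by (rule order_tendstoD) simp
    then show ?thesis by eventually_elim simp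
  qed
  have "\<forall>\<^sub>F n in sequentially. \<forall>e\<in>E. (v' \<bullet> e \<noteq> 0 \<and> w' \<bullet> e = 0 \<longrightarrow> d n e < \<eta> n \<bullet> e) \<and>
      (v' \<bullet> e = 0 \<and> w' \<bullet> e \<noteq> 0 \<longrightarrow> d n e > \<eta> n \<bullet> e)"
  proof (intro eventually_ball_finite[OF fin] ballI)
    fix e assume e: "e \<in> E"
    show "\<forall>\<^sub>F n in sequentially. (v' \<bullet> e \<noteq> 0 \<and> w' \<bullet> e = 0 \<longrightarrow> d n e < \<eta> n \<bullet> e) \<and>
      (v' \<bullet> e = 0 \<and> w' \<bullet> e \<noteq> 0 \<longrightarrow> d n e > \<eta> n \<bullet> e)"
      using neg[OF e] pos[OF e] by (cases "v' \<bullet> e = 0"; cases "w' \<bullet> e = 0") auto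
  qed
  then obtain N where N: "\<And>e. e \<in> E \<Longrightarrow> v' \<bullet> e \<noteq> 0 \<Longrightarrow> w' \<bullet> e = 0 \<Longrightarrow> d N e < \<eta> N \<bullet> e"
    "\<And>e. e \<in> E \<Longrightarrow> v' \<bullet> e = 0 \<Longrightarrow> w' \<bullet> e \<noteq> 0 \<Longrightarrow> d N e > \<eta> N \<bullet> e"
    unfolding eventually_sequentially by blast
  have "z N - \<eta> N \<in> weights E"
    using zW \<gamma>(1) by (intro subspace_diff[OF subspace_weights[OF E]]) (auto simp: \<eta>_def)
  then obtain D' where D': "D' \<in> \<pp>" "diag_on E D'" "\<And>e. e \<in> E \<Longrightarrow> D' e \<bullet> e = d N e - \<eta> N \<bullet> e"
    by (auto simp: weights_def inner_diff_left ze)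
  have "\<eta>' \<in> weights E" using \<gamma>(1) by (auto simp: \<eta>'_def)
  then obtain B where B: "B \<in> \<pp>" "diag_on E B" "\<And>e. e \<in> E \<Longrightarrow> B e \<bullet> e = \<eta>' \<bullet> e"
    by (auto simp: weights_def)
  have D'I: "D' e \<bullet> e = 0" if "e \<in> I" for e
    using D'(3)[of e] \<eta>I[OF that] that by (simp add: I_def)
  have supp: "v' \<bullet> e \<noteq> 0" if e: "e \<in> E" "w' \<bullet> e \<noteq> 0" for e
  proof
    assume 0: "v' \<bullet> e = 0"
    have m: "- 1 *\<^sub>R D' \<in> \<pp>" "diag_on E (- 1 *\<^sub>R D')" 
      by (rule p_scaleR[OF D'(1)], rule diag_on_scaleR[OF D'(2)])
    have le: "- (D' f \<bullet> f) \<le> 0" if "f \<in> E" "w' \<bullet> f \<noteq> 0" for f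
    proof (cases "v' \<bullet> f = 0")
      case True
      then show ?thesis using N(2)[OF that(1) True that(2)] D'(3)[OF that(1)] by simp
    next
      case False
      then show ?thesis using D'I[of f] that by (simp add: I_def)
    qed
    have "(norm (exp_blinfun (- 1 *\<^sub>R D') w'))\<^sup>2 < (norm w')\<^sup>2"
      unfolding diag_on_exp_norm[OF E p_symmetric[OF m(1)] m(2)] onb_norm_eq[OF E, of w']
    proof (rule sum_strict_mono_ex1[OF fin])
      show "\<forall>f\<in>E. exp (2 * ((- 1 *\<^sub>R D') f \<bullet> f)) * (w' \<bullet> f)\<^sup>2 \<le> (w' \<bullet> f)\<^sup>2"
      proof
        fix f assume f: "f \<in> E"
        show "exp (2 * ((- 1 *\<^sub>R D') f \<bullet> f)) * (w' \<bullet> f)\<^sup>2 \<le> (w' \<bullet> f)\<^sup>2"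
        proof (cases "w' \<bullet> f = 0")
          case False
          then have "exp (2 * ((- 1 *\<^sub>R D') f \<bullet> f)) \<le> 1"
            using le[OF f False] by (simp add: blinfun.scaleR_left blinfun.minus_left)
          then show ?thesis by (intro mult_left_le_one_le) auto
        qed simp
      qed
      have "D' e \<bullet> e > 0" using N(2)[OF e(1) 0 e(2)] D'(3)[OF e(1)] by simp
      then show "\<exists>f\<in>E. exp (2 * ((- 1 *\<^sub>R D') f \<bullet> f)) * (w' \<bullet> f)\<^sup>2 < (w' \<bullet> f)\<^sup>2"
        using e by (intro bexI[of _ e]) (simp_all add: blinfun.scaleR_left blinfun.minus_left)
    qed
    moreover have "norm w' \<le> norm (exp_blinfun (- 1 *\<^sub>R D') w')"
      by (rule minimalD[OF w'M p_exp_mem[OF D'(1)]])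
    ultimately show False by (simp add: power_mono leD)
  qed
  define P where "P = (\<Sum>e\<in>E. (if D' e \<bullet> e = 0 then b v \<bullet> e else 0) *\<^sub>R e)"
  have Pe: "P \<bullet> e = (if D' e \<bullet> e = 0 then v' \<bullet> e else 0)" if "e \<in> E" for e
    unfolding P_def v'_def by (rule onb_sum_inner[OF E that])
  have "exp_blinfun B P = w'"
  proof (rule onb_eqI[OF E])
    fix e assume e: "e \<in> E"
    have *: "exp_blinfun B P \<bullet> e = exp (\<eta>' \<bullet> e) * (P \<bullet> e)"
      using diag_on_exp_inner[OF p_symmetric[OF B(1)] B(2) e] B(3)[OF e] by simp
    show "exp_blinfun B P \<bullet> e = w' \<bullet> e"
    proof (cases "e \<in> I")
      case True
      then have "v' \<bullet> e \<noteq> 0" by (simp add: I_def)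
      then show ?thesis
        using * Pe[OF e] D'I[OF True] \<eta>'I[OF True] rho(1)[OF True] by simp
    next
      case False
      then have w0: "w' \<bullet> e = 0" using supp[OF e] e by (auto simp: I_def)
      then have "P \<bullet> e = 0" using Pe[OF e] N(1)[OF e _ w0] D'(3)[OF e] by (cases "v' \<bullet> e = 0") auto
      then show ?thesis using * w0 by simp
    qed
  qed
  then have "P = (exp_blinfun (- 1 *\<^sub>R B)) (a' w)" by (auto simp flip: w'_def)
  then have "P \<in> orbit G w"
    using orbit_apply[OF orbit_I[OF K_mem[OF a'(1)]] p_exp_mem[OF B(1), of "- 1"]] by simp
  moreover have "D' e \<bullet> e \<le> 0" if "e \<in> E" "b v \<bullet> e \<noteq> 0" for e
  proof (cases "e \<in> I")
    case False
    then have "w' \<bullet> e = 0" using that by (auto simp: I_def v'_def)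
    then show ?thesis using N(1)[OF that(1)] that(2) D'(3)[OF that(1)] by (simp add: v'_def)
  qed (simp add: D'I)
  ultimately show thesis using that[OF b(1) D'(1,2)] by (simp add: P_def)
qed

end

lemma norm_exp_blinfun_le: "norm (exp_blinfun A) \<le> exp (norm A)"
  unfolding exp_blinfun_eq norm_endo.rep_eq[symmetric]
  by (rule order_trans[OF norm_exp]) (simp add: norm_endo.abs_eq)

lemma norm_blinfun_compose3_le:
  fixes f g h :: "'a::euclidean_space \<Rightarrow>\<^sub>L 'a"
  shows "norm (f o\<^sub>L g o\<^sub>L h) \<le> norm f * norm g * norm h"
  by (rule order_trans[OF norm_blinfun_compose mult_right_mono[OF norm_blinfun_compose norm_ge_zero]])

lemma linear_times_exp_tendsto_zero:
  assumes "\<epsilon> > 0"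
  shows "((\<lambda>t::real. (a + b * t) * exp (- (\<epsilon> * t))) \<longlongrightarrow> 0) at_top"
proof -
  have at_top: "filterlim (\<lambda>t. \<epsilon> * t) at_top at_top"
    using assms by (intro filterlim_tendsto_pos_mult_at_top[OF tendsto_const]) (auto simp: filterlim_ident)
  have "((\<lambda>t. a * ((\<epsilon> * t) ^ 0 / exp (\<epsilon> * t)) + b / \<epsilon> * ((\<epsilon> * t) ^ 1 / exp (\<epsilon> * t))) \<longlongrightarrow> a * 0 + b / \<epsilon> * 0) at_top"
    by (intro tendsto_intros filterlim_compose[OF tendsto_power_div_exp_0 at_top])
  moreover have "a * ((\<epsilon> * t) ^ 0 / exp (\<epsilon> * t)) + b / \<epsilon> * ((\<epsilon> * t) ^ 1 / exp (\<epsilon> * t)) =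
      (a + b * t) * exp (- (\<epsilon> * t))" for t
    using assms by (simp add: exp_minus field_simps)
  ultimately show ?thesis by simp
qed

lemma exp_symmetric_norm_ge_near:
  assumes "A \<in> symmetric_maps" "A w \<bullet> w = 0"
  shows "(norm (exp_blinfun A y))\<^sup>2 \<ge> (norm y)\<^sup>2 - 2 * norm A * (norm (y - w) * (norm (y - w) + 2 * norm w))"
proof -
  have "A y \<bullet> y = A (y - w) \<bullet> (y - w) + 2 * (A (y - w) \<bullet> w)"
    using assms(2) symmetricD[OF assms(1), of y w]
    by (simp add: blinfun.diff_right inner_diff_left inner_diff_right inner_commute)
  also have "\<dots> = A (y - w) \<bullet> ((y - w) + 2 *\<^sub>R w)"
    by (simp add: inner_add_right)
  finally have "\<bar>A y \<bullet> y\<bar> \<le> norm (A (y - w)) * norm ((y - w) + 2 *\<^sub>R w)"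
    by (simp only: Cauchy_Schwarz_ineq2)
  also have "\<dots> \<le> (norm A * norm (y - w)) * (norm (y - w) + 2 * norm w)"
    using norm_triangle_ineq[of "y - w" "2 *\<^sub>R w"]
    by (intro mult_mono norm_blinfun) (auto intro: mult_nonneg_nonneg)
  finally show ?thesis
    using exp_symmetric_norm_ge[OF assms(1), of y] by (simp add: mult.assoc)
qed

context reductive
begin

text \<open>The exponential rate of convergence is what makes minimal vectors in the closure of an orbit
  comparable with the whole orbit, because the polar part of a group element along the
  one-parameter group grows only linearly.\<close>

theorem hilbert_mumford:
  assumes w: "w \<in> \<M>" "w \<in> closure (orbit G v)"
  obtains \<alpha> u C \<epsilon> where "\<alpha> \<in> \<pp>" "u \<in> orbit G w" "\<epsilon> > 0" "C \<ge> 0"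
    "\<And>t. t \<ge> 0 \<Longrightarrow> norm (exp_blinfun (t *\<^sub>R \<alpha>) v - u) \<le> C * exp (- (\<epsilon> * t))"
proof -
  obtain E where frame: "frame E" by (rule exists_frame)
  have E: "onb E" using frame by (simp add: frame_def)
  obtain l D where l: "l \<in> K" and D: "D \<in> \<pp>" "diag_on E D"
    and le: "\<And>e. e \<in> E \<Longrightarrow> l v \<bullet> e \<noteq> 0 \<Longrightarrow> D e \<bullet> e \<le> 0"
    and P: "(\<Sum>e\<in>E. (if D e \<bullet> e = 0 then l v \<bullet> e else 0) *\<^sub>R e) \<in> orbit G w"
    by (rule hilbert_mumford_diag[OF frame w]) (rule that)
  define P where "P = (\<Sum>e\<in>E. (if D e \<bullet> e = 0 then l v \<bullet> e else 0) *\<^sub>R e)"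
  obtain k where k: "k \<in> K" "l o\<^sub>L k = id_blinfun" "\<And>x. k (l x) = x" by (rule K_inverse[OF l]) blast
  define \<alpha> where "\<alpha> = k o\<^sub>L D o\<^sub>L l"
  have fin: "finite E" using E by (rule onb_finite)
  define \<epsilon> where "\<epsilon> = Min (insert 1 ((\<lambda>e. - (D e \<bullet> e)) ` {e \<in> E. D e \<bullet> e < 0}))"
  have fin': "finite (insert 1 ((\<lambda>e. - (D e \<bullet> e)) ` {e \<in> E. D e \<bullet> e < 0}))" using fin by simp
  have \<epsilon>: "\<epsilon> > 0" using fin' unfolding \<epsilon>_def by (subst Min_gr_iff) auto
  have \<epsilon>D: "D e \<bullet> e \<le> - \<epsilon>" if "e \<in> E" "D e \<bullet> e < 0" for e
  proof -
    have "\<epsilon> \<le> - (D e \<bullet> e)" unfolding \<epsilon>_def using that by (intro Min_le[OF fin']) auto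
    then show ?thesis by simp
  qed
  have "norm (exp_blinfun (t *\<^sub>R \<alpha>) v - k P) \<le> norm v * exp (- (\<epsilon> * t))" if t: "t \<ge> 0" for t
  proof -
    have "t *\<^sub>R \<alpha> = k o\<^sub>L (t *\<^sub>R D) o\<^sub>L l"
      unfolding \<alpha>_def by (rule blinfun_eqI) (simp add: blinfun.scaleR_left blinfun.scaleR_right)
    then have "exp_blinfun (t *\<^sub>R \<alpha>) v - k P = k (exp_blinfun (t *\<^sub>R D) (l v) - P)"
      by (simp add: exp_blinfun_conjugate[OF k(2)] blinfun.diff_right)
    then have n: "norm (exp_blinfun (t *\<^sub>R \<alpha>) v - k P) = norm (exp_blinfun (t *\<^sub>R D) (l v) - P)"
      using k(1) by simp
    have "(norm (exp_blinfun (t *\<^sub>R D) (l v) - P))\<^sup>2 \<le> (\<Sum>e\<in>E. (exp (- (\<epsilon> * t)))\<^sup>2 * (l v \<bullet> e)\<^sup>2)"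
      unfolding onb_norm_eq[OF E]
    proof (rule sum_mono)
      fix e assume e: "e \<in> E"
      have Pe: "P \<bullet> e = (if D e \<bullet> e = 0 then l v \<bullet> e else 0)"
        unfolding P_def by (rule onb_sum_inner[OF E e])
      have De: "exp_blinfun (t *\<^sub>R D) (l v) \<bullet> e = exp (t * (D e \<bullet> e)) * (l v \<bullet> e)"
        using diag_on_exp_inner[OF symmetric_maps_scaleR[OF p_symmetric[OF D(1)]] diag_on_scaleR[OF D(2)] e]
        by (simp add: blinfun.scaleR_left)
      show "((exp_blinfun (t *\<^sub>R D) (l v) - P) \<bullet> e)\<^sup>2 \<le> (exp (- (\<epsilon> * t)))\<^sup>2 * (l v \<bullet> e)\<^sup>2"
      proof (cases "D e \<bullet> e = 0 \<or> l v \<bullet> e = 0")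
        case True
        then show ?thesis by (auto simp: inner_diff_left Pe De)
      next
        case False
        then have "D e \<bullet> e \<le> - \<epsilon>" using le[OF e] \<epsilon>D[OF e] by force
        then have "t * (D e \<bullet> e) \<le> - (\<epsilon> * t)" using t mult_left_mono[of "D e \<bullet> e" "- \<epsilon>" t] by (simp add: mult.commute)
        then have "exp (t * (D e \<bullet> e)) \<le> exp (- (\<epsilon> * t))" by simp
        then have "(exp (t * (D e \<bullet> e)))\<^sup>2 \<le> (exp (- (\<epsilon> * t)))\<^sup>2" by (intro power_mono) auto
        then show ?thesis using False
          by (simp add: inner_diff_left Pe De power_mult_distrib mult_right_mono)
      qed
    qed
    also have "\<dots> = (norm v * exp (- (\<epsilon> * t)))\<^sup>2"
      using l by (simp add: sum_distrib_left[symmetric] onb_norm_eq[OF E, symmetric] power_mult_distrib)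
    finally show ?thesis unfolding n by (rule power2_le_imp_le) simp
  qed
  moreover have "\<alpha> \<in> \<pp>" unfolding \<alpha>_def by (rule p_conjugate[OF D(1) k(1) l k(2)])
  moreover have "k P \<in> orbit G w"
    using orbit_apply[OF P K_mem[OF k(1)]] by (simp add: P_def)
  ultimately show thesis using that[of \<alpha> "k P" \<epsilon> "norm v"] \<epsilon> by simp
qed

lemma polar_norm_bound:
  assumes "k \<in> K" "A \<in> \<pp>" "g = k o\<^sub>L exp_blinfun A" "g o\<^sub>L h = id_blinfun" "h o\<^sub>L g = id_blinfun"
  shows "exp (norm A) \<le> max (norm g) (norm h)"
proof -
  obtain l where l: "l \<in> K" "k o\<^sub>L l = id_blinfun" "\<And>x. k (l x) = x" "\<And>x. l (k x) = x"
    by (rule K_inverse[OF assms(1)]) blast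
  have hg: "h (g x) = x" for x using arg_cong[OF assms(5), of "\<lambda>f. f x"] by simp
  have "exp_blinfun A = l o\<^sub>L g" by (rule blinfun_eqI) (simp add: assms(3) l)
  then have "norm (exp_blinfun A) \<le> norm l * norm g" by (simp add: norm_blinfun_compose)
  also have "\<dots> \<le> norm g" using K_bounded[OF l(1)] by (intro mult_left_le_one_le) auto
  finally have 1: "norm (exp_blinfun A) \<le> norm g" .
  have "exp_blinfun (- A) x = h (k x)" for x
  proof -
    have "h (k x) = h (g (exp_blinfun (- A) x))" by (simp add: assms(3))
    then show ?thesis by (simp add: hg)
  qed
  then have "exp_blinfun (- A) = h o\<^sub>L k" by (intro blinfun_eqI) simp
  then have "norm (exp_blinfun (- A)) \<le> norm h * norm k" by (simp add: norm_blinfun_compose)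
  also have "\<dots> \<le> norm h" using K_bounded[OF assms(1)] by (intro mult_right_le_one_le) auto
  finally show ?thesis
    using 1 exp_norm_le_symmetric[OF p_symmetric[OF assms(2)]] by linarith
qed

lemma minimal_in_closure_norm_le:
  assumes w: "w \<in> \<M>" "w \<in> closure (orbit G v)" and g: "g \<in> G"
  shows "norm w \<le> norm (g v)"
proof -
  obtain \<alpha> u C \<epsilon> where \<alpha>: "\<alpha> \<in> \<pp>" and u: "u \<in> orbit G w" and \<epsilon>: "\<epsilon> > 0" and C: "C \<ge> 0"
    and rate: "\<And>t. t \<ge> 0 \<Longrightarrow> norm (exp_blinfun (t *\<^sub>R \<alpha>) v - u) \<le> C * exp (- (\<epsilon> * t))"
    by (rule hilbert_mumford[OF w]) blast
  obtain h where h: "h \<in> G" "u = h w" using u by (auto simp: orbit_def)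
  obtain h' where h': "h' \<in> G" "h o\<^sub>L h' = id_blinfun" "h' o\<^sub>L h = id_blinfun" "\<And>x. h (h' x) = x" "\<And>x. h' (h x) = x"
    by (rule inverse_mem[OF h(1)]) blast
  obtain g' where g': "g' \<in> G" "g o\<^sub>L g' = id_blinfun" "g' o\<^sub>L g = id_blinfun" "\<And>x. g (g' x) = x" "\<And>x. g' (g x) = x"
    by (rule inverse_mem[OF g]) blast
  define y where "y t = h' (exp_blinfun (t *\<^sub>R \<alpha>) v)" for t
  define c where "c = max (norm g * norm h) (norm h' * norm g')"
  define s where "s t = norm h' * (C * exp (- (\<epsilon> * t)))" for t
  define b where "b = norm h' * C * (norm h' * C + 2 * norm w)"
  have yw: "norm (y t - w) \<le> s t" if "t \<ge> 0" for t
  proof -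
    have "y t - w = h' (exp_blinfun (t *\<^sub>R \<alpha>) v - u)" by (simp add: y_def h(2) h'(5) blinfun.diff_right)
    then have "norm (y t - w) \<le> norm h' * norm (exp_blinfun (t *\<^sub>R \<alpha>) v - u)" by (simp add: norm_blinfun)
    also have "\<dots> \<le> s t" unfolding s_def by (intro mult_left_mono rate that) simp
    finally show ?thesis .
  qed
  have key: "(norm (y t))\<^sup>2 - 2 * (((c + norm \<alpha> * t) * exp (- (\<epsilon> * t))) * b) \<le> (norm (g v))\<^sup>2" if t: "t \<ge> 0" for t
  proof -
    define q where "q = g o\<^sub>L exp_blinfun (- (t *\<^sub>R \<alpha>)) o\<^sub>L h"
    define q' where "q' = h' o\<^sub>L exp_blinfun (t *\<^sub>R \<alpha>) o\<^sub>L g'"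
    have q: "q \<in> G" unfolding q_def using p_exp_mem[OF \<alpha>, of "- t"] g h by (simp add: mult_mem)
    have qq: "q o\<^sub>L q' = id_blinfun" "q' o\<^sub>L q = id_blinfun"
      by (rule blinfun_eqI; simp add: q_def q'_def h'(4,5) g'(4,5))+
    obtain k A where kA: "k \<in> K" "A \<in> \<pp>" "q = k o\<^sub>L exp_blinfun A" using polar[OF q] .
    have "q (y t) = g v" by (simp add: q_def y_def h'(4))
    then have gv: "norm (g v) = norm (exp_blinfun A (y t))" using kA by (metis K_norm blinfun_apply_blinfun_compose)
    have e: "norm (exp_blinfun (t *\<^sub>R \<alpha>)) \<le> exp (norm \<alpha> * t)" "norm (exp_blinfun (- (t *\<^sub>R \<alpha>))) \<le> exp (norm \<alpha> * t)"
      using norm_exp_blinfun_le[of "t *\<^sub>R \<alpha>"] norm_exp_blinfun_le[of "- (t *\<^sub>R \<alpha>)"] t by (simp_all add: mult.commute)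
    have "norm q \<le> norm g * norm (exp_blinfun (- (t *\<^sub>R \<alpha>))) * norm h" unfolding q_def by (rule norm_blinfun_compose3_le)
    also have "\<dots> \<le> norm g * exp (norm \<alpha> * t) * norm h" by (intro mult_right_mono mult_left_mono e) auto
    also have "\<dots> \<le> c * exp (norm \<alpha> * t)" unfolding c_def by (simp add: mult.assoc mult.left_commute)
    finally have 1: "norm q \<le> c * exp (norm \<alpha> * t)" .
    have "norm q' \<le> norm h' * norm (exp_blinfun (t *\<^sub>R \<alpha>)) * norm g'" unfolding q'_def by (rule norm_blinfun_compose3_le)
    also have "\<dots> \<le> norm h' * exp (norm \<alpha> * t) * norm g'" by (intro mult_right_mono mult_left_mono e) auto
    also have "\<dots> \<le> c * exp (norm \<alpha> * t)" unfolding c_def by (simp add: mult.assoc mult.left_commute)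
    finally have 2: "norm q' \<le> c * exp (norm \<alpha> * t)" .
    have "exp (norm A) \<le> c * exp (norm \<alpha> * t)"
      using polar_norm_bound[OF kA qq] 1 2 by linarith
    also have "\<dots> \<le> exp c * exp (norm \<alpha> * t)"
      using exp_ge_add_one_self[of c] by (intro mult_right_mono exp_ge_zero) linarith
    finally have nA: "norm A \<le> c + norm \<alpha> * t" by (simp flip: exp_add)
    have s0: "0 \<le> s t" unfolding s_def using C by simp
    have s1: "s t \<le> norm h' * C"
      unfolding s_def using C \<epsilon> t by (intro mult_left_mono mult_left_le) auto
    have "norm (y t - w) * (norm (y t - w) + 2 * norm w) \<le> s t * (norm h' * C + 2 * norm w)"
      using yw[OF t] s1 s0 by (intro mult_mono add_right_mono) auto
    also have "\<dots> = exp (- (\<epsilon> * t)) * b" by (simp add: s_def b_def mult_ac)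
    finally have "norm A * (norm (y t - w) * (norm (y t - w) + 2 * norm w)) \<le> (c + norm \<alpha> * t) * (exp (- (\<epsilon> * t)) * b)"
      by (rule mult_mono'[OF nA _ norm_ge_zero]) (intro mult_nonneg_nonneg add_nonneg_nonneg norm_ge_zero; simp)
    then show ?thesis
      unfolding gv using exp_symmetric_norm_ge_near[OF p_symmetric[OF kA(2)] minimal_moment[OF w(1) kA(2)], of "y t"]
      by (simp add: mult.assoc)
  qed
  have ylim: "(y \<longlongrightarrow> w) at_top"
  proof -
    have "((\<lambda>t. (norm h' * C + 0 * t) * exp (- (\<epsilon> * t))) \<longlongrightarrow> 0) at_top" by (rule linear_times_exp_tendsto_zero[OF \<epsilon>])
    then have s: "(s \<longlongrightarrow> 0) at_top" unfolding s_def by (simp add: mult.assoc)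
    have "((\<lambda>t. y t - w) \<longlongrightarrow> 0) at_top"
      by (rule Lim_null_comparison[OF _ s]) (use yw in \<open>auto intro: eventually_mono[OF eventually_ge_at_top[of 0]]\<close>)
    then show ?thesis by (simp add: Lim_null[of _ w])
  qed
  have "((\<lambda>t. (norm (y t))\<^sup>2 - 2 * (((c + norm \<alpha> * t) * exp (- (\<epsilon> * t))) * b)) \<longlongrightarrow> (norm w)\<^sup>2 - 2 * (0 * b)) at_top"
    by (intro tendsto_intros ylim linear_times_exp_tendsto_zero[OF \<epsilon>])
  then have "(norm w)\<^sup>2 - 2 * (0 * b) \<le> (norm (g v))\<^sup>2"
    by (rule tendsto_upperbound) (use key in \<open>auto intro: eventually_mono[OF eventually_ge_at_top[of 0]]\<close>)
  then have "(norm w)\<^sup>2 \<le> (norm (g v))\<^sup>2" by simp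
  then show ?thesis by (rule power2_le_imp_le) simp
qed

text \<open>For symmetric \<open>A\<close> one has \<open>|exp(A) y - y|\<^sup>2 = |exp(A) y|\<^sup>2 + |y|\<^sup>2 - 2 |exp(A/2) y|\<^sup>2\<close>, so two
  almost shortest vectors of an orbit differ by an element of \<open>K\<close> up to a small error.\<close>

lemma shortest_vectors_conjugate:
  assumes w1: "w1 \<in> closure (orbit G v)" and w2: "w2 \<in> closure (orbit G v)"
    and le: "\<And>g. g \<in> G \<Longrightarrow> m \<le> norm (g v)" and n: "norm w1 = m" "norm w2 = m"
  shows "w2 \<in> orbit K w1"
proof -
  obtain g where g: "\<And>n. g n \<in> G" "(\<lambda>n. g n v) \<longlonglongrightarrow> w1" using closure_orbitE[OF w1] by blast
  obtain h where h: "\<And>n. h n \<in> G" "(\<lambda>n. h n v) \<longlonglongrightarrow> w2" using closure_orbitE[OF w2] by blast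
  have "\<exists>k A. k \<in> K \<and> A \<in> \<pp> \<and> h n v = k (exp_blinfun A (g n v))" for n
  proof -
    obtain g' where g': "g' \<in> G" "\<And>x. g' (g n x) = x" by (rule inverse_mem[OF g(1)[of n]]) blast
    obtain k A where kA: "k \<in> K" "A \<in> \<pp>" "h n o\<^sub>L g' = k o\<^sub>L exp_blinfun A"
      using polar[OF mult_mem[OF h(1)[of n] g'(1)]] .
    have "h n v = k (exp_blinfun A (g n v))"
      using g'(2) arg_cong[OF kA(3), of "\<lambda>f. f (g n v)"] by simp
    then show ?thesis using kA(1,2) by blast
  qed
  then obtain k A where kA: "\<And>n. k n \<in> K" "\<And>n. A n \<in> \<pp>" "\<And>n. h n v = k n (exp_blinfun (A n) (g n v))" by metis
  obtain l r where l: "l \<in> K" "strict_mono r" "(\<lambda>n. k (r n)) \<longlonglongrightarrow> l" using K_subseq[of k, OF kA(1)] by blast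
  define y where "y n = g (r n) v" for n
  define z where "z n = exp_blinfun (A (r n)) (y n)" for n
  have ylim: "y \<longlonglongrightarrow> w1"
    using LIMSEQ_subseq_LIMSEQ[OF g(2) l(2)] unfolding o_def y_def[symmetric] .
  have kz: "k (r n) (z n) = h (r n) v" for n by (simp add: kA(3) z_def y_def)
  have hlim: "(\<lambda>n. k (r n) (z n)) \<longlonglongrightarrow> w2" unfolding kz using LIMSEQ_subseq_LIMSEQ[OF h(2) l(2)] by (simp add: o_def)
  have "norm (k (r n) (z n)) = norm (z n)" for n using kA(1) by simp
  then have nz: "(\<lambda>n. norm (z n)) \<longlonglongrightarrow> m" using tendsto_norm[OF hlim] n by simp
  have ny: "(\<lambda>n. norm (y n)) \<longlonglongrightarrow> m" using tendsto_norm[OF ylim] n by simp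
  have m0: "0 \<le> m" using n by auto
  have le': "(norm (z n - y n))\<^sup>2 \<le> (norm (z n))\<^sup>2 + (norm (y n))\<^sup>2 - 2 * m\<^sup>2" for n
  proof -
    have "exp_blinfun ((1/2) *\<^sub>R A (r n)) o\<^sub>L g (r n) \<in> G" by (intro mult_mem g p_exp_mem kA)
    from le[OF this] have "m \<le> norm (exp_blinfun ((1/2) *\<^sub>R A (r n)) (y n))" by (simp add: y_def)
    then have "m\<^sup>2 \<le> (norm (exp_blinfun ((1/2) *\<^sub>R A (r n)) (y n)))\<^sup>2" using m0 by (rule power_mono)
    then show ?thesis
      unfolding z_def exp_symmetric_displacement[OF p_symmetric[OF kA(2)], of "r n" "y n"] by simp
  qed
  have "(\<lambda>n. (norm (z n))\<^sup>2 + (norm (y n))\<^sup>2 - 2 * m\<^sup>2) \<longlonglongrightarrow> m\<^sup>2 + m\<^sup>2 - 2 * m\<^sup>2"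
    by (intro tendsto_intros nz ny)
  then have lim0: "(\<lambda>n. (norm (z n))\<^sup>2 + (norm (y n))\<^sup>2 - 2 * m\<^sup>2) \<longlonglongrightarrow> 0" by simp
  have "(\<lambda>n. (norm (z n - y n))\<^sup>2) \<longlonglongrightarrow> 0"
    by (rule Lim_null_comparison[OF _ lim0]) (use le' in simp)
  then have "(\<lambda>n. sqrt ((norm (z n - y n))\<^sup>2)) \<longlonglongrightarrow> sqrt 0" by (rule tendsto_real_sqrt)
  then have "(\<lambda>n. z n - y n) \<longlonglongrightarrow> 0" by (simp add: tendsto_norm_zero_iff)
  from tendsto_add[OF this ylim] have zlim: "z \<longlonglongrightarrow> w1" by simp
  have "(\<lambda>n. k (r n) (z n)) \<longlonglongrightarrow> l w1" by (intro tendsto_intros l zlim)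
  then have "w2 = l w1" using LIMSEQ_unique[OF hlim] by simp
  then show ?thesis using l(1) by (auto simp: orbit_def)
qed

lemma minimal_closure_unique:
  assumes "w1 \<in> \<M>" "w1 \<in> closure (orbit G v)" "w2 \<in> \<M>" "w2 \<in> closure (orbit G v)"
  shows "orbit G w1 = orbit G w2"
proof -
  have le: "norm w \<le> norm x" if w: "w \<in> \<M>" "w \<in> closure (orbit G v)" and x: "x \<in> closure (orbit G v)" for w x
  proof -
    obtain g where g: "\<And>n. g n \<in> G" "(\<lambda>n. g n v) \<longlonglongrightarrow> x" using closure_orbitE[OF x] by blast
    show ?thesis
      by (rule LIMSEQ_le_const[OF tendsto_norm[OF g(2)]]) (use minimal_in_closure_norm_le[OF w g(1)] in blast)
  qed
  have "w2 \<in> orbit K w1"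
    using shortest_vectors_conjugate[OF assms(2,4), of "norm w1"] minimal_in_closure_norm_le[OF assms(1,2)]
      le[OF assms(1,2,4)] le[OF assms(3,4,2)] by simp
  then have "w2 \<in> orbit G w1" using K_mem by (auto simp: orbit_def)
  then show ?thesis by (simp add: orbit_eq)
qed

theorem null_cone_closed: "closed (null_cone G)"
proof -
  obtain E where frame: "frame E" by (rule exists_frame)
  have E: "onb E" using frame by (simp add: frame_def)
  define S where "S D = {e \<in> E. D e \<bullet> e < 0}" for D :: "'a \<Rightarrow>\<^sub>L 'a"
  define \<I> where "\<I> = S ` {D \<in> \<pp>. diag_on E D}"
  define C where "C I = {v. \<exists>l\<in>K. \<forall>e\<in>E - I. l v \<bullet> e = 0}" for I
  have "null_cone G = (\<Union>I\<in>\<I>. C I)"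
  proof
    show "null_cone G \<subseteq> (\<Union>I\<in>\<I>. C I)"
    proof
      fix v assume "v \<in> null_cone G"
      then have cl: "0 \<in> closure (orbit G v)" by (simp add: null_cone_def)
      have 0: "0 \<in> \<M>" by (simp add: minimal_vectors_def)
      obtain l D where l: "l \<in> K" and D: "D \<in> \<pp>" "diag_on E D"
        and le: "\<And>e. e \<in> E \<Longrightarrow> l v \<bullet> e \<noteq> 0 \<Longrightarrow> D e \<bullet> e \<le> 0"
        and P: "(\<Sum>e\<in>E. (if D e \<bullet> e = 0 then l v \<bullet> e else 0) *\<^sub>R e) \<in> orbit G 0"
        by (rule hilbert_mumford_diag[OF frame 0 cl]) (rule that)
      have "l v \<bullet> e = 0" if e: "e \<in> E - S D" for e
      proof (rule ccontr)
        assume n: "l v \<bullet> e \<noteq> 0"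
        then have "D e \<bullet> e = 0" using le[of e] e by (force simp: S_def)
        moreover have "(\<Sum>e\<in>E. (if D e \<bullet> e = 0 then l v \<bullet> e else 0) *\<^sub>R e) = 0" using P by (auto simp: orbit_def)
        ultimately show False
          using onb_sum_inner[OF E, of e "\<lambda>e. if D e \<bullet> e = 0 then l v \<bullet> e else 0"] n e by simp
      qed
      then show "v \<in> (\<Union>I\<in>\<I>. C I)" using l D unfolding \<I>_def C_def by blast
    qed
    show "(\<Union>I\<in>\<I>. C I) \<subseteq> null_cone G"
    proof (intro subsetI, elim UN_E)
      fix v I assume "I \<in> \<I>" "v \<in> C I"
      then obtain D l where D: "D \<in> \<pp>" "diag_on E D" and l: "l \<in> K" "\<And>e. e \<in> E - S D \<Longrightarrow> l v \<bullet> e = 0"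
        unfolding \<I>_def C_def by blast
      define f where "f t = exp_blinfun (t *\<^sub>R D) (l v)" for t
      have fe: "f t \<bullet> e = exp (t * (D e \<bullet> e)) * (l v \<bullet> e)" if "e \<in> E" for t e
        unfolding f_def
        using diag_on_exp_inner[OF symmetric_maps_scaleR[OF p_symmetric[OF D(1)]] diag_on_scaleR[OF D(2)] that]
        by (simp add: blinfun.scaleR_left)
      have "((\<lambda>t. f t \<bullet> e) \<longlongrightarrow> 0) at_top" if e: "e \<in> E" for e
      proof (cases "D e \<bullet> e < 0")
        case True
        then have "((\<lambda>t. (l v \<bullet> e + 0 * t) * exp (- (- (D e \<bullet> e) * t))) \<longlongrightarrow> 0) at_top"
          by (intro linear_times_exp_tendsto_zero) simp
        then show ?thesis by (simp add: fe[OF e] mult.commute)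
      next
        case False
        then show ?thesis using l(2)[of e] e by (simp add: fe S_def)
      qed
      then have "((\<lambda>t. \<Sum>e\<in>E. (f t \<bullet> e) *\<^sub>R e) \<longlongrightarrow> (\<Sum>e\<in>E. 0 *\<^sub>R e)) at_top"
        by (intro tendsto_sum tendsto_scaleR tendsto_const)
      then have "(f \<longlongrightarrow> 0) at_top" by (simp add: onb_expand[OF E])
      moreover have "f t \<in> closure (orbit G v)" for t
        unfolding f_def using orbit_apply[OF orbit_I[OF K_mem[OF l(1)]] p_exp_mem[OF D(1)]] closure_subset by blast
      ultimately have "0 \<in> closure (orbit G v)"
        by (intro Lim_in_closed_set[of _ f at_top]) auto
      then show "v \<in> null_cone G" by (simp add: null_cone_def)
    qed
  qed
  moreover have "closed (C I)" for I
    unfolding closed_sequential_limits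
  proof (intro allI impI, elim conjE)
    fix x v assume x: "\<forall>n. x n \<in> C I" and lim: "x \<longlonglongrightarrow> v"
    from x obtain l where l: "\<And>n. l n \<in> K" "\<And>n e. e \<in> E - I \<Longrightarrow> l n (x n) \<bullet> e = 0"
      unfolding C_def by (simp add: Ball_def Bex_def) metis
    obtain k r where k: "k \<in> K" "strict_mono r" "(\<lambda>n. l (r n)) \<longlonglongrightarrow> k" using K_subseq[of l, OF l(1)] by blast
    have "k v \<bullet> e = 0" if e: "e \<in> E - I" for e
    proof -
      have "(\<lambda>n. l (r n) (x (r n)) \<bullet> e) \<longlonglongrightarrow> k v \<bullet> e"
        using LIMSEQ_subseq_LIMSEQ[OF lim k(2)] by (intro tendsto_intros k) (simp add: o_def)
      then show ?thesis by (simp add: l(2)[OF e] LIMSEQ_const_iff)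
    qed
    then show "v \<in> C I" using k(1) by (auto simp: C_def)
  qed
  moreover have "finite \<I>"
    by (rule finite_subset[of _ "Pow E"]) (use onb_finite[OF E] in \<open>auto simp: \<I>_def S_def\<close>)
  ultimately show ?thesis by (simp add: closed_UN)
qed

end

section \<open>Orbits of minimal vectors are closed\<close>

definition frob :: "('a::euclidean_space \<Rightarrow>\<^sub>L 'a) \<Rightarrow> real" where
  "frob g = (\<Sum>b\<in>Basis. (norm (g b))\<^sup>2)"

lemma frob_onb:
  fixes g :: "'a::euclidean_space \<Rightarrow>\<^sub>L 'a"
  assumes E: "onb E"
  shows "(\<Sum>e\<in>E. (norm (g e))\<^sup>2) = frob g"
proof -
  have adj: "(\<Sum>e\<in>F. (norm (g e))\<^sup>2) = (\<Sum>b\<in>Basis. (norm (adjoint g b))\<^sup>2)" if F: "onb F" for F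
  proof -
    have "(\<Sum>e\<in>F. (norm (g e))\<^sup>2) = (\<Sum>e\<in>F. \<Sum>b\<in>Basis. (adjoint g b \<bullet> e)\<^sup>2)"
    proof (rule sum.cong[OF refl])
      fix e
      have "g e \<bullet> b = adjoint g b \<bullet> e" for b
        using adjoint_works[OF bounded_linear.linear[OF blinfun.bounded_linear_right], of e g b]
        by (simp add: inner_commute)
      then show "(norm (g e))\<^sup>2 = (\<Sum>b\<in>Basis. (adjoint g b \<bullet> e)\<^sup>2)"
        by (simp add: onb_norm_eq[OF onb_Basis, of "g e"])
    qed
    also have "\<dots> = (\<Sum>b\<in>Basis. \<Sum>e\<in>F. (adjoint g b \<bullet> e)\<^sup>2)" by (rule sum.swap)
    also have "\<dots> = (\<Sum>b\<in>Basis. (norm (adjoint g b))\<^sup>2)" by (simp only: onb_norm_eq[OF F])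
    finally show ?thesis .
  qed
  show ?thesis unfolding frob_def adj[OF E] adj[OF onb_Basis] ..
qed

lemma frob_nonneg: "0 \<le> frob g"
  by (simp add: frob_def sum_nonneg)

lemma norm_le_frob:
  fixes g :: "'a::euclidean_space \<Rightarrow>\<^sub>L 'a"
  shows "norm g \<le> real DIM('a) * (1 + frob g)"
proof -
  have "norm (g b) \<le> 1 + frob g" if "b \<in> Basis" for b
  proof -
    have "(norm (g b))\<^sup>2 \<le> frob g"
      unfolding frob_def by (rule member_le_sum[OF that]) auto
    moreover have "norm (g b) \<le> 1 + (norm (g b))\<^sup>2"
    proof -
      have "0 \<le> (norm (g b) - 1)\<^sup>2" by simp
      then have "2 * norm (g b) \<le> 1 + (norm (g b))\<^sup>2" by (simp add: power2_diff)
      then show ?thesis using norm_ge_zero[of "g b"] by linarith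
    qed
    ultimately show ?thesis by linarith
  qed
  then have "(\<Sum>b\<in>Basis. norm (g b)) \<le> real DIM('a) * (1 + frob g)"
    by (rule sum_bounded_above)
  then show ?thesis using norm_blinfun_euclidean_le[of g] by linarith
qed

text \<open>For \<open>B\<close> close to the direction of \<open>A\<close>, the largest eigenvalue of \<open>A\<close> dominates the sum.\<close>

lemma sinh_pairing_positive:
  fixes A B :: "'a::euclidean_space \<Rightarrow>\<^sub>L 'a"
  assumes A: "A \<in> symmetric_maps" and F: "onb F" "diag_on F A" and A0: "A \<noteq> 0"
    and close: "norm (B - (1 / norm A) *\<^sub>R A) * real DIM('a) < 1"
  shows "(\<Sum>f\<in>F. (exp (2 * (A f \<bullet> f)) - exp (- (2 * (A f \<bullet> f)))) * (B f \<bullet> f)) > 0"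
proof -
  define t where "t = norm A"
  define S where "S x = exp (2 * x) - exp (- (2 * x))" for x :: real
  define \<epsilon> where "\<epsilon> = norm (B - (1 / t) *\<^sub>R A)"
  define a where "a f = A f \<bullet> f" for f
  have t: "t > 0" using A0 by (simp add: t_def)
  have fin: "finite F" using F(1) by (rule onb_finite)
  have at: "\<bar>a f\<bar> \<le> t" if "f \<in> F" for f
    unfolding a_def t_def by (rule diag_on_abs_le_norm[OF F(1) that])
  have S_odd: "S (- x) = - S x" for x by (simp add: S_def)
  have S_mono: "S x \<le> S y" if "x \<le> y" for x y
    using that by (simp add: S_def diff_mono)
  have S0: "S 0 = 0" by (simp add: S_def)
  have St: "S t > 0" using t by (simp add: S_def)
  have S_abs: "\<bar>S x\<bar> \<le> S t" if "\<bar>x\<bar> \<le> t" for x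
    using S_mono[of x t] S_mono[of "- t" x] that by (auto simp: S_odd abs_le_iff)
  have S_pos: "S x * x \<ge> 0" for x
    using S_mono[of 0 x] S_mono[of x 0] S0 by (cases "x \<ge> 0") (auto intro: mult_nonneg_nonneg mult_nonpos_nonpos)
  have summand: "S (a f) * (B f \<bullet> f) \<ge> S (a f) * a f / t - S t * \<epsilon>" if f: "f \<in> F" for f
  proof -
    have "B f \<bullet> f = a f / t + (B - (1 / t) *\<^sub>R A) f \<bullet> f"
      by (simp add: blinfun.diff_left blinfun.scaleR_left inner_diff_left a_def)
    then have "S (a f) * (B f \<bullet> f) = S (a f) * a f / t + S (a f) * ((B - (1 / t) *\<^sub>R A) f \<bullet> f)"
      by (simp add: distrib_left)
    moreover have "\<bar>S (a f) * ((B - (1 / t) *\<^sub>R A) f \<bullet> f)\<bar> \<le> S t * \<epsilon>"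
      unfolding abs_mult \<epsilon>_def
      by (intro mult_mono S_abs at f diag_on_abs_le_norm[OF F(1)]) (use St in auto)
    ultimately show ?thesis by linarith
  qed
  obtain f0 where f0: "f0 \<in> F" "\<bar>a f0\<bar> = t"
    using diag_on_norm_attained[OF F(1) A F(2)] by (auto simp: a_def t_def)
  have "S (a f0) * a f0 / t = S t"
    using f0(2) t S_odd[of t] by (cases "a f0 \<ge> 0") (auto simp: abs_if split: if_splits)
  then have "S t \<le> (\<Sum>f\<in>F. S (a f) * a f / t)"
    using member_le_sum[OF f0(1), of "\<lambda>f. S (a f) * a f / t"] S_pos t fin by simp
  then have "S t - real (card F) * (S t * \<epsilon>) \<le> (\<Sum>f\<in>F. S (a f) * a f / t - S t * \<epsilon>)"
    by (simp add: sum_subtractf)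
  also have "\<dots> \<le> (\<Sum>f\<in>F. S (a f) * (B f \<bullet> f))" by (intro sum_mono summand)
  finally have ge: "S t - real (card F) * (S t * \<epsilon>) \<le> (\<Sum>f\<in>F. S (a f) * (B f \<bullet> f))" .
  have "real (card F) * (S t * \<epsilon>) \<le> real DIM('a) * (S t * \<epsilon>)"
    using onb_card[OF F(1)] St by (intro mult_right_mono) (auto simp: \<epsilon>_def)
  also have "\<dots> = S t * (\<epsilon> * real DIM('a))" by (simp add: mult_ac)
  also have "\<dots> < S t * 1" using St close by (intro mult_strict_left_mono) (auto simp: \<epsilon>_def t_def)
  finally show ?thesis using ge by (simp add: S_def a_def)
qed

context reductive
begin

lemma coset_minimizer:
  assumes g: "g \<in> G"
  obtains q q' where "q \<in> G" "q o\<^sub>L q' = id_blinfun" "q' o\<^sub>L q = id_blinfun" "q w = g w"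
    "\<And>p p'. p \<in> G \<Longrightarrow> p o\<^sub>L p' = id_blinfun \<Longrightarrow> p' o\<^sub>L p = id_blinfun \<Longrightarrow> p w = g w \<Longrightarrow>
       frob q + frob q' \<le> frob p + frob p'"
proof -
  obtain g' where g': "g o\<^sub>L g' = id_blinfun" "g' o\<^sub>L g = id_blinfun" by (rule inverse_mem[OF g]) blast
  define M where "M = frob g + frob g'"
  define S where "S = {(p, p'). p \<in> G \<and> p o\<^sub>L p' = id_blinfun \<and> p' o\<^sub>L p = id_blinfun \<and> p w = g w \<and>
     frob p + frob p' \<le> M}"
  have "bounded S"
    unfolding bounded_iff
  proof (intro exI ballI)
    fix z assume "z \<in> S"
    then obtain p p' where z: "z = (p, p')" "frob p + frob p' \<le> M" by (auto simp: S_def)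
    have "norm z \<le> norm p + norm p'" unfolding z by (rule norm_Pair_le)
    also have "\<dots> \<le> real DIM('a) * (1 + M) + real DIM('a) * (1 + M)"
      using z(2) frob_nonneg[of p] frob_nonneg[of p']
      by (intro add_mono order_trans[OF norm_le_frob] mult_left_mono) auto
    finally show "norm z \<le> real DIM('a) * (1 + M) + real DIM('a) * (1 + M)" .
  qed
  moreover have "closed S"
    unfolding closed_sequential_limits
  proof (intro allI impI, elim conjE)
    fix x z assume x: "\<forall>n. x n \<in> S" and "x \<longlonglongrightarrow> z"
    define p p' where "p n = fst (x n)" and "p' n = snd (x n)" for n
    have lim: "p \<longlonglongrightarrow> fst z" "p' \<longlonglongrightarrow> snd z"
      unfolding p_def p'_def by (intro tendsto_fst tendsto_snd \<open>x \<longlonglongrightarrow> z\<close>)+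
    have p: "p n \<in> G" "p n o\<^sub>L p' n = id_blinfun" "p' n o\<^sub>L p n = id_blinfun" "p n w = g w"
      "frob (p n) + frob (p' n) \<le> M" for n
      using x by (auto simp: S_def p_def p'_def case_prod_beta)
    have "(\<lambda>n. (p n o\<^sub>L p' n)) \<longlonglongrightarrow> (fst z o\<^sub>L snd z)" "(\<lambda>n. p' n o\<^sub>L p n) \<longlonglongrightarrow> (snd z o\<^sub>L fst z)"
      by (intro bounded_bilinear.tendsto[OF bounded_bilinear_blinfun_compose] lim)+
    then have inv: "fst z o\<^sub>L snd z = id_blinfun" "snd z o\<^sub>L fst z = id_blinfun"
      by (simp_all add: p LIMSEQ_const_iff)
    have "(\<lambda>n. p n w) \<longlonglongrightarrow> fst z w" by (intro tendsto_intros lim)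
    then have zw: "fst z w = g w" by (simp add: p LIMSEQ_const_iff)
    have fr: "(\<lambda>n. frob (u n)) \<longlonglongrightarrow> frob u'" if "u \<longlonglongrightarrow> u'" for u and u' :: "'a \<Rightarrow>\<^sub>L 'a"
      unfolding frob_def by (intro tendsto_intros that)
    have "frob (fst z) + frob (snd z) \<le> M"
      by (rule LIMSEQ_le_const2[OF tendsto_add[OF fr[OF lim(1)] fr[OF lim(2)]]]) (use p(5) in blast)
    then show "z \<in> S"
      using limit_mem[OF p(1) lim(1) inv] inv zw by (simp add: S_def case_prod_beta)
  qed
  ultimately have "compact S" by (simp add: compact_eq_bounded_closed)
  moreover have "(g, g') \<in> S" using g g' by (simp add: S_def M_def)
  moreover have "continuous_on S (\<lambda>z. frob (fst z) + frob (snd z))"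
    unfolding frob_def by (intro continuous_intros)
  ultimately obtain z where z: "z \<in> S" "\<And>y. y \<in> S \<Longrightarrow> frob (fst z) + frob (snd z) \<le> frob (fst y) + frob (snd y)"
    using continuous_attains_inf[of S "\<lambda>z. frob (fst z) + frob (snd z)"] by blast
  have zS: "fst z \<in> G" "fst z o\<^sub>L snd z = id_blinfun" "snd z o\<^sub>L fst z = id_blinfun" "fst z w = g w"
    "frob (fst z) + frob (snd z) \<le> M"
    using z(1) by (auto simp: S_def)
  show thesis
  proof (rule that[OF zS(1-4)])
    fix p p' assume p: "p \<in> G" "p o\<^sub>L p' = id_blinfun" "p' o\<^sub>L p = id_blinfun" "p w = g w"
    show "frob (fst z) + frob (snd z) \<le> frob p + frob p'"
    proof (cases "frob p + frob p' \<le> M")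
      case True
      then show ?thesis using z(2)[of "(p, p')"] p by (simp add: S_def)
    qed (use zS(5) in simp)
  qed
qed

lemma coset_minimizer_stationary:
  assumes q: "q \<in> G" "q o\<^sub>L q' = id_blinfun" "q' o\<^sub>L q = id_blinfun" "q w = x"
    and min: "\<And>p p'. p \<in> G \<Longrightarrow> p o\<^sub>L p' = id_blinfun \<Longrightarrow> p' o\<^sub>L p = id_blinfun \<Longrightarrow> p w = x \<Longrightarrow>
       frob q + frob q' \<le> frob p + frob p'"
    and kA: "k \<in> K" "A \<in> \<pp>" "q = k o\<^sub>L exp_blinfun A"
    and B: "B \<in> \<pp>" "B w = 0" and F: "onb F" "diag_on F A"
  shows "(\<Sum>f\<in>F. (exp (2 * (A f \<bullet> f)) - exp (- (2 * (A f \<bullet> f)))) * (B f \<bullet> f)) = 0"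
proof -
  note As = p_symmetric[OF kA(2)] and Bs = p_symmetric[OF B(1)]
  obtain E where E: "onb E" "diag_on E B" using symmetric_diagonalizable[OF Bs] .
  define \<beta> where "\<beta> e = B e \<bullet> e" for e
  define \<psi> where "\<psi> s = (\<Sum>e\<in>E. exp (2 * (s * \<beta> e)) * (norm (exp_blinfun A e))\<^sup>2 +
      exp (- (2 * (s * \<beta> e))) * (norm (exp_blinfun (- A) e))\<^sup>2)" for s
  obtain l where l: "l \<in> K" "\<And>x. k (l x) = x" "\<And>x. l (k x) = x" "\<And>x y. k x \<bullet> y = x \<bullet> l y"
    by (rule K_inverse[OF kA(1)]) blast
  have qq: "q (q' x) = x" "q' (q x) = x" for x
    using arg_cong[OF q(2), of "\<lambda>f. f x"] arg_cong[OF q(3), of "\<lambda>f. f x"] by simp_all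
  have q': "q' x = exp_blinfun (- A) (l x)" for x
  proof -
    have "q (exp_blinfun (- A) (l x)) = x" by (simp add: kA(3) l(2))
    then show ?thesis using qq(2)[of "exp_blinfun (- A) (l x)"] by simp
  qed
  have frobs: "frob (q o\<^sub>L exp_blinfun (s *\<^sub>R B)) + frob (exp_blinfun (- (s *\<^sub>R B)) o\<^sub>L q') = \<psi> s" for s
  proof -
    have "frob (q o\<^sub>L exp_blinfun (s *\<^sub>R B)) = (\<Sum>e\<in>E. exp (2 * (s * \<beta> e)) * (norm (exp_blinfun A e))\<^sup>2)"
      unfolding frob_onb[OF E(1), symmetric]
    proof (rule sum.cong[OF refl])
      fix e assume e: "e \<in> E"
      have "(s *\<^sub>R B) e = (s * \<beta> e) *\<^sub>R e"
        using E(2) e unfolding diag_on_def \<beta>_def by (metis blinfun.scaleR_left scaleR_scaleR)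
      from exp_blinfun_eigenvector[OF this]
      show "(norm ((q o\<^sub>L exp_blinfun (s *\<^sub>R B)) e))\<^sup>2 = exp (2 * (s * \<beta> e)) * (norm (exp_blinfun A e))\<^sup>2"
        by (simp add: blinfun.scaleR_right kA power_mult_distrib exp_double)
    qed
    moreover have "frob (exp_blinfun (- (s *\<^sub>R B)) o\<^sub>L q') =
        (\<Sum>e\<in>E. exp (- (2 * (s * \<beta> e))) * (norm (exp_blinfun (- A) e))\<^sup>2)"
    proof -
      have m: "- (s *\<^sub>R B) \<in> symmetric_maps" "diag_on E (- (s *\<^sub>R B))"
        using symmetric_maps_scaleR[OF Bs, of "- s"] diag_on_scaleR[OF E(2), of "- s"] by simp_all
      have "frob (exp_blinfun (- (s *\<^sub>R B)) o\<^sub>L q') =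
          (\<Sum>b\<in>Basis. \<Sum>e\<in>E. exp (- (2 * (s * \<beta> e))) * (q' b \<bullet> e)\<^sup>2)"
        unfolding frob_def blinfun_apply_blinfun_compose diag_on_exp_norm[OF E(1) m]
        by (simp add: \<beta>_def blinfun.scaleR_left blinfun.minus_left)
      also have "\<dots> = (\<Sum>e\<in>E. \<Sum>b\<in>Basis. exp (- (2 * (s * \<beta> e))) * (q' b \<bullet> e)\<^sup>2)" by (rule sum.swap)
      also have "\<dots> = (\<Sum>e\<in>E. exp (- (2 * (s * \<beta> e))) * (norm (exp_blinfun (- A) e))\<^sup>2)"
      proof (rule sum.cong[OF refl])
        fix e
        have "- A \<in> symmetric_maps" using symmetric_maps_scaleR[OF As, of "- 1"] by simp
        from exp_symmetric[OF this]
        have "q' b \<bullet> e = l b \<bullet> exp_blinfun (- A) e" for b by (simp add: q')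
        then have "q' b \<bullet> e = k (exp_blinfun (- A) e) \<bullet> b" for b
          using l(4)[of "exp_blinfun (- A) e" b] by (simp add: inner_commute)
        then have "(\<Sum>b\<in>Basis. (q' b \<bullet> e)\<^sup>2) = (norm (k (exp_blinfun (- A) e)))\<^sup>2"
          by (simp add: onb_norm_eq[OF onb_Basis])
        then show "(\<Sum>b\<in>Basis. exp (- (2 * (s * \<beta> e))) * (q' b \<bullet> e)\<^sup>2) =
            exp (- (2 * (s * \<beta> e))) * (norm (exp_blinfun (- A) e))\<^sup>2"
          using kA(1) by (simp add: sum_distrib_left[symmetric])
      qed
      finally show ?thesis .
    qed
    ultimately show ?thesis by (simp add: \<psi>_def sum.distrib)
  qed
  have "\<psi> 0 \<le> \<psi> s" for s
  proof -
    have "frob q + frob q' \<le> frob (q o\<^sub>L exp_blinfun (s *\<^sub>R B)) + frob (exp_blinfun (- (s *\<^sub>R B)) o\<^sub>L q')"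
    proof (rule min)
      show "q o\<^sub>L exp_blinfun (s *\<^sub>R B) \<in> G" by (intro mult_mem q p_exp_mem B)
      show "q o\<^sub>L exp_blinfun (s *\<^sub>R B) o\<^sub>L (exp_blinfun (- (s *\<^sub>R B)) o\<^sub>L q') = id_blinfun"
        by (rule blinfun_eqI) (simp add: qq)
      show "exp_blinfun (- (s *\<^sub>R B)) o\<^sub>L q' o\<^sub>L (q o\<^sub>L exp_blinfun (s *\<^sub>R B)) = id_blinfun"
        by (rule blinfun_eqI) (simp add: qq)
      have "exp_blinfun (s *\<^sub>R B) w = w" by (rule exp_fixes) (simp add: blinfun.scaleR_left B)
      then show "(q o\<^sub>L exp_blinfun (s *\<^sub>R B)) w = x" by (simp add: q(4))
    qed
    moreover have "q o\<^sub>L exp_blinfun (0 *\<^sub>R B) = q" "exp_blinfun (- (0 *\<^sub>R B)) o\<^sub>L q' = q'"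
      by (rule blinfun_eqI; simp)+
    ultimately show ?thesis using frobs[of s] frobs[of 0] by simp
  qed
  moreover have "(\<psi> has_real_derivative (\<Sum>e\<in>E. 2 * \<beta> e * (norm (exp_blinfun A e))\<^sup>2 +
      - (2 * \<beta> e) * (norm (exp_blinfun (- A) e))\<^sup>2)) (at 0)"
    unfolding \<psi>_def by (auto intro!: derivative_eq_intros sum.cong)
  ultimately have z: "(\<Sum>e\<in>E. 2 * \<beta> e * (norm (exp_blinfun A e))\<^sup>2 +
      - (2 * \<beta> e) * (norm (exp_blinfun (- A) e))\<^sup>2) = 0"
    using DERIV_local_min[of \<psi> _ 0 1] by simp
  have m: "- A \<in> symmetric_maps" "diag_on F (- A)"
    using symmetric_maps_scaleR[OF As, of "- 1"] diag_on_scaleR[OF F(2), of "- 1"] by simp_all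
  have "(\<Sum>f\<in>F. (exp (2 * (A f \<bullet> f)) - exp (- (2 * (A f \<bullet> f)))) * (B f \<bullet> f)) =
      (\<Sum>f\<in>F. \<Sum>e\<in>E. (exp (2 * (A f \<bullet> f)) - exp (- (2 * (A f \<bullet> f)))) * (\<beta> e * (f \<bullet> e)\<^sup>2))"
  proof (rule sum.cong[OF refl])
    fix f
    have "B f \<bullet> f = (\<Sum>e\<in>E. \<beta> e * (f \<bullet> e)\<^sup>2)"
      unfolding \<beta>_def by (rule diag_on_quadratic[OF E(1) Bs E(2)])
    then show "(exp (2 * (A f \<bullet> f)) - exp (- (2 * (A f \<bullet> f)))) * (B f \<bullet> f) =
        (\<Sum>e\<in>E. (exp (2 * (A f \<bullet> f)) - exp (- (2 * (A f \<bullet> f)))) * (\<beta> e * (f \<bullet> e)\<^sup>2))"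
      by (simp only: sum_distrib_left)
  qed
  also have "\<dots> = (\<Sum>e\<in>E. \<Sum>f\<in>F. (exp (2 * (A f \<bullet> f)) - exp (- (2 * (A f \<bullet> f)))) * (\<beta> e * (f \<bullet> e)\<^sup>2))"
    by (rule sum.swap)
  also have "\<dots> = (\<Sum>e\<in>E. \<beta> e * ((norm (exp_blinfun A e))\<^sup>2 - (norm (exp_blinfun (- A) e))\<^sup>2))"
    unfolding diag_on_exp_norm[OF F(1) As F(2)] diag_on_exp_norm[OF F(1) m] sum_subtractf[symmetric] sum_distrib_left
    by (intro sum.cong refl) (simp add: blinfun.minus_left algebra_simps inner_commute)
  also have "\<dots> = 0"
  proof -
    have "2 * (\<Sum>e\<in>E. \<beta> e * ((norm (exp_blinfun A e))\<^sup>2 - (norm (exp_blinfun (- A) e))\<^sup>2)) =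
      (\<Sum>e\<in>E. 2 * \<beta> e * (norm (exp_blinfun A e))\<^sup>2 + - (2 * \<beta> e) * (norm (exp_blinfun (- A) e))\<^sup>2)"
      unfolding sum_distrib_left by (rule sum.cong) (simp_all add: algebra_simps)
    then show ?thesis using z by simp
  qed
  finally show ?thesis .
qed

text \<open>Representatives \<open>q\<^sub>n = k\<^sub>n exp(A\<^sub>n)\<close> of smallest Frobenius size modulo the stabiliser of \<open>w\<close> stay
  bounded: otherwise a limit direction of \<open>A\<^sub>n\<close> would fix \<open>w\<close> and contradict stationarity.\<close>

theorem minimal_orbit_closed:
  assumes w: "w \<in> \<M>"
  shows "closed (orbit G w)"
  unfolding closed_sequential_limits
proof (intro allI impI, elim conjE)
  fix x y assume x: "\<forall>n. x n \<in> orbit G w" and lim: "x \<longlonglongrightarrow> y"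
  define stationary where "stationary A \<longleftrightarrow> (\<forall>B\<in>\<pp>. \<forall>F. B w = 0 \<longrightarrow> onb F \<longrightarrow> diag_on F A \<longrightarrow>
        (\<Sum>f\<in>F. (exp (2 * (A f \<bullet> f)) - exp (- (2 * (A f \<bullet> f)))) * (B f \<bullet> f)) = 0)" for A :: "'a \<Rightarrow>\<^sub>L 'a"
  have "\<exists>k A. k \<in> K \<and> A \<in> \<pp> \<and> x n = k (exp_blinfun A w) \<and> stationary A" for n
  proof -
    obtain g where g: "g \<in> G" "x n = g w" using x by (auto simp: orbit_def)
    obtain q q' where q: "q \<in> G" "q o\<^sub>L q' = id_blinfun" "q' o\<^sub>L q = id_blinfun" "q w = g w"
      and min: "\<And>p p'. p \<in> G \<Longrightarrow> p o\<^sub>L p' = id_blinfun \<Longrightarrow> p' o\<^sub>L p = id_blinfun \<Longrightarrow> p w = g w \<Longrightarrow>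
        frob q + frob q' \<le> frob p + frob p'"
      by (rule coset_minimizer[OF g(1), of w]) (rule that)
    obtain k A where kA: "k \<in> K" "A \<in> \<pp>" "q = k o\<^sub>L exp_blinfun A" using polar[OF q(1)] .
    show ?thesis
      unfolding stationary_def
    proof (intro exI conjI ballI allI impI)
      show "x n = k (exp_blinfun A w)" using g q(4) kA(3) by simp
      fix B F assume BF: "B \<in> \<pp>" "B w = 0" "onb F" "diag_on F A"
      show "(\<Sum>f\<in>F. (exp (2 * (A f \<bullet> f)) - exp (- (2 * (A f \<bullet> f)))) * (B f \<bullet> f)) = 0"
        by (rule coset_minimizer_stationary[OF q _ kA BF]) (rule min)
    qed (fact kA)+
  qed
  then obtain k A where k: "\<And>n. k n \<in> K" and A: "\<And>n. A n \<in> \<pp>" and xk: "\<And>n. x n = k n (exp_blinfun (A n) w)"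
    and st: "\<And>n. stationary (A n)"
    by metis
  obtain C where C: "\<And>n. norm (x n) \<le> C"
    using convergent_imp_Bseq[OF convergentI[OF lim]] by (auto simp: Bseq_def)
  have expC: "norm (exp_blinfun (A n) w) \<le> C" for n using C[of n] xk[of n] k[of n] by simp
  have "bounded (range A)"
  proof (rule ccontr)
    assume "\<not> bounded (range A)"
    then have "\<forall>n::nat. \<exists>m. norm (A m) > real n + 1"
      unfolding bounded_iff by (auto simp: not_le)
    then obtain m where m: "\<And>n::nat. norm (A (m n)) > real n + 1" by metis
    define T where "T n = norm (A (m n))" for n
    have T: "T n > real n + 1" for n using m by (simp add: T_def)
    then have T1: "T n \<ge> 1" for n by (smt (verit) of_nat_0_le_iff)
    define B where "B n = (1 / T n) *\<^sub>R A (m n)" for n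
    have nB: "norm (B n) = 1" for n
      using less_le_trans[OF zero_less_one T1[of n]] by (simp add: B_def T_def)
    have "bounded (range B)" using nB by (auto simp: bounded_iff)
    then obtain B' r where B': "strict_mono (r :: nat \<Rightarrow> nat)" "(\<lambda>n. B (r n)) \<longlonglongrightarrow> B'"
      using bounded_imp_convergent_subsequence[of B] unfolding o_def by blast
    have B'p: "B' \<in> \<pp>"
      by (rule p_closed[OF _ B'(2)]) (simp add: B_def p_scaleR A)
    have "norm (exp_blinfun B' w) \<le> norm w"
    proof -
      have "(norm (exp_blinfun (B n) w))\<^sup>2 \<le> (norm w)\<^sup>2 + (1 / T n) * C\<^sup>2" for n
      proof -
        have s: "0 \<le> 1 / T n" "1 / T n \<le> 1" using T1[of n] by auto
        have "(norm (exp_blinfun (B n) w))\<^sup>2 \<le> (1 - 1 / T n) * (norm w)\<^sup>2 + (1 / T n) * (norm (exp_blinfun (A (m n)) w))\<^sup>2"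
          unfolding B_def by (rule exp_symmetric_norm_convex[OF p_symmetric[OF A] s])
        also have "\<dots> \<le> 1 * (norm w)\<^sup>2 + (1 / T n) * C\<^sup>2"
          using s expC[of "m n"] by (intro add_mono mult_right_mono mult_left_mono power_mono) auto
        finally show ?thesis by simp
      qed
      then have le: "(norm (exp_blinfun (B (r n)) w))\<^sup>2 \<le> (norm w)\<^sup>2 + (1 / T (r n)) * C\<^sup>2" for n .
      have "(\<lambda>n. 1 / T n) \<longlonglongrightarrow> 0"
      proof (rule Lim_null_comparison[OF _ LIMSEQ_inverse_real_of_nat])
        show "\<forall>\<^sub>F n in sequentially. norm (1 / T n) \<le> inverse (real (Suc n))"
        proof (rule always_eventually, rule allI)
          fix n show "norm (1 / T n) \<le> inverse (real (Suc n))"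
            using T[of n] T1[of n] by (simp add: inverse_eq_divide frac_le)
        qed
      qed
      from LIMSEQ_subseq_LIMSEQ[OF this B'(1)]
      have "(\<lambda>n. 1 / T (r n)) \<longlonglongrightarrow> 0" by (simp add: o_def)
      then have lim2: "(\<lambda>n. (norm w)\<^sup>2 + (1 / T (r n)) * C\<^sup>2) \<longlonglongrightarrow> (norm w)\<^sup>2 + 0 * C\<^sup>2"
        by (intro tendsto_intros)
      have lim1: "(\<lambda>n. (norm (exp_blinfun (B (r n)) w))\<^sup>2) \<longlonglongrightarrow> (norm (exp_blinfun B' w))\<^sup>2"
        by (intro tendsto_intros tendsto_exp_blinfun B')
      have "(norm (exp_blinfun B' w))\<^sup>2 \<le> (norm w)\<^sup>2 + 0 * C\<^sup>2"
        by (rule LIMSEQ_le[OF lim1 lim2]) (use le in blast)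
      then have "(norm (exp_blinfun B' w))\<^sup>2 \<le> (norm w)\<^sup>2" by simp
      then show ?thesis by (rule power2_le_imp_le) simp
    qed
    then have B'w: "B' w = 0" by (rule minimal_stable[OF w B'p])
    have "(\<lambda>n. norm (B' - B (r n)) * real DIM('a)) \<longlonglongrightarrow> norm (B' - B') * real DIM('a)"
      by (intro tendsto_intros B')
    then have "\<forall>\<^sub>F n in sequentially. norm (B' - B (r n)) * real DIM('a) < 1"
      by (rule order_tendstoD) simp
    then obtain n where n: "norm (B' - B (r n)) * real DIM('a) < 1"
      by (auto simp: eventually_sequentially)
    define A' where "A' = A (m (r n))"
    obtain F where F: "onb F" "diag_on F A'"
      using symmetric_diagonalizable[OF p_symmetric[OF A]] unfolding A'_def by blast
    have "A' \<noteq> 0" using T1[of "r n"] by (auto simp: A'_def T_def)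
    then have "(\<Sum>f\<in>F. (exp (2 * (A' f \<bullet> f)) - exp (- (2 * (A' f \<bullet> f)))) * (B' f \<bullet> f)) > 0"
      using n by (intro sinh_pairing_positive F) (auto simp: A'_def B_def T_def intro: p_symmetric A)
    moreover have "(\<Sum>f\<in>F. (exp (2 * (A' f \<bullet> f)) - exp (- (2 * (A' f \<bullet> f)))) * (B' f \<bullet> f)) = 0"
      using st[of "m (r n)"] B'p B'w F unfolding stationary_def A'_def by blast
    ultimately show False by simp
  qed
  then obtain A' r where A': "strict_mono (r :: nat \<Rightarrow> nat)" "(\<lambda>n. A (r n)) \<longlonglongrightarrow> A'"
    using bounded_imp_convergent_subsequence[of A] unfolding o_def by blast
  obtain k' s where k': "k' \<in> K" "strict_mono s" "(\<lambda>n. k (r (s n))) \<longlonglongrightarrow> k'"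
    using K_subseq[of "\<lambda>n. k (r n)", OF k] by blast
  have A's: "(\<lambda>n. A (r (s n))) \<longlonglongrightarrow> A'" using LIMSEQ_subseq_LIMSEQ[OF A'(2) k'(2)] by (simp add: o_def)
  have A'p: "A' \<in> \<pp>" by (rule p_closed[OF A A'(2)])
  have "(\<lambda>n. x (r (s n))) \<longlonglongrightarrow> k' (exp_blinfun A' w)"
    unfolding xk by (intro tendsto_intros tendsto_exp_blinfun k' A's)
  moreover have "(\<lambda>n. x (r (s n))) \<longlonglongrightarrow> y"
    using LIMSEQ_subseq_LIMSEQ[OF lim strict_mono_o[OF A'(1) k'(2)]] by (simp add: o_def)
  ultimately have "y = k' (exp_blinfun A' w)" using LIMSEQ_unique by blast
  then show "y \<in> orbit G w"
    using orbit_apply[OF orbit_I[OF p_exp_mem_1[OF A'p]] K_mem[OF k'(1)]] by simp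
qed

lemma closed_orbit_minimal:
  assumes "closed (orbit G u)"
  obtains w where "w \<in> orbit G u" "w \<in> \<M>"
  using exists_minimal[of u] assms that by (metis closure_closed)

end

theorem theorem1p1:
  fixes G :: "('a::euclidean_space \<Rightarrow>\<^sub>L 'a) set"
  assumes "real_reductive G"
  shows "(\<forall>v vbar. vbar \<in> orbit G v \<and> vbar \<in> minimal_vectors G \<longrightarrow>
            closed (orbit G v) \<and>
            orbit G vbar \<inter> minimal_vectors G = orbit (K_part G) vbar)
       \<and> (\<forall>v. \<not> closed (orbit G v) \<longrightarrow>
            (\<exists>\<alpha>\<in>p_part G. \<exists>w.
               ((\<lambda>t::real. blinfun_apply (exp_blinfun (t *\<^sub>R \<alpha>)) v) \<longlongrightarrow> w) at_top \<and>
               closed (orbit G w)))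
       \<and> (\<forall>v. \<exists>!C. (\<exists>u. C = orbit G u) \<and> closed C \<and> C \<subseteq> closure (orbit G v))
       \<and> closed (null_cone G)"
proof -
  interpret reductive G by unfold_locales (rule assms)
  have i: "closed (orbit G v) \<and> orbit G w \<inter> minimal_vectors G = orbit (K_part G) w"
    if "w \<in> orbit G v \<and> w \<in> minimal_vectors G" for v w
    using that minimal_orbit_closed[of w] orbit_eq[of w v] orbit_inter_minimal[of w] by simp
  have ii: "\<exists>\<alpha>\<in>p_part G. \<exists>w.
      ((\<lambda>t::real. blinfun_apply (exp_blinfun (t *\<^sub>R \<alpha>)) v) \<longlongrightarrow> w) at_top \<and> closed (orbit G w)" for v
  proof -
    obtain w where w: "w \<in> closure (orbit G v)" "w \<in> minimal_vectors G"
      by (rule exists_minimal)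
    obtain \<alpha> u C \<epsilon> where \<alpha>: "\<alpha> \<in> p_part G" and u: "u \<in> orbit G w" and \<epsilon>: "\<epsilon> > 0"
      and rate: "\<And>t. t \<ge> 0 \<Longrightarrow> norm (exp_blinfun (t *\<^sub>R \<alpha>) v - u) \<le> C * exp (- (\<epsilon> * t))"
      by (rule hilbert_mumford[OF w(2,1)]) blast
    have "((\<lambda>t. (C + 0 * t) * exp (- (\<epsilon> * t))) \<longlongrightarrow> 0) at_top"
      by (rule linear_times_exp_tendsto_zero[OF \<epsilon>])
    then have lim: "((\<lambda>t. C * exp (- (\<epsilon> * t))) \<longlongrightarrow> 0) at_top" by simp
    have "\<forall>\<^sub>F t in at_top. norm (exp_blinfun (t *\<^sub>R \<alpha>) v - u) \<le> C * exp (- (\<epsilon> * t))"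
      using eventually_ge_at_top[of 0] by eventually_elim (rule rate)
    from Lim_null_comparison[OF this lim]
    have "((\<lambda>t. exp_blinfun (t *\<^sub>R \<alpha>) v) \<longlongrightarrow> u) at_top" by (simp add: Lim_null[of _ u])
    moreover have "closed (orbit G u)"
      using minimal_orbit_closed[OF w(2)] orbit_eq[OF u] by simp
    ultimately show ?thesis using \<alpha> by blast
  qed
  have iii: "\<exists>!C. (\<exists>u. C = orbit G u) \<and> closed C \<and> C \<subseteq> closure (orbit G v)" for v
  proof -
    obtain w where w: "w \<in> closure (orbit G v)" "w \<in> minimal_vectors G"
      by (rule exists_minimal)
    show ?thesis
    proof (rule ex1I[of _ "orbit G w"])
      have "orbit G w \<subseteq> closure (orbit G v)"
        using closure_orbit_apply[OF w(1)] by (auto simp: orbit_def)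
      then show "(\<exists>u. orbit G w = orbit G u) \<and> closed (orbit G w) \<and> orbit G w \<subseteq> closure (orbit G v)"
        using minimal_orbit_closed[OF w(2)] by blast
    next
      fix C assume C: "(\<exists>u. C = orbit G u) \<and> closed C \<and> C \<subseteq> closure (orbit G v)"
      then obtain u where u: "C = orbit G u" by blast
      then have "closed (orbit G u)" and sub: "orbit G u \<subseteq> closure (orbit G v)"
        using C by simp_all
      then obtain x where x: "x \<in> orbit G u" "x \<in> minimal_vectors G"
        using closed_orbit_minimal[of u] by metis
      have "orbit G x = orbit G w"
        by (rule minimal_closure_unique[OF x(2) subsetD[OF sub x(1)] w(2,1)])
      then show "C = orbit G w" using orbit_eq[OF x(1)] u by simp
    qed
  qed
  show ?thesis
  proof (intro conjI allI impI)
    fix v w assume "w \<in> orbit G v \<and> w \<in> minimal_vectors G"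
    from i[OF this] show "closed (orbit G v)" "orbit G w \<inter> minimal_vectors G = orbit (K_part G) w"
      by simp_all
  qed (rule ii iii null_cone_closed)+
qed

end
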